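(* Let $N>1$, $s\in(0,1)$, $p\in(1,\infty)$, and let $\Omega\subset\mathbb R^N$ be a bounded domain with $C^{1,1}$ boundary. There exist $\alpha\in(0,s]$ depending only on $N,p,s$, and $C_\Omega>0$ depending only on $N,p,s,\Omega$, such that for every $f\in L^\infty(\Omega)$ and every weak solution $u\in W^{s,p}_0(\Omega)$ of $$(-\Delta)^s_p u=f \ \text{in } \Omega,\qquad u=0 \ \text{in } \Omega^c,$$ one has $u\in C^\alpha(\overline\Omega)$ and $$\|u\|_{C^\alpha(\overline\Omega)}\le C_\Omega\,\|f\|_{L^\infty(\Omega)}^{\frac{1}{p-1}}.$$
   Context: Notation: for $a\in\mathbb R$, $q>0$, $a^{q}:=|a|^{q-1}a$. $\Omega^c=\mathbb R^N\setminus\Omega$. $W^{s,p}_0(\Omega)=\{u\in L^p(\mathbb R^N): \int_{\mathbb R^N\times\mathbb R^N}\frac{|u(x)-u(y)|^p}{|x-y|^{N+ps}}dx\,dy<\infty,\ u=0\text{ a.e. in }\Omega^c\}$. A weak solution $u\in W^{s,p}_0(\Omega)$ of the Dirichlet problem means: for every $\varphi\in W^{s,p}_0(\Omega)$, $$\int_{\mathbb R^N\times\mathbb R^N}\frac{(u(x)-u(y))^{p-1}(\varphi(x)-\varphi(y))}{|x-y|^{N+ps}}\,dx\,dy=\int_\Omega f\varphi\,dx.$$ $C^\alpha(\overline\Omega)$ is the space of continuous functions on $\overline\Omega$ with finite $[u]_{C^\alpha(\overline\Omega)}=\sup_{x\ne y\in\overline\Omega}|u(x)-u(y)|/|x-y|^\alpha$,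 normed by $\|u\|_{L^\infty(\Omega)}+[u]_{C^\alpha(\overline\Omega)}$ (the conclusion means $u$ has such a representative). *)

theory Defs
  imports "HOL-Analysis.Analysis"
begin

definition spow :: "real \<Rightarrow> real \<Rightarrow> real" where
  "spow a q = \<bar>a\<bar> powr (q - 1) * a"

text \<open>Bounded domain with C^{1,1} boundary: near every boundary point, after a
  rigid motion, the domain is the strict epigraph (in some coordinate direction k)
  of a C^{1,1} function (differentiable with Lipschitz derivative) of the other
  coordinates.\<close>
definition C11_domain :: "(real^'n) set \<Rightarrow> bool" where
  "C11_domain \<Omega> \<longleftrightarrow> open \<Omega> \<and> connected \<Omega> \<and> bounded \<Omega> \<and> \<Omega> \<noteq> {} \<and>
     (\<forall>x0 \<in> frontier \<Omega>. \<exists>r>0. \<exists>(R::real^'n \<Rightarrow> real^'n) (k::'n) (\<gamma>::real^'n \<Rightarrow> real)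
          (D::real^'n \<Rightarrow> real^'n \<Rightarrow> real) (L::real).
        orthogonal_transformation R \<and>
        (\<forall>z. \<gamma> z = \<gamma> (z + (- (z $ k)) *\<^sub>R axis k (1::real))) \<and>
        (\<forall>z. (\<gamma> has_derivative D z) (at z)) \<and>
        (\<forall>z w h. \<bar>D z h - D w h\<bar> \<le> L * norm (z - w) * norm h) \<and>
        \<Omega> \<inter> ball x0 r = {x \<in> ball x0 r. R (x - x0) $ k > \<gamma> (R (x - x0))})"

definition gagliardo :: "real \<Rightarrow> real \<Rightarrow> (real^'n \<Rightarrow> real) \<Rightarrow> ennreal" where
  "gagliardo s p u = (\<integral>\<^sup>+ xy. ennreal (\<bar>u (fst xy) - u (snd xy)\<bar> powr p /
        norm (fst xy - snd xy) powr (real CARD('n) + p * s)) \<partial>(lebesgue \<Otimes>\<^sub>M lebesgue))"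

definition W0 :: "real \<Rightarrow> real \<Rightarrow> (real^'n) set \<Rightarrow> (real^'n \<Rightarrow> real) set" where
  "W0 s p \<Omega> = {u. u \<in> borel_measurable lebesgue \<and>
      (\<integral>\<^sup>+ x. ennreal (\<bar>u x\<bar> powr p) \<partial>lebesgue) < \<infinity> \<and>
      gagliardo s p u < \<infinity> \<and>
      (AE x in lebesgue. x \<notin> \<Omega> \<longrightarrow> u x = 0)}"

definition Linf :: "(real^'n) set \<Rightarrow> (real^'n \<Rightarrow> real) set" where
  "Linf \<Omega> = {f. set_borel_measurable lebesgue \<Omega> f \<and>
      (\<exists>C. AE x in lebesgue. x \<in> \<Omega> \<longrightarrow> \<bar>f x\<bar> \<le> C)}"

definition Linf_norm :: "(real^'n) set \<Rightarrow> (real^'n \<Rightarrow> real) \<Rightarrow> real" where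
  "Linf_norm \<Omega> f = Inf {C. 0 \<le> C \<and> (AE x in lebesgue. x \<in> \<Omega> \<longrightarrow> \<bar>f x\<bar> \<le> C)}"

definition weak_solution ::
  "real \<Rightarrow> real \<Rightarrow> (real^'n) set \<Rightarrow> (real^'n \<Rightarrow> real) \<Rightarrow> (real^'n \<Rightarrow> real) \<Rightarrow> bool" where
  "weak_solution s p \<Omega> f u \<longleftrightarrow> u \<in> W0 s p \<Omega> \<and>
     (\<forall>\<phi> \<in> W0 s p \<Omega>.
        (\<integral> xy. spow (u (fst xy) - u (snd xy)) (p - 1) * (\<phi> (fst xy) - \<phi> (snd xy)) /
            norm (fst xy - snd xy) powr (real CARD('n) + p * s) \<partial>(lebesgue \<Otimes>\<^sub>M lebesgue))
        = (\<integral>x\<in>\<Omega>. f x * \<phi> x \<partial>lebesgue))"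

definition holder_quotients :: "(real^'n) set \<Rightarrow> real \<Rightarrow> (real^'n \<Rightarrow> real) \<Rightarrow> real set" where
  "holder_quotients K \<alpha> v = {\<bar>v x - v y\<bar> / dist x y powr \<alpha> | x y. x \<in> K \<and> y \<in> K \<and> x \<noteq> y}"

definition holder_seminorm :: "(real^'n) set \<Rightarrow> real \<Rightarrow> (real^'n \<Rightarrow> real) \<Rightarrow> real" where
  "holder_seminorm K \<alpha> v = Sup (holder_quotients K \<alpha> v)"

definition holder_space :: "(real^'n) set \<Rightarrow> real \<Rightarrow> (real^'n \<Rightarrow> real) set" where
  "holder_space K \<alpha> = {v. continuous_on K v \<and> bdd_above (holder_quotients K \<alpha> v)}"

end

theory Submission
  imports Defs
begin

text \<open>Boundedness follows by testing with \<open>(u - \<kappa>)\<^sup>+\<close>, because the interaction with the exterior, where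
  \<open>u = 0\<close>, controls the integral of the test function. For the Hoelder estimate let \<open>V = u - m\<close> or
  \<open>V = M - u\<close> be nonnegative on a ball \<open>B\<close>, and at least \<open>\<mu>\<close> on a part of \<open>B\<close> of positive density. A small multiple
  of a smooth bump of height \<open>\<mu>\<close> is a subsolution once the nonlocal contribution of that part is added, so by the
  comparison principle \<open>V\<close> is bounded below by a multiple of \<open>\<mu>\<close> on a smaller concentric ball, and the oscillation of
  \<open>u\<close> decays geometrically. Near the boundary the required density is provided by an exterior ball at each
  frontier point, whose relative size does not depend on the domain at small scales, so that the exponent depends
  only on the dimension, \<open>p\<close> and \<open>s\<close>.\<close>

section \<open>Integrals of the singular kernel\<close>

text \<open>The principal value defining the operator need not converge absolutely even for smooth
  functions, so pointwise computations are made with a neighbourhood of the diagonal cut off, and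
  bounds uniform in the cut-off come from averaging over h and -h. For p < 2 the averaged integrand
  still carries a negative power of the increments, worst where the gradient of the bump vanishes;
  hence a bump 1 - |x|^(2i+2) with i large depending on p. The second obstacle is a circularity. The
  exponent \<alpha> dictates how fast u may grow away from the centre, this growth enters the far
  part of the operator, the far part must be beaten by the fixed contribution of the set of positive
  density, and the height \<sigma> of the barrier that survives determines \<alpha>. It is broken
  because the far part, normalised to unit scale and height, tends to 0 with \<sigma>. All competing
  terms scale like \<mu>^(p-1) R^(-ps), so one \<sigma> serves all radii, and the right-hand side
  stays subordinate at small radii because \<alpha>(p-1) \<le> ps.\<close>

definition kern :: "real \<Rightarrow> real^'n \<Rightarrow> real" where
  "kern a h = 1 / norm h powr (real CARD('n) + a)"

lemma kern_nonneg [simp]: "0 \<le> kern a h"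
  by (simp add: kern_def)

lemma kern_minus [simp]: "kern a (- h) = kern a h"
  by (simp add: kern_def)

lemma kern_commute: "kern a (x - y) = kern a (y - x)"
  by (simp add: kern_def norm_minus_commute)

lemma kern_measurable [measurable]: "kern a \<in> borel_measurable borel"
  unfolding kern_def[abs_def] by measurable

lemma kern_scale:
  assumes "r > 0"
  shows "kern a (r *\<^sub>R h :: real^'n) = r powr (- real CARD('n) - a) * kern a h"
proof -
  have "r powr (- real CARD('n) - a) = 1 / r powr (real CARD('n) + a)"
    using assms powr_minus_divide[of r "real CARD('n) + a"] by simp
  then show ?thesis
    using assms by (simp add: kern_def powr_mult)
qed

lemma nn_integral_lborel_affine_scale:
  fixes g :: "'a::euclidean_space \<Rightarrow> ennreal"
  assumes [measurable]: "g \<in> borel_measurable borel" and r: "r > 0"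
  shows "(\<integral>\<^sup>+ y. g ((y - x) /\<^sub>R r) \<partial>lborel) = ennreal (r ^ DIM('a)) * (\<integral>\<^sup>+ h. g h \<partial>lborel)"
proof -
  have "(\<integral>\<^sup>+ y. g ((y - x) /\<^sub>R r) \<partial>lborel)
     = (\<integral>\<^sup>+ y. g ((y - x) /\<^sub>R r) \<partial>density (distr lborel borel (\<lambda>h. x + r *\<^sub>R h)) (\<lambda>_. \<bar>r\<bar> ^ DIM('a)))"
    by (subst lborel_affine[of r x]) (use r in auto)
  also have "\<dots> = ennreal (r ^ DIM('a)) * (\<integral>\<^sup>+ h. g ((x + r *\<^sub>R h - x) /\<^sub>R r) \<partial>lborel)"
    using r by (simp add: nn_integral_density nn_integral_distr nn_integral_cmult)
  finally show ?thesis using r by simp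
qed

lemma nn_integral_lborel_diff:
  fixes g :: "'a::euclidean_space \<Rightarrow> ennreal"
  assumes [measurable]: "g \<in> borel_measurable borel"
  shows "(\<integral>\<^sup>+ y. g (y - x) \<partial>lborel) = (\<integral>\<^sup>+ h. g h \<partial>lborel)"
  using nn_integral_lborel_affine_scale[OF assms, of 1 x] by simp

lemma lborel_distr_reflect:
  "distr lborel borel (\<lambda>h::'a::euclidean_space. x - h) = lborel"
proof -
  have "lborel = density (distr lborel borel (\<lambda>h::'a. x + (-1) *\<^sub>R h)) (\<lambda>_. ennreal (\<bar>-1\<bar> ^ DIM('a)))"
    by (rule lborel_affine) simp
  then show ?thesis by (simp add: density_1)
qed

text \<open>The volume of a set is compared with that of the unit ball by Tonelli's theorem and translation
  invariance, as in the uniqueness proof for Haar measure; an isometry fixes the ball.\<close>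
lemma nn_integral_lborel_orthogonal:
  fixes T :: "'a::euclidean_space \<Rightarrow> 'a" and g :: "'a \<Rightarrow> ennreal"
  assumes T: "orthogonal_transformation T" and g [measurable]: "g \<in> borel_measurable borel"
  shows "(\<integral>\<^sup>+ h. g (T h) \<partial>lborel) = (\<integral>\<^sup>+ h. g h \<partial>lborel)"
proof -
  define b :: "'a \<Rightarrow> ennreal" where "b = indicator (ball 0 1)"
  have lin: "linear T" using T by (rule orthogonal_transformation_linear)
  have T_borel [measurable]: "T \<in> borel_measurable borel"
    using lin by (intro borel_measurable_continuous_onI linear_continuous_on) (simp add: linear_conv_bounded_linear)
  have b_borel [measurable]: "b \<in> borel_measurable borel" unfolding b_def by (intro borel_measurable_indicator) simp
  have bT: "b (T h) = b h" for h
    using T by (simp add: b_def indicator_def orthogonal_transformation_norm)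
  have shift: "(\<integral>\<^sup>+ z. f (z + x) \<partial>lborel) = (\<integral>\<^sup>+ z. f z \<partial>lborel)"
    if "f \<in> borel_measurable borel" for f :: "'a \<Rightarrow> ennreal" and x
    using nn_integral_lborel_diff[OF that, of "- x"] by simp
  have refl: "(\<integral>\<^sup>+ z. g (x - z) \<partial>lborel) = (\<integral>\<^sup>+ z. g z \<partial>lborel)" for x
    by (subst (2) lborel_distr_reflect[of x, symmetric], subst nn_integral_distr) auto
  have "(\<integral>\<^sup>+ h. g (T h) \<partial>lborel) * (\<integral>\<^sup>+ z. b z \<partial>lborel) = (\<integral>\<^sup>+ h. (\<integral>\<^sup>+ z. g (T h) * b (z + T h) \<partial>lborel) \<partial>lborel)"
    by (subst nn_integral_multc[symmetric]) (auto simp: nn_integral_cmult shift)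
  also have "\<dots> = (\<integral>\<^sup>+ z. (\<integral>\<^sup>+ h. g (T h) * b (z + T h) \<partial>lborel) \<partial>lborel)"
    by (rule lborel_pair.Fubini') measurable
  \<comment> \<open>Translating h by a preimage w of z under T moves the shift from b to g;
    linearity gives T (h + w) = T h + z.\<close>
  also have "\<dots> = (\<integral>\<^sup>+ z. (\<integral>\<^sup>+ h. g (T h - z) * b (T h) \<partial>lborel) \<partial>lborel)"
  proof (rule nn_integral_cong)
    fix z :: 'a
    obtain w where w: "T w = z" using orthogonal_transformation_surj[OF T] by (metis surjD)
    have Tw: "T (h + w) = T h + z" for h using lin w by (simp add: linear_add)
    show "(\<integral>\<^sup>+ h. g (T h) * b (z + T h) \<partial>lborel) = (\<integral>\<^sup>+ h. g (T h - z) * b (T h) \<partial>lborel)"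
      using shift[of "\<lambda>h. g (T h - z) * b (T h)" w] by (simp add: Tw add.commute)
  qed
  also have "\<dots> = (\<integral>\<^sup>+ h. (\<integral>\<^sup>+ z. g (T h - z) * b (T h) \<partial>lborel) \<partial>lborel)"
    by (rule lborel_pair.Fubini') measurable
  also have "\<dots> = (\<integral>\<^sup>+ h. g h \<partial>lborel) * (\<integral>\<^sup>+ z. b z \<partial>lborel)"
    by (simp add: nn_integral_multc nn_integral_cmult refl bT)
  finally have eq: "(\<integral>\<^sup>+ h. g (T h) \<partial>lborel) * (\<integral>\<^sup>+ z. b z \<partial>lborel) = (\<integral>\<^sup>+ h. g h \<partial>lborel) * (\<integral>\<^sup>+ z. b z \<partial>lborel)" .
  have "(\<integral>\<^sup>+ z. b z \<partial>lborel) = emeasure lborel (ball (0::'a) 1)" by (simp add: b_def)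
  moreover have "emeasure lborel (ball (0::'a) 1) \<noteq> 0"
    using open_not_negligible[of "ball (0::'a) 1"] by (simp add: negligible_iff_emeasure0)
  moreover have "emeasure lborel (ball (0::'a) 1) \<noteq> \<infinity>"
    using emeasure_bounded_finite[OF bounded_ball, of "0::'a" 1] by auto
  ultimately show ?thesis
    using eq by (simp add: mult.commute[of _ "emeasure _ _"] ennreal_mult_cancel_left)
qed

text \<open>Both half-lines contain 0 and may overcount there; an upper bound is all that the
  finiteness statements need.\<close>

lemma nn_integral_even_real:
  fixes g :: "real \<Rightarrow> real"
  assumes [measurable]: "g \<in> borel_measurable borel"
  shows "(\<integral>\<^sup>+ t. ennreal (g \<bar>t\<bar>) \<partial>lborel) \<le> 2 * (\<integral>\<^sup>+ t. ennreal (indicator {0..} t * g t) \<partial>lborel)"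
proof -
  let ?h = "\<lambda>t::real. ennreal (indicator {0..} t * g t)"
  have "(\<integral>\<^sup>+ t. ennreal (g \<bar>t\<bar>) \<partial>lborel) \<le> (\<integral>\<^sup>+ t. ?h t + ?h (- t) \<partial>lborel)"
    by (intro nn_integral_mono) (auto simp: indicator_def)
  also have "\<dots> = (\<integral>\<^sup>+ t. ?h t \<partial>lborel) + (\<integral>\<^sup>+ t. ?h (- t) \<partial>lborel)"
    by (intro nn_integral_add) measurable
  also have "(\<integral>\<^sup>+ t. ?h (- t) \<partial>lborel) = (\<integral>\<^sup>+ t. ?h t \<partial>lborel)"
    using nn_integral_real_affine[of ?h "-1" 0] by simp
  finally show ?thesis by (simp add: mult_2)
qed

lemma nn_integral_powr_near_0:
  fixes d :: real
  assumes d: "d > 0"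
  shows "(\<integral>\<^sup>+ t. ennreal (indicator {-1..1} t * \<bar>t\<bar> powr (d - 1)) \<partial>lborel) < \<infinity>"
proof -
  let ?g = "\<lambda>t::real. indicator {..1} t * t powr (d - 1)"
  have hi: "((\<lambda>t. if t \<in> {0..1} then t powr (d - 1) else 0) has_integral (1 / d)) UNIV"
    using has_integral_powr_from_0[of "d - 1" 1] d by (simp only: has_integral_restrict_UNIV) simp
  have "(\<integral>\<^sup>+ t. ennreal (indicator {-1..1} t * \<bar>t\<bar> powr (d - 1)) \<partial>lborel) = (\<integral>\<^sup>+ t. ennreal (?g \<bar>t\<bar>) \<partial>lborel)"
    by (intro nn_integral_cong) (auto simp: indicator_def)
  also have "\<dots> \<le> 2 * (\<integral>\<^sup>+ t. ennreal (indicator {0..} t * ?g t) \<partial>lborel)"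
    by (rule nn_integral_even_real) measurable
  also have "(\<integral>\<^sup>+ t. ennreal (indicator {0..} t * ?g t) \<partial>lborel)
     = (\<integral>\<^sup>+ t. ennreal (if t \<in> {0..1} then t powr (d - 1) else 0) \<partial>lborel)"
    by (intro nn_integral_cong) (auto simp: indicator_def)
  also have "\<dots> = ennreal (1 / d)"
    by (rule nn_integral_has_integral_lborel[OF _ _ hi]) auto
  finally show ?thesis by (rule le_less_trans) (simp add: ennreal_mult_less_top)
qed

lemma nn_integral_powr_at_infinity:
  fixes b :: real
  assumes b: "b > 0"
  shows "(\<integral>\<^sup>+ t. ennreal ((1 + \<bar>t\<bar>) powr (- 1 - b)) \<partial>lborel) < \<infinity>"
proof -
  let ?g = "\<lambda>t::real. (1 + t) powr (- 1 - b)"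
  have "((\<lambda>t. t powr (- 1 - b)) has_integral 1 / b) {1..}"
    using has_integral_powr_to_inf[of "- 1 - b" 1] b by simp
  then have hi: "((\<lambda>t. if t \<in> {1..} then t powr (- 1 - b) else 0) has_integral (1 / b)) UNIV"
    by (simp only: has_integral_restrict_UNIV)
  have "(\<integral>\<^sup>+ t. ennreal (?g \<bar>t\<bar>) \<partial>lborel) \<le> 2 * (\<integral>\<^sup>+ t. ennreal (indicator {0..} t * ?g t) \<partial>lborel)"
    by (rule nn_integral_even_real) measurable
  also have "(\<integral>\<^sup>+ t. ennreal (indicator {0..} t * ?g t) \<partial>lborel)
     = (\<integral>\<^sup>+ t. ennreal (if 1 + t \<in> {1..} then (1 + t) powr (- 1 - b) else 0) \<partial>lborel)"
    by (intro nn_integral_cong) (auto simp: indicator_def)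
  also have "\<dots> = (\<integral>\<^sup>+ t. ennreal (if t \<in> {1..} then t powr (- 1 - b) else 0) \<partial>lborel)"
    using nn_integral_real_affine[of "\<lambda>t. ennreal (if t \<in> {1..} then t powr (- 1 - b) else 0)" 1 1]
    by (simp del: mult_1) (simp only: mult_1_left)
  also have "\<dots> = ennreal (1 / b)"
    by (rule nn_integral_has_integral_lborel[OF _ _ hi]) auto
  finally show ?thesis by (rule le_less_trans) (simp add: ennreal_mult_less_top)
qed

text \<open>The decay exponent N + b is shared evenly among the N coordinates. Outside the ball,
  \<open>1 + \<bar>h \<bullet> i\<bar>\<close> is at most \<open>norm h * (1 + 1 / r)\<close>, so
  the kernel is dominated by a product of one-dimensional functions with exponent -1 - b/N, and
  Tonelli factorises the integral.\<close>

lemma nn_integral_powr_outside_ball: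
  fixes b r :: real
  assumes b: "b > 0" and r: "r > 0"
  shows "(\<integral>\<^sup>+ h. ennreal (indicator {h. r \<le> norm h} h * kern b (h :: real^'n)) \<partial>lborel) < \<infinity>"
proof -
  let ?N = "real CARD('n)" and ?B = "Basis :: (real^'n) set"
  define b' where "b' = b / ?N"
  have b': "b' > 0" using b by (simp add: b'_def)
  define A where "A = (1 + 1 / r) powr (?N + b)"
  have pw: "indicator {h. r \<le> norm h} h * kern b h \<le> A * (\<Prod>i\<in>?B. (1 + \<bar>h \<bullet> i\<bar>) powr (- 1 - b'))" for h :: "real^'n"
  proof (cases "r \<le> norm h")
    case True
    then have nh: "norm h > 0" using r by linarith
    have "(norm h * (1 + 1 / r)) powr (- 1 - b') \<le> (1 + \<bar>h \<bullet> i\<bar>) powr (- 1 - b')" if "i \<in> ?B" for i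
    proof (rule powr_mono2')
      have "1 \<le> norm h / r" using True r by simp
      moreover have "\<bar>h \<bullet> i\<bar> \<le> norm h" using that by (rule Basis_le_norm)
      ultimately show "1 + \<bar>h \<bullet> i\<bar> \<le> norm h * (1 + 1 / r)" by (simp add: algebra_simps)
    qed (use b' in auto)
    then have "(\<Prod>i\<in>?B. (norm h * (1 + 1 / r)) powr (- 1 - b')) \<le> (\<Prod>i\<in>?B. (1 + \<bar>h \<bullet> i\<bar>) powr (- 1 - b'))"
      by (intro prod_mono) auto
    also have "(\<Prod>i\<in>?B. (norm h * (1 + 1 / r)) powr (- 1 - b')) = (norm h * (1 + 1 / r)) powr (- (?N + b))"
    proof -
      have "(- 1 - b') * ?N = - (?N + b)" by (simp add: b'_def field_simps)
      moreover have "norm h * (1 + 1 / r) > 0" using nh r by (simp add: add_pos_pos)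
      then have "((norm h * (1 + 1 / r)) powr c) ^ CARD('n) = (norm h * (1 + 1 / r)) powr (c * ?N)" for c
        by (subst powr_powr[symmetric], subst powr_realpow) auto
      ultimately show ?thesis by simp
    qed
    finally have "A * (norm h * (1 + 1 / r)) powr (- (?N + b)) \<le> A * (\<Prod>i\<in>?B. (1 + \<bar>h \<bullet> i\<bar>) powr (- 1 - b'))"
      by (intro mult_left_mono) (auto simp: A_def)
    moreover have "A * (norm h * (1 + 1 / r)) powr (- (?N + b)) = kern b h"
    proof -
      have "1 + 1 / r > 0" using r by (simp add: add_pos_pos)
      then have "(1 + 1 / r) powr (?N + b) > 0" by simp
      then show ?thesis
        using nh r unfolding A_def kern_def powr_minus_divide by (subst powr_mult) auto
    qed
    ultimately show ?thesis using True by simp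
  qed (simp add: A_def prod_nonneg)
  have "(\<integral>\<^sup>+ h. ennreal (indicator {h. r \<le> norm h} h * kern b (h :: real^'n)) \<partial>lborel)
     \<le> (\<integral>\<^sup>+ h. ennreal A * (\<Prod>i\<in>?B. ennreal ((1 + \<bar>h \<bullet> i\<bar>) powr (- 1 - b'))) \<partial>lborel)"
  proof (rule nn_integral_mono)
    fix h :: "real^'n"
    have "ennreal A * (\<Prod>i\<in>?B. ennreal ((1 + \<bar>h \<bullet> i\<bar>) powr (- 1 - b'))) = ennreal (A * (\<Prod>i\<in>?B. (1 + \<bar>h \<bullet> i\<bar>) powr (- 1 - b')))"
      by (subst prod_ennreal) (auto simp: ennreal_mult prod_nonneg A_def)
    then show "ennreal (indicator {h. r \<le> norm h} h * kern b h) \<le> ennreal A * (\<Prod>i\<in>?B. ennreal ((1 + \<bar>h \<bullet> i\<bar>) powr (- 1 - b')))"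
      using pw[of h] by (simp add: ennreal_leI)
  qed
  also have "\<dots> = ennreal A * (\<integral>\<^sup>+ h. (\<Prod>i\<in>?B. ennreal ((1 + \<bar>h \<bullet> i\<bar>) powr (- 1 - b'))) \<partial>lborel)"
    by (rule nn_integral_cmult) measurable
  also have "(\<integral>\<^sup>+ h. (\<Prod>i\<in>?B. ennreal ((1 + \<bar>h \<bullet> i\<bar>) powr (- 1 - b'))) \<partial>lborel)
      = (\<Prod>i\<in>?B. (\<integral>\<^sup>+ t. ennreal ((1 + \<bar>t\<bar>) powr (- 1 - b')) \<partial>lborel))"
    by (subst nn_integral_lborel_prod) auto
  also have "ennreal A * \<dots> < \<infinity>"
    using nn_integral_powr_at_infinity[OF b'] by (simp add: ennreal_mult_less_top power_less_top_ennreal)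
  finally show ?thesis .
qed

lemma negligible_hyperplanes_AE:
  "AE h in lborel. \<forall>i\<in>Basis. (h :: 'a::euclidean_space) \<bullet> i \<noteq> 0"
proof -
  have "AE h in lborel. (h :: 'a) \<bullet> i \<noteq> 0" if "i \<in> Basis" for i
  proof -
    have "negligible {h :: 'a. h \<bullet> i = 0}" using that by (rule negligible_standard_hyperplane)
    then have "{h :: 'a. h \<bullet> i = 0} \<in> null_sets lborel"
      by (subst (asm) negligible_iff_null_sets) (auto simp: null_sets_def)
    then show ?thesis by (rule AE_I') auto
  qed
  then show ?thesis by (simp add: AE_finite_all)
qed

text \<open>The weight has total degree \<beta> - N, integrable at the origin, and its singularity
  across the hyperplane has degree q - 2 > -1. Distributing the degrees over the coordinates bounds
  it by a product of one-dimensional weights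
  \<open>\<bar>t\<bar> powr (\<delta> - 1)\<close>.\<close>

lemma nn_integral_directional_powr_axis:
  fixes q \<beta> :: real and k :: "'n::finite"
  assumes q: "1 < q" "q \<le> 2" and \<beta>: "\<beta> > 0"
  shows "(\<integral>\<^sup>+ h. ennreal (indicator (ball 0 1) h *
            (\<bar>axis k 1 \<bullet> h\<bar> powr (q - 2) * norm h powr (2 - q + \<beta> - real CARD('n)))) \<partial>(lborel :: (real^'n) measure)) < \<infinity>"
proof -
  let ?N = "real CARD('n)" and ?B = "Basis :: (real^'n) set"
  let ?e = "axis k 1 :: real^'n"
  \<comment> \<open>N\<delta> \<le> \<beta> permits lowering the total degree to N(\<delta> - 1)
    inside the unit ball, and \<delta> \<le> q - 1 makes every power of \<open>norm h\<close> that
    is split off nonpositive, so that \<open>norm h\<close> may be replaced by the smaller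
    coordinates.\<close>
  define \<delta> where "\<delta> = min (\<beta> / ?N) (q - 1)"
  have \<delta>: "\<delta> > 0" "\<delta> \<le> q - 1" "\<delta> \<le> 1" "?N * \<delta> \<le> \<beta>"
  proof -
    have "\<delta> \<le> \<beta> / ?N" "\<delta> \<le> q - 1" by (simp_all add: \<delta>_def)
    then show "\<delta> \<le> q - 1" "\<delta> \<le> 1" "?N * \<delta> \<le> \<beta>" using q by (auto simp: le_divide_eq mult.commute)
    show "\<delta> > 0" using q \<beta> by (simp add: \<delta>_def)
  qed
  have eB: "?e \<in> ?B" by (auto simp: Basis_vec_def)
  have pw: "indicator (ball 0 1) h * (\<bar>?e \<bullet> h\<bar> powr (q - 2) * norm h powr (2 - q + \<beta> - ?N))
       \<le> (\<Prod>i\<in>?B. indicator {-1..1} (h \<bullet> i) * \<bar>h \<bullet> i\<bar> powr (\<delta> - 1))"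
    if nz: "\<forall>i\<in>?B. h \<bullet> i \<noteq> 0" for h :: "real^'n"
  proof (cases "h \<in> ball 0 1")
    case True
    then have h1: "norm h \<le> 1" by simp
    have hi: "\<bar>h \<bullet> i\<bar> \<le> norm h" if "i \<in> ?B" for i using that by (rule Basis_le_norm)
    have nh: "norm h > 0" using nz eB by auto
    have "norm h powr (2 - q + \<beta> - ?N) \<le> norm h powr (2 - q + ?N * \<delta> - ?N)"
      using h1 nh \<delta> by (intro powr_mono') auto
    also have "\<dots> = norm h powr (- (q - 1 - \<delta>) + (?N - 1) * (\<delta> - 1))"
      by (simp add: algebra_simps)
    also have "\<dots> = norm h powr (- (q - 1 - \<delta>)) * norm h powr ((\<delta> - 1) * (?N - 1))"
      by (simp add: powr_add mult.commute)
    also have "norm h powr ((\<delta> - 1) * (?N - 1)) = (\<Prod>i\<in>?B - {?e}. norm h powr (\<delta> - 1))"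
    proof -
      have "(\<Prod>i\<in>?B - {?e}. norm h powr (\<delta> - 1)) = (norm h powr (\<delta> - 1)) ^ (CARD('n) - 1)"
        using eB by simp
      also have "\<dots> = (norm h powr (\<delta> - 1)) powr real (CARD('n) - 1)"
        using nh by (subst powr_realpow) auto
      also have "real (CARD('n) - 1) = ?N - 1" by (simp add: of_nat_diff Suc_leI)
      finally show ?thesis by (simp add: powr_powr)
    qed
    also have "norm h powr (- (q - 1 - \<delta>)) * \<dots> \<le> \<bar>h \<bullet> ?e\<bar> powr (- (q - 1 - \<delta>)) * (\<Prod>i\<in>?B - {?e}. \<bar>h \<bullet> i\<bar> powr (\<delta> - 1))"
      using nz eB hi \<delta> by (intro mult_mono prod_mono conjI powr_mono2' prod_nonneg) auto
    finally have "\<bar>?e \<bullet> h\<bar> powr (q - 2) * norm h powr (2 - q + \<beta> - ?N) \<le>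
       \<bar>h \<bullet> ?e\<bar> powr (q - 2) * (\<bar>h \<bullet> ?e\<bar> powr (- (q - 1 - \<delta>)) * (\<Prod>i\<in>?B - {?e}. \<bar>h \<bullet> i\<bar> powr (\<delta> - 1)))"
      by (subst inner_commute) (intro mult_left_mono, auto)
    also have "\<dots> = \<bar>h \<bullet> ?e\<bar> powr (\<delta> - 1) * (\<Prod>i\<in>?B - {?e}. \<bar>h \<bullet> i\<bar> powr (\<delta> - 1))"
      by (simp add: mult.assoc[symmetric] powr_add[symmetric])
    also have "\<dots> = (\<Prod>i\<in>?B. \<bar>h \<bullet> i\<bar> powr (\<delta> - 1))"
      using eB by (subst prod.remove[of ?B ?e]) auto
    also have "\<dots> = (\<Prod>i\<in>?B. indicator {-1..1} (h \<bullet> i) * \<bar>h \<bullet> i\<bar> powr (\<delta> - 1))"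
    proof (rule prod.cong)
      fix i :: "real^'n" assume "i \<in> ?B"
      then have "\<bar>h \<bullet> i\<bar> \<le> 1" using hi h1 by (meson order_trans)
      then show "\<bar>h \<bullet> i\<bar> powr (\<delta> - 1) = indicator {-1..1} (h \<bullet> i) * \<bar>h \<bullet> i\<bar> powr (\<delta> - 1)"
        by (simp add: indicator_def abs_le_iff)
    qed simp
    finally show ?thesis using True by simp
  qed (simp add: prod_nonneg)
  have "(\<integral>\<^sup>+ h. ennreal (indicator (ball 0 1) h *
            (\<bar>?e \<bullet> h\<bar> powr (q - 2) * norm h powr (2 - q + \<beta> - ?N))) \<partial>lborel)
     \<le> (\<integral>\<^sup>+ h. (\<Prod>i\<in>?B. ennreal (indicator {-1..1} (h \<bullet> i) * \<bar>h \<bullet> i\<bar> powr (\<delta> - 1))) \<partial>lborel)"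
    using negligible_hyperplanes_AE
    by (intro nn_integral_mono_AE) (auto elim!: eventually_mono simp: prod_ennreal pw ennreal_leI)
  also have "\<dots> = (\<Prod>i\<in>?B. (\<integral>\<^sup>+ t. ennreal (indicator {-1..1} t * \<bar>t\<bar> powr (\<delta> - 1)) \<partial>lborel))"
    by (subst nn_integral_lborel_prod) auto
  also have "\<dots> < \<infinity>"
    using nn_integral_powr_near_0[OF \<delta>(1)] by (simp add: power_less_top_ennreal)
  finally show ?thesis .
qed

text \<open>In the application \<open>e\<close> is the radial direction at a point of the barrier's
  ball and varies with that point; a rotation taking \<open>e\<close> to a coordinate axis makes the
  constant independent of it.\<close>

lemma nn_integral_directional_powr:
  fixes q \<beta> :: real
  assumes q: "1 < q" "q \<le> 2" and \<beta>: "\<beta> > 0"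
  shows "\<exists>C\<ge>0. \<forall>e::real^'n. norm e = 1 \<longrightarrow>
     (\<integral>\<^sup>+ h. ennreal (indicator (ball 0 1) h *
            (\<bar>e \<bullet> h\<bar> powr (q - 2) * norm h powr (2 - q + \<beta> - real CARD('n)))) \<partial>lborel) \<le> ennreal C"
proof -
  define G where "G e = (\<lambda>h::real^'n. ennreal (indicator (ball 0 1) h *
            (\<bar>e \<bullet> h\<bar> powr (q - 2) * norm h powr (2 - q + \<beta> - real CARD('n)))))" for e
  let ?e = "axis undefined 1 :: real^'n"
  have [measurable]: "G e \<in> borel_measurable borel" for e
  proof -
    have [measurable]: "ball (0::real^'n) 1 \<in> sets borel" by simp
    show ?thesis unfolding G_def by measurable
  qed
  have fin: "(\<integral>\<^sup>+ h. G ?e h \<partial>lborel) < \<infinity>"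
    unfolding G_def using nn_integral_directional_powr_axis[OF assms] .
  have eq: "(\<integral>\<^sup>+ h. G e h \<partial>lborel) = (\<integral>\<^sup>+ h. G ?e h \<partial>lborel)" if "norm e = 1" for e
  proof -
    have "norm e = norm ?e" using that by (simp add: norm_axis_1)
    then obtain T where T: "orthogonal_transformation T" "T e = ?e"
      by (rule orthogonal_transformation_exists)
    have lin: "linear T" using T by (simp add: orthogonal_transformation_linear)
    have [measurable]: "T \<in> borel_measurable borel"
      using lin by (intro borel_measurable_continuous_onI linear_continuous_on) (simp add: linear_conv_bounded_linear)
    have "G e h = G ?e (T h)" for h
    proof -
      have "T e \<bullet> T h = e \<bullet> h" using T(1) unfolding orthogonal_transformation_def by blast
      then have "?e \<bullet> T h = e \<bullet> h" by (simp only: T(2))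
      moreover have "norm (T h) = norm h" using T(1) by (rule orthogonal_transformation_norm)
      ultimately show ?thesis by (simp add: G_def indicator_def)
    qed
    then show ?thesis using nn_integral_lborel_orthogonal[OF T(1), of "G ?e"] by simp
  qed
  show ?thesis
  proof (intro exI conjI allI impI)
    fix e :: "real^'n" assume "norm e = 1"
    then have "(\<integral>\<^sup>+ h. G e h \<partial>lborel) \<le> ennreal (enn2real (\<integral>\<^sup>+ h. G ?e h \<partial>lborel))"
      using fin by (subst eq) (simp_all add: ennreal_enn2real_if)
    then show "(\<integral>\<^sup>+ h. ennreal (indicator (ball 0 1) h *
            (\<bar>e \<bullet> h\<bar> powr (q - 2) * norm h powr (2 - q + \<beta> - real CARD('n)))) \<partial>lborel) \<le> ennreal (enn2real (\<integral>\<^sup>+ h. G ?e h \<partial>lborel))"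
      by (simp add: G_def)
  qed simp
qed

section \<open>A barrier for the fractional p-Laplacian\<close>

lemma spow_0 [simp]: "spow 0 q = 0"
  by (simp add: spow_def)

lemma spow_nonneg_eq: "0 \<le> a \<Longrightarrow> spow a q = a powr q"
  by (cases "a = 0") (auto simp: spow_def powr_mult_base powr_diff)

lemma spow_minus: "spow (- a) q = - spow a q"
  by (simp add: spow_def)

lemma spow_nonpos_eq: "a \<le> 0 \<Longrightarrow> spow a q = - ((- a) powr q)"
  using spow_nonneg_eq[of "- a" q] by (simp add: spow_minus)

lemma abs_spow: "\<bar>spow a q\<bar> = \<bar>a\<bar> powr q"
  by (cases "a \<ge> 0") (auto simp: spow_nonneg_eq spow_nonpos_eq)

lemma spow_nonneg_iff [simp]: "0 \<le> spow a q \<longleftrightarrow> 0 \<le> a"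
  by (auto simp: spow_def zero_le_mult_iff)

lemma spow_mono:
  assumes "a \<le> b" "0 < q"
  shows "spow a q \<le> spow b q"
proof (cases "a \<ge> 0")
  case True
  with assms show ?thesis by (simp add: spow_nonneg_eq powr_mono2)
next
  case False
  show ?thesis
  proof (cases "b \<ge> 0")
    case True
    with False have "spow a q \<le> 0" by (simp add: spow_nonpos_eq)
    also have "0 \<le> spow b q" using True by simp
    finally show ?thesis .
  next
    case b: False
    then show ?thesis using False assms by (simp add: spow_nonpos_eq powr_mono2)
  qed
qed

lemma spow_mult: "0 \<le> c \<Longrightarrow> spow (c * a) q = c powr q * spow a q"
  using powr_mult_base[of c "q - 1"] by (simp add: spow_def abs_mult powr_mult mult_ac)

lemma spow_measurable [measurable]: "(\<lambda>a. spow a q) \<in> borel_measurable borel"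
  unfolding spow_def by measurable

lemma powr_add_le:
  fixes a b p :: real
  assumes "0 \<le> a" "0 \<le> b" "0 \<le> p"
  shows "(a + b) powr p \<le> 2 powr p * (a powr p + b powr p)"
proof -
  have "(a + b) powr p \<le> (2 * max a b) powr p"
    using assms by (intro powr_mono2) auto
  also have "\<dots> = 2 powr p * (max a b) powr p" using assms by (simp add: powr_mult)
  also have "(max a b) powr p \<le> a powr p + b powr p" by (simp add: max_def)
  finally show ?thesis by simp
qed

text \<open>For q at least 1 the mean value theorem gives the factor \<open>A powr (q - 1)\<close>.
  For q below 1 the derivative is unbounded at 0 and
  \<open>B powr q \<ge> B * A powr (q - 1)\<close> replaces it; passing from A to A + B, of which A
  is at least half, costs \<open>2 powr (1 - q)\<close>. The constant q + 2 covers both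
  cases.\<close>

lemma powr_diff_le:
  fixes A B q :: real
  assumes AB: "0 \<le> B" "B \<le> A" "0 < A" and q: "0 < q"
  shows "A powr q - B powr q \<le> (q + 2) * (A - B) * (A + B) powr (q - 1)"
proof (cases "1 \<le> q")
  case True
  have "A powr q - B powr q \<le> q * (A - B) * A powr (q - 1)"
  proof (cases "0 < B \<and> B < A")
    case lt: True
    have "\<exists>z. B < z \<and> z < A \<and> A powr q - B powr q = (A - B) * (q * z powr (q - 1))"
      by (rule MVT2) (use lt in \<open>auto intro!: has_real_derivative_powr\<close>)
    then obtain z where z: "B < z" "z < A" "A powr q - B powr q = (A - B) * (q * z powr (q - 1))"
      by blast
    have "(A - B) * (q * z powr (q - 1)) \<le> (A - B) * (q * A powr (q - 1))"
      using z lt q True by (intro mult_left_mono powr_mono2) auto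
    then show ?thesis using z by (simp add: mult_ac)
  next
    case False
    then consider "B = 0" | "B = A" using AB by linarith
    then show ?thesis
    proof cases
      case 1
      have "A powr q = A * A powr (q - 1)" using AB by (simp add: powr_diff)
      also have "\<dots> \<le> q * (A * A powr (q - 1))" using True AB mult_right_mono[of 1 q "A * A powr (q - 1)"] by simp
      finally show ?thesis using 1 by simp
    qed simp
  qed
  also have "\<dots> \<le> (q + 2) * (A - B) * (A + B) powr (q - 1)"
    using AB q True by (intro mult_mono powr_mono2 mult_nonneg_nonneg) auto
  finally show ?thesis .
next
  case False
  have "B powr q \<ge> B * A powr (q - 1)"
  proof (cases "B = 0")
    case False
    then have "B powr q = B * B powr (q - 1)" using AB by (simp add: powr_diff)
    moreover have "A powr (q - 1) \<le> B powr (q - 1)"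
      using AB False \<open>\<not> 1 \<le> q\<close> by (intro powr_mono2') auto
    ultimately show ?thesis using AB by (simp add: mult_left_mono)
  qed simp
  moreover have "A powr q = A * A powr (q - 1)" using AB by (simp add: powr_diff)
  ultimately have "A powr q - B powr q \<le> (A - B) * A powr (q - 1)" by (simp add: algebra_simps)
  also have "A powr (q - 1) \<le> ((A + B) / 2) powr (q - 1)"
    using AB False by (intro powr_mono2') auto
  also have "((A + B) / 2) powr (q - 1) = 2 powr (1 - q) * (A + B) powr (q - 1)"
  proof -
    have "2 powr (1 - q) = 1 / 2 powr (q - 1)" using powr_minus_divide[of 2 "q - 1"] by simp
    then show ?thesis using AB by (simp add: powr_divide)
  qed
  also have "2 powr (1 - q) \<le> q + 2"
    using powr_mono[of "1 - q" 1 2] q by simp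
  finally show ?thesis using AB by (simp add: mult_left_mono mult_right_mono mult_ac)
qed

text \<open>With A and B the increments of a function along h and -h, the cancellation appears as
  the second difference A + B, and the remaining factor has the size of the increments. When the
  signs differ this is the bound for differences of powers; when they agree there is nothing to
  cancel and monotonicity suffices. For q < 1 the last factor is a negative power and calls for a
  lower bound on the increments.\<close>

lemma spow_add_le:
  fixes A B q :: real
  assumes s: "0 \<le> A + B" and q: "0 < q"
  shows "spow A q + spow B q \<le> (q + 2) * (A + B) * (\<bar>A\<bar> + \<bar>B\<bar>) powr (q - 1)"
proof -
  have main: "spow A q + spow B q \<le> (q + 2) * (A + B) * (\<bar>A\<bar> + \<bar>B\<bar>) powr (q - 1)"
    if s: "0 \<le> A + B" and BA: "B \<le> A" for A B
  proof (cases "A = 0")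
    case True
    then show ?thesis using that by simp
  next
    case False
    then have A: "A > 0" using that by linarith
    show ?thesis
    proof (cases "B \<ge> 0")
      case True
      have "spow A q + spow B q \<le> (A + B) powr q + (A + B) powr q"
        using True A q powr_mono2[of q A "A + B"] powr_mono2[of q B "A + B"]
        by (simp add: spow_nonneg_eq)
      also have "\<dots> = 2 * ((A + B) * (A + B) powr (q - 1))"
        using A True by (simp add: powr_diff)
      also have "\<dots> \<le> (q + 2) * ((A + B) * (A + B) powr (q - 1))"
        using q s by (intro mult_right_mono) auto
      finally show ?thesis using A True by (simp add: mult_ac)
    next
      case False
      then show ?thesis
        using powr_diff_le[of "- B" A q] s A q by (simp add: spow_nonneg_eq spow_nonpos_eq)
    qed
  qed
  show ?thesis
  proof (cases "B \<le> A")
    case True then show ?thesis using main s by blast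
  next
    case False then show ?thesis using main[of B A] s by (simp add: add.commute)
  qed
qed

section \<open>First- and second-order expansion of integer powers\<close>

lemma power_Suc_diff_le:
  fixes y t M :: real
  assumes "0 \<le> y" "y \<le> M" "0 \<le> t" "t \<le> M"
  shows "\<bar>y ^ Suc i - t ^ Suc i\<bar> \<le> real (Suc i) * M ^ i * \<bar>y - t\<bar>"
proof (induction i)
  case (Suc i)
  have "y ^ Suc (Suc i) - t ^ Suc (Suc i) = y * (y ^ Suc i - t ^ Suc i) + (y - t) * t ^ Suc i"
    by (simp add: algebra_simps)
  then have "\<bar>y ^ Suc (Suc i) - t ^ Suc (Suc i)\<bar> \<le> \<bar>y * (y ^ Suc i - t ^ Suc i)\<bar> + \<bar>(y - t) * t ^ Suc i\<bar>"
    by (metis abs_triangle_ineq)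
  also have "\<dots> = y * \<bar>y ^ Suc i - t ^ Suc i\<bar> + \<bar>y - t\<bar> * t ^ Suc i"
    using assms by (simp add: abs_mult)
  also have "\<dots> \<le> M * (real (Suc i) * M ^ i * \<bar>y - t\<bar>) + \<bar>y - t\<bar> * M ^ Suc i"
    using assms Suc by (intro add_mono mult_mono power_mono) auto
  also have "\<dots> = real (Suc (Suc i)) * M ^ Suc i * \<bar>y - t\<bar>"
    by (simp add: algebra_simps)
  finally show ?case .
qed simp

text \<open>The linear term is written \<open>real j * a * b ^ j / b\<close> so that j = 0 needs no
  truncated exponent. The constant \<open>4 ^ j\<close> reproduces itself in the induction:
  \<open>\<bar>b + a\<bar> \<le> 2 * b\<close> and \<open>real j \<le> 2 * 4 ^ j\<close> each
  contribute half of \<open>4 ^ Suc j\<close>.\<close>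

lemma power_second_order_remainder:
  fixes a b :: real
  assumes "0 < b" "\<bar>a\<bar> \<le> b"
  shows "\<bar>(b + a) ^ j - b ^ j - real j * a * b ^ j / b\<bar> \<le> 4 ^ j * a\<^sup>2 * b ^ j / b\<^sup>2"
proof (induction j)
  case (Suc j)
  let ?E = "(b + a) ^ j - b ^ j - real j * a * b ^ j / b"
  have "(b + a) ^ Suc j - b ^ Suc j - real (Suc j) * a * b ^ Suc j / b
       = (b + a) * ?E + real j * a\<^sup>2 * b ^ j / b"
    using assms by (simp add: field_simps power2_eq_square)
  then have "\<bar>(b + a) ^ Suc j - b ^ Suc j - real (Suc j) * a * b ^ Suc j / b\<bar>
      \<le> \<bar>(b + a) * ?E\<bar> + \<bar>real j * a\<^sup>2 * b ^ j / b\<bar>"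
    by (metis abs_triangle_ineq)
  also have "\<dots> = \<bar>b + a\<bar> * \<bar>?E\<bar> + real j * a\<^sup>2 * b ^ j / b"
    using assms by (simp add: abs_mult)
  also have "\<dots> \<le> (2 * b) * (4 ^ j * a\<^sup>2 * b ^ j / b\<^sup>2) + 2 * 4 ^ j * a\<^sup>2 * b ^ j / b"
  proof (intro add_mono mult_mono Suc divide_right_mono)
    have "j < 2 ^ j" by simp
    also have "(2::nat) ^ j \<le> 4 ^ j" by (intro power_mono) auto
    finally have "real j \<le> 4 ^ j" by (metis of_nat_less_iff of_nat_numeral of_nat_power less_imp_le)
    then show "real j \<le> 2 * 4 ^ j" by (rule order_trans) simp
  qed (use assms in auto)
  also have "\<dots> = 4 ^ Suc j * a\<^sup>2 * b ^ Suc j / b\<^sup>2"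
    using assms by (simp add: field_simps power2_eq_square)
  finally show ?case .
qed simp

text \<open>A lower bound for the odd part, needed where a negative power of the increments occurs.
  For a \<ge> 0, replacing the inner i-th powers of b + a and b - a by \<open>b ^ i\<close>
  decreases the first term and increases the second.\<close>

lemma power_gap_ge:
  fixes a b :: real
  assumes "0 \<le> b" "\<bar>a\<bar> \<le> b"
  shows "2 * \<bar>a\<bar> * b ^ i \<le> \<bar>(b + a) ^ Suc i - (b - a) ^ Suc i\<bar>"
proof -
  have main: "2 * a * b ^ i \<le> (b + a) ^ Suc i - (b - a) ^ Suc i" if "0 \<le> a" "a \<le> b" for a
  proof -
    have "(b + a) * b ^ i \<le> (b + a) * (b + a) ^ i"
      using that by (intro mult_left_mono power_mono) auto
    moreover have "(b - a) * (b - a) ^ i \<le> (b - a) * b ^ i"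
      using that by (intro mult_left_mono power_mono) auto
    ultimately show ?thesis by (simp add: algebra_simps)
  qed
  show ?thesis using main[of a] main[of "- a"] assms by (cases "a \<ge> 0") auto
qed

text \<open>The even remainder of the power function is \<open>O(\<bar>h\<bar>\<^sup>2)\<close>, while the odd part is at least of order
  \<open>\<bar>e \<bullet> h\<bar>\<close>; this controls the singularity of \<open>t powr (p - 2)\<close> for \<open>p < 2\<close>. The
  exponent is so high that the barrier is flat enough at its only critical point.\<close>
lemma barrier_symmetric_difference:
  fixes p :: real and i :: nat
  assumes p: "1 < p" and i: "1 \<le> (2 * real i + 1) * (p - 1)"
  defines "f \<equiv> \<lambda>x::'a::euclidean_space. (x \<bullet> x) ^ Suc i"
  shows "\<exists>C\<ge>0. \<forall>x. norm x < 1 \<longrightarrow> (\<exists>e. norm e = 1 \<and>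
     (\<forall>h. norm h < 1 \<longrightarrow> e \<bullet> h \<noteq> 0 \<longrightarrow>
        spow (f (x + h) - f x) (p - 1) + spow (f (x - h) - f x) (p - 1)
          \<le> C * (\<bar>e \<bullet> h\<bar> powr (min p 2 - 2) * norm h powr (p + 2 - min p 2))))"
proof -
  define j where "j = Suc i"
  define q where "q = min p 2"
  define C2 where "C2 = (8 * 4 ^ j + 2 * real j) * 2 ^ i"
  define C3 where "C3 = 6 * real j * 4 ^ i"
  define Cf where "Cf = 2 * (9 ^ j) powr (p - 1)"
  define Cn where "Cn = (p + 1) * C2 * (1 + C3 powr (p - 2))"
  have C2: "C2 \<ge> 0" and C3: "C3 > 0" and Cf: "Cf \<ge> 0"
    by (auto simp: C2_def C3_def Cf_def j_def)
  have Cn: "Cn \<ge> 0" using C2 p by (simp add: Cn_def)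
  have exp_ge: "p \<le> 2 * real j * (p - 1)"
    using i by (simp add: j_def algebra_simps)
  have bound: "spow (f (x + h) - f x) (p - 1) + spow (f (x - h) - f x) (p - 1)
          \<le> (Cf + Cn) * (\<bar>e \<bullet> h\<bar> powr (q - 2) * norm h powr (p + 2 - q))"
    if x: "norm x < 1" and h: "norm h < 1" and e: "norm e = 1" "norm x *\<^sub>R e = x" and eh: "e \<bullet> h \<noteq> 0" for x h e :: 'a
  proof -
    define r where "r = norm x"
    define t where "t = x \<bullet> x"
    define \<tau> where "\<tau> = h \<bullet> h"
    define a where "a = 2 * (x \<bullet> h)"
    \<comment> \<open>The squared norms of x + h and x - h are b + a and b - a, with b even and a
      odd in h. The second difference of f at x becomes that of the j-th power at b, plus twice
      \<open>b ^ j - t ^ j\<close>.\<close>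
    define b where "b = t + \<tau>"
    define A where "A = (b + a) ^ j - t ^ j"
    define B where "B = (b - a) ^ j - t ^ j"
    have nh: "norm h > 0" using eh by auto
    have tr: "t = r\<^sup>2" by (simp add: t_def r_def power2_norm_eq_inner)
    have \<tau>h: "\<tau> = (norm h)\<^sup>2" by (simp add: \<tau>_def power2_norm_eq_inner)
    have t0: "t \<ge> 0" "\<tau> > 0" using nh by (auto simp: tr \<tau>h)
    have b0: "b > 0" using t0 by (simp add: b_def)
    have r01: "0 \<le> r" "r < 1" using x by (auto simp: r_def)
    have t1: "t \<le> 1" unfolding tr using r01 by (simp add: power_le_one)
    have ar: "\<bar>a\<bar> \<le> 2 * r * norm h"
      using Cauchy_Schwarz_ineq2[of x h] by (simp add: a_def r_def abs_mult)
    have a_e: "\<bar>a\<bar> = 2 * (r * \<bar>e \<bullet> h\<bar>)"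
    proof -
      have "x \<bullet> h = r * (e \<bullet> h)" by (subst e(2)[symmetric]) (simp add: r_def)
      then show ?thesis using r01 by (simp add: a_def abs_mult)
    qed
    have eh_le: "\<bar>e \<bullet> h\<bar> \<le> norm h" using Cauchy_Schwarz_ineq2[of e h] e by simp
    have eh0: "\<bar>e \<bullet> h\<bar> > 0" using eh by simp
    have yp: "b + a = (norm (x + h))\<^sup>2" "b - a = (norm (x - h))\<^sup>2"
      by (simp_all add: power2_norm_eq_inner b_def a_def t_def \<tau>_def inner_simps inner_commute)
    have fA: "f (x + h) - f x = A" "f (x - h) - f x = B"
      unfolding f_def A_def B_def yp t_def j_def by (simp_all add: power2_norm_eq_inner)
    have sq: "(norm (x + h))\<^sup>2 \<le> (r + norm h)\<^sup>2" "(norm (x - h))\<^sup>2 \<le> (r + norm h)\<^sup>2"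
      unfolding r_def by (auto intro!: power_mono norm_triangle_ineq norm_triangle_ineq4)
    \<comment> \<open>Since \<open>\<bar>e \<bullet> h\<bar> \<le> norm h\<close> and q \<le> 2, the
      right-hand side of the claim dominates \<open>norm h powr p\<close>; wherever the direction
      does not matter this simpler bound is proved instead.\<close>
    have Z: "1 \<le> \<bar>e \<bullet> h\<bar> powr (q - 2) * norm h powr (2 - q)"
    proof -
      have "norm h powr (q - 2) \<le> \<bar>e \<bullet> h\<bar> powr (q - 2)"
        using eh_le eh0 by (intro powr_mono2') (auto simp: q_def)
      then have "norm h powr (q - 2) * norm h powr (2 - q) \<le> \<bar>e \<bullet> h\<bar> powr (q - 2) * norm h powr (2 - q)"
        by (intro mult_right_mono) auto
      moreover have "norm h powr (q - 2) * norm h powr (2 - q) = 1"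
        using nh by (simp add: powr_add[symmetric])
      ultimately show ?thesis by simp
    qed
    have hp: "norm h powr p \<le> \<bar>e \<bullet> h\<bar> powr (q - 2) * norm h powr (p + 2 - q)"
    proof -
      have "norm h powr p * 1 \<le> norm h powr p * (\<bar>e \<bullet> h\<bar> powr (q - 2) * norm h powr (2 - q))"
        using Z by (intro mult_left_mono) auto
      also have "\<dots> = \<bar>e \<bullet> h\<bar> powr (q - 2) * (norm h powr p * norm h powr (2 - q))" by simp
      also have "norm h powr p * norm h powr (2 - q) = norm h powr (p + 2 - q)"
        by (simp add: powr_add[symmetric] algebra_simps)
      finally show ?thesis by simp
    qed
    let ?R = "\<bar>e \<bullet> h\<bar> powr (q - 2) * norm h powr (p + 2 - q)"
    have R0: "?R \<ge> 0" by simp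
    have "spow A (p - 1) + spow B (p - 1) \<le> Cf * ?R + Cn * ?R"
    proof (cases "r \<le> 2 * norm h")
      case True
      have le9: "(r + norm h)\<^sup>2 \<le> 9 * \<tau>"
      proof -
        have "(r + norm h)\<^sup>2 \<le> (3 * norm h)\<^sup>2" using True r01 by (intro power_mono) auto
        then show ?thesis by (simp add: \<tau>h power_mult_distrib)
      qed
      have "A \<le> (9 * \<tau>) ^ j - 0" unfolding A_def
        using sq(1) le9 t0 yp by (intro diff_mono power_mono) auto
      moreover have "B \<le> (9 * \<tau>) ^ j - 0" unfolding B_def
        using sq(2) le9 t0 yp by (intro diff_mono power_mono) auto
      ultimately have "spow A (p - 1) + spow B (p - 1) \<le> 2 * spow ((9 * \<tau>) ^ j) (p - 1)"
        using p spow_mono[of A "(9 * \<tau>) ^ j" "p - 1"] spow_mono[of B "(9 * \<tau>) ^ j" "p - 1"] by linarith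
      also have "spow ((9 * \<tau>) ^ j) (p - 1) = (9 ^ j) powr (p - 1) * (\<tau> ^ j) powr (p - 1)"
        using t0 by (simp add: spow_nonneg_eq power_mult_distrib powr_mult)
      also have "(\<tau> ^ j) powr (p - 1) = norm h powr (2 * real j * (p - 1))"
      proof -
        have "\<tau> ^ j = norm h powr real (2 * j)" using nh by (subst powr_realpow) (auto simp: \<tau>h power_mult)
        then show ?thesis by (simp add: powr_powr)
      qed
      also have "\<dots> \<le> norm h powr p"
        using nh h exp_ge by (intro powr_mono') auto
      also note hp
      finally have "spow A (p - 1) + spow B (p - 1) \<le> Cf * ?R"
        by (simp add: Cf_def mult_left_mono mult_ac)
      then show ?thesis using Cn R0 by (simp add: add_increasing2)
    next
      case False
      have rpos: "r > 0" using False r01 nh by linarith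
      have tpos: "t > 0" using rpos by (simp add: tr)
      have \<tau>t: "\<tau> \<le> t"
        unfolding tr \<tau>h using False nh by (intro power_mono) linarith+
      have b2t: "b \<le> 2 * t" using \<tau>t by (simp add: b_def)
      \<comment> \<open>Away from the centre \<open>norm h\<close> is below r/2, which puts a in the
        range where the second-order expansion is valid.\<close>
      have at: "\<bar>a\<bar> \<le> t"
      proof -
        have "2 * r * norm h \<le> r * r" using False rpos by simp
        then show ?thesis using ar by (simp add: tr power2_eq_square)
      qed
      have ab: "\<bar>a\<bar> \<le> b" using at t0 by (simp add: b_def)
      have a2: "a\<^sup>2 \<le> 4 * b * \<tau>"
      proof -
        have "a\<^sup>2 \<le> (2 * r * norm h)\<^sup>2" using ar by (metis abs_ge_zero power2_abs power_mono)
        also have "\<dots> = 4 * t * \<tau>" by (simp add: tr \<tau>h power_mult_distrib)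
        also have "\<dots> \<le> 4 * b * \<tau>" using t0 by (intro mult_right_mono) (auto simp: b_def)
        finally show ?thesis .
      qed
      have bi: "b ^ i \<le> 2 ^ i * t ^ i"
        using b2t b0 by (metis less_imp_le power_mono power_mult_distrib)
      have sum_le: "A + B \<le> C2 * \<tau> * t ^ i"
      proof -
        let ?E1 = "(b + a) ^ j - b ^ j - real j * a * b ^ j / b"
        let ?E2 = "(b + (- a)) ^ j - b ^ j - real j * (- a) * b ^ j / b"
        have "A + B = ?E1 + ?E2 + 2 * (b ^ j - t ^ j)" by (simp add: A_def B_def algebra_simps)
        also have "\<dots> \<le> 4 ^ j * a\<^sup>2 * b ^ j / b\<^sup>2 + 4 ^ j * (- a)\<^sup>2 * b ^ j / b\<^sup>2 + 2 * (real j * b ^ i * \<tau>)"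
        proof (intro add_mono mult_left_mono)
          show "?E1 \<le> 4 ^ j * a\<^sup>2 * b ^ j / b\<^sup>2"
            using power_second_order_remainder[OF b0 ab, of j] by linarith
          show "?E2 \<le> 4 ^ j * (- a)\<^sup>2 * b ^ j / b\<^sup>2"
            using power_second_order_remainder[OF b0, of "- a" j] ab by linarith
          show "b ^ j - t ^ j \<le> real j * b ^ i * \<tau>"
            using power_Suc_diff_le[of b b t i] t0 b0 by (simp add: j_def b_def)
        qed simp
        also have "\<dots> = 2 * 4 ^ j * a\<^sup>2 * b ^ j / b\<^sup>2 + 2 * real j * b ^ i * \<tau>" by simp
        also have "2 * 4 ^ j * a\<^sup>2 * b ^ j / b\<^sup>2 \<le> 2 * 4 ^ j * (4 * b * \<tau>) * b ^ j / b\<^sup>2"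
          using a2 b0 by (intro divide_right_mono mult_right_mono mult_left_mono) auto
        also have "\<dots> = 8 * 4 ^ j * b ^ i * \<tau>"
          using b0 by (simp add: j_def field_simps power2_eq_square)
        finally have "A + B \<le> (8 * 4 ^ j + 2 * real j) * \<tau> * b ^ i" by (simp add: algebra_simps)
        also have "\<dots> \<le> (8 * 4 ^ j + 2 * real j) * \<tau> * (2 ^ i * t ^ i)"
          using bi t0 by (intro mult_left_mono) auto
        finally show ?thesis by (simp add: C2_def mult_ac)
      qed
      show ?thesis
      proof (cases "A + B \<le> 0")
        case True
        then have "spow A (p - 1) \<le> spow (- B) (p - 1)" using p by (intro spow_mono) auto
        then have "spow A (p - 1) + spow B (p - 1) \<le> 0" by (simp add: spow_minus)
        also have "0 \<le> Cf * ?R + Cn * ?R" using Cf Cn R0 by (intro add_nonneg_nonneg mult_nonneg_nonneg) auto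
        finally show ?thesis .
      next
        case pos: False
        have step: "spow A (p - 1) + spow B (p - 1) \<le> (p + 1) * (C2 * \<tau> * t ^ i) * (\<bar>A\<bar> + \<bar>B\<bar>) powr (p - 2)"
        proof -
          have "spow A (p - 1) + spow B (p - 1) \<le> (p - 1 + 2) * (A + B) * (\<bar>A\<bar> + \<bar>B\<bar>) powr (p - 1 - 1)"
            using pos p by (intro spow_add_le) auto
          also have "\<dots> = (p + 1) * (A + B) * (\<bar>A\<bar> + \<bar>B\<bar>) powr (p - 2)" by (simp add: algebra_simps)
          also have "\<dots> \<le> (p + 1) * (C2 * \<tau> * t ^ i) * (\<bar>A\<bar> + \<bar>B\<bar>) powr (p - 2)"
            using sum_le p by (intro mult_right_mono mult_left_mono) auto
          finally show ?thesis .
        qed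
        have ti: "t ^ i = r ^ (2 * i)" by (simp add: tr power_mult)
        have ti1: "t ^ i \<le> 1" using t0 t1 by (simp add: power_le_one)
        have near: "\<tau> * t ^ i * (\<bar>A\<bar> + \<bar>B\<bar>) powr (p - 2) \<le> (1 + C3 powr (p - 2)) * ?R"
        proof (cases "p < 2")
          case True
          \<comment> \<open>For p < 2 the factor
            \<open>(\<bar>A\<bar> + \<bar>B\<bar>) powr (p - 2)\<close> is large when the increments
            are small. The odd part A - B bounds them from below by the first-order change along
            e.\<close>
          have "r ^ (2 * i + 1) * \<bar>e \<bullet> h\<bar> \<le> 2 * \<bar>a\<bar> * b ^ i"
          proof -
            have "r ^ (2 * i + 1) * \<bar>e \<bullet> h\<bar> = t ^ i * (r * \<bar>e \<bullet> h\<bar>)" by (simp add: ti)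
            also have "\<dots> \<le> b ^ i * (r * \<bar>e \<bullet> h\<bar>)"
              using t0 r01 by (intro mult_right_mono power_mono) (auto simp: b_def)
            also have "\<dots> \<le> b ^ i * (2 * \<bar>a\<bar>)"
              using r01 b0 by (intro mult_left_mono) (auto simp: a_e)
            finally show ?thesis by (simp add: mult_ac)
          qed
          also have "\<dots> \<le> \<bar>A - B\<bar>" using power_gap_ge[of b a i] b0 ab by (simp add: A_def B_def j_def)
          also have "\<dots> \<le> \<bar>A\<bar> + \<bar>B\<bar>" by (rule abs_triangle_ineq4)
          finally have "(\<bar>A\<bar> + \<bar>B\<bar>) powr (p - 2) \<le> (r ^ (2 * i + 1) * \<bar>e \<bullet> h\<bar>) powr (p - 2)"
            using True rpos eh0 by (intro powr_mono2') auto
          also have "\<dots> = r powr (real (2 * i + 1) * (p - 2)) * \<bar>e \<bullet> h\<bar> powr (p - 2)"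
          proof -
            have "r ^ (2 * i + 1) = r powr real (2 * i + 1)" using rpos by (subst powr_realpow) auto
            then show ?thesis using rpos by (simp only: powr_mult powr_powr)
          qed
          finally have "\<tau> * t ^ i * (\<bar>A\<bar> + \<bar>B\<bar>) powr (p - 2)
             \<le> \<tau> * t ^ i * (r powr (real (2 * i + 1) * (p - 2)) * \<bar>e \<bullet> h\<bar> powr (p - 2))"
            using t0 by (intro mult_left_mono) auto
          also have "\<dots> = \<tau> * \<bar>e \<bullet> h\<bar> powr (p - 2) * (r powr (real (2 * i)) * r powr (real (2 * i + 1) * (p - 2)))"
            using rpos by (subst powr_realpow) (auto simp: ti)
          \<comment> \<open>The powers of r combine to the exponent
            \<open>(2 * real i + 1) * (p - 1) - 1\<close>, nonnegative by the choice of i: this is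
            how the flatness compensates the vanishing gradient at the centre.\<close>
          also have "r powr (real (2 * i)) * r powr (real (2 * i + 1) * (p - 2)) = r powr ((2 * real i + 1) * (p - 1) - 1)"
            by (subst powr_add[symmetric]) (simp add: algebra_simps)
          also have "\<tau> * \<bar>e \<bullet> h\<bar> powr (p - 2) * \<dots> \<le> \<tau> * \<bar>e \<bullet> h\<bar> powr (p - 2) * 1"
            using i r01 t0 by (intro mult_left_mono powr_le1) auto
          also have "\<dots> = ?R"
            using True nh by (simp add: \<tau>h q_def)
          also have "\<dots> \<le> (1 + C3 powr (p - 2)) * ?R"
            by (simp add: algebra_simps)
          finally show ?thesis .
        next
          case False
          \<comment> \<open>For p \<ge> 2 the power p - 2 is nonnegative, and the increments need an
            upper bound linear in \<open>norm h\<close>.\<close>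
          have y4: "b + a \<le> 4" "b - a \<le> 4" "0 \<le> b + a" "0 \<le> b - a"
          proof -
            have "(r + norm h)\<^sup>2 \<le> 2\<^sup>2" using r01 h by (intro power_mono) auto
            then show "b + a \<le> 4" "b - a \<le> 4" using sq yp by auto
          qed (simp_all add: yp)
          have \<tau>nh: "\<tau> \<le> norm h" using h by (simp add: \<tau>h power2_eq_square mult_left_le)
          have ah: "\<bar>a\<bar> \<le> 2 * norm h"
          proof -
            have "2 * r * norm h \<le> 2 * 1 * norm h" using r01 by (intro mult_right_mono) auto
            then show ?thesis using ar by simp
          qed
          have "\<bar>A\<bar> \<le> real j * 4 ^ i * \<bar>b + a - t\<bar>"
            unfolding A_def j_def using y4 t0 t1 by (intro power_Suc_diff_le) auto
          also have "\<dots> \<le> real j * 4 ^ i * (3 * norm h)"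
            using \<tau>nh ah t0 by (intro mult_left_mono) (auto simp: b_def)
          finally have A3: "\<bar>A\<bar> \<le> real j * 4 ^ i * (3 * norm h)" .
          have "\<bar>B\<bar> \<le> real j * 4 ^ i * \<bar>b - a - t\<bar>"
            unfolding B_def j_def using y4 t0 t1 by (intro power_Suc_diff_le) auto
          also have "\<dots> \<le> real j * 4 ^ i * (3 * norm h)"
            using \<tau>nh ah t0 by (intro mult_left_mono) (auto simp: b_def)
          finally have "\<bar>A\<bar> + \<bar>B\<bar> \<le> C3 * norm h" using A3 by (simp add: C3_def)
          then have "(\<bar>A\<bar> + \<bar>B\<bar>) powr (p - 2) \<le> (C3 * norm h) powr (p - 2)"
            using False by (intro powr_mono2) auto
          also have "\<dots> = C3 powr (p - 2) * norm h powr (p - 2)" using C3 by (simp add: powr_mult)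
          finally have "\<tau> * t ^ i * (\<bar>A\<bar> + \<bar>B\<bar>) powr (p - 2) \<le> \<tau> * 1 * (C3 powr (p - 2) * norm h powr (p - 2))"
            using t0 ti1 by (intro mult_mono mult_left_mono) auto
          also have "\<dots> = C3 powr (p - 2) * (norm h powr 2 * norm h powr (p - 2))"
            using nh by (simp add: \<tau>h)
          also have "norm h powr 2 * norm h powr (p - 2) = norm h powr p"
            by (subst powr_add[symmetric]) simp
          also have "C3 powr (p - 2) * norm h powr p \<le> C3 powr (p - 2) * ?R"
            using hp by (intro mult_left_mono) auto
          also have "\<dots> \<le> (1 + C3 powr (p - 2)) * ?R" by (simp add: algebra_simps)
          finally show ?thesis .
        qed
        have "spow A (p - 1) + spow B (p - 1) \<le> (p + 1) * C2 * (\<tau> * t ^ i * (\<bar>A\<bar> + \<bar>B\<bar>) powr (p - 2))"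
          using step by (simp add: mult_ac)
        also have "\<dots> \<le> (p + 1) * C2 * ((1 + C3 powr (p - 2)) * ?R)"
          using near p C2 by (intro mult_left_mono) auto
        also have "\<dots> = Cn * ?R" by (simp add: Cn_def)
        finally show ?thesis using Cf R0 by (simp add: add_increasing)
      qed
    qed
    then show ?thesis by (simp only: fA distrib_right)
  qed
  show ?thesis
  proof (intro exI[of _ "Cf + Cn"] conjI allI impI)
    fix x :: 'a assume x: "norm x < 1"
    obtain e :: 'a where e: "norm e = 1" "norm x *\<^sub>R e = x"
    proof (cases "x = 0")
      case True
      obtain e :: 'a where "e \<in> Basis" using nonempty_Basis by blast
      then show ?thesis using True that[of e] by simp
    next
      case False
      then show ?thesis using that[of "x /\<^sub>R norm x"] by simp
    qed
    then show "\<exists>e. norm e = 1 \<and> (\<forall>h. norm h < 1 \<longrightarrow> e \<bullet> h \<noteq> 0 \<longrightarrow>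
        spow (f (x + h) - f x) (p - 1) + spow (f (x - h) - f x) (p - 1)
          \<le> (Cf + Cn) * (\<bar>e \<bullet> h\<bar> powr (min p 2 - 2) * norm h powr (p + 2 - min p 2)))"
      using bound[OF x] unfolding q_def by blast
  qed (use Cf Cn in auto)
qed

text \<open>The even exponent makes 1 - \<open>barrier\<close> a power of a squared norm inside the
  ball, so its differences are governed by polynomial expansions. Cutting at 0 only raises the
  function, the favourable direction for a subsolution at interior points.\<close>

definition barrier :: "nat \<Rightarrow> 'a::euclidean_space \<Rightarrow> real \<Rightarrow> 'a \<Rightarrow> real" where
  "barrier i x0 \<rho> x = max 0 (1 - (norm (x - x0) / \<rho>) ^ (2 * Suc i))"

lemma barrier_nonneg [simp]: "0 \<le> barrier i x0 \<rho> x"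
  by (simp add: barrier_def)

lemma barrier_le_1 [simp]: "0 < \<rho> \<Longrightarrow> barrier i x0 \<rho> x \<le> 1"
  by (simp add: barrier_def)

lemma barrier_outside: "0 < \<rho> \<Longrightarrow> x \<notin> ball x0 \<rho> \<Longrightarrow> barrier i x0 \<rho> x = 0"
  unfolding barrier_def using one_le_power[of "norm (x - x0) / \<rho>" "2 * Suc i"]
  by (auto simp: dist_norm norm_minus_commute simp del: power_Suc mult_Suc_right)

lemma barrier_ge_half:
  assumes "0 < \<rho>" "norm (x - x0) \<le> \<rho> / 2"
  shows "1 / 2 \<le> barrier i x0 \<rho> x"
proof -
  have "(norm (x - x0) / \<rho>) ^ (2 * Suc i) \<le> (1 / 2) ^ (2 * Suc i)"
    using assms by (intro power_mono) (auto simp: field_simps)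
  also have "\<dots> \<le> (1 / 2) ^ 1" by (intro power_decreasing) auto
  finally show ?thesis by (simp add: barrier_def del: power_Suc mult_Suc_right)
qed

lemma barrier_lipschitz:
  assumes "0 < \<rho>"
  shows "\<bar>barrier i x0 \<rho> x - barrier i x0 \<rho> y\<bar> \<le> real (2 * Suc i) / \<rho> * norm (x - y)"
proof -
  define n where "n x = min 1 (norm (x - x0) / \<rho>)" for x
  have b: "barrier i x0 \<rho> x = 1 - n x ^ (2 * Suc i)" for x
  proof (cases "norm (x - x0) / \<rho> \<le> 1")
    case True
    then have "(norm (x - x0) / \<rho>) ^ (2 * Suc i) \<le> 1" using assms by (intro power_le_one) auto
    then show ?thesis using True by (simp add: n_def barrier_def min_def del: power_Suc mult_Suc_right)
  next
    case False
    then have "1 \<le> (norm (x - x0) / \<rho>) ^ (2 * Suc i)" by (intro one_le_power) auto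
    then show ?thesis using False by (simp add: n_def barrier_def min_def del: power_Suc mult_Suc_right)
  qed
  have m: "2 * Suc i = Suc (2 * i + 1)" by simp
  have "\<bar>n x ^ (2 * Suc i) - n y ^ (2 * Suc i)\<bar> \<le> real (2 * Suc i) * 1 ^ (2 * i + 1) * \<bar>n x - n y\<bar>"
    unfolding m using assms by (intro power_Suc_diff_le) (auto simp: n_def)
  also have "\<bar>n x - n y\<bar> \<le> \<bar>norm (x - x0) / \<rho> - norm (y - x0) / \<rho>\<bar>"
    by (auto simp: n_def min_def)
  also have "\<dots> = \<bar>norm (x - x0) - norm (y - x0)\<bar> / \<rho>"
    using assms by (simp add: diff_divide_distrib[symmetric])
  also have "\<dots> \<le> norm (x - y) / \<rho>"
    using assms norm_triangle_ineq3[of "x - x0" "y - x0"] by (simp add: divide_right_mono)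
  finally have "\<bar>n x ^ (2 * Suc i) - n y ^ (2 * Suc i)\<bar> \<le> real (2 * Suc i) * (norm (x - y) / \<rho>)"
    by (simp add: mult_left_mono)
  then show ?thesis by (simp add: b abs_minus_commute)
qed

lemma barrier_measurable [measurable]: "barrier i x0 \<rho> \<in> borel_measurable borel"
  unfolding barrier_def[abs_def] by measurable

text \<open>The contribution to the fractional p-Laplacian of the barrier at x from distances
  between \<epsilon> and \<rho>. The lower cut avoids a principal value; the region beyond \<rho> is
  estimated together with the tail of the solution.\<close>

definition barrier_operator :: "real \<Rightarrow> real \<Rightarrow> nat \<Rightarrow> real \<Rightarrow> real^'n \<Rightarrow> real \<Rightarrow> real^'n \<Rightarrow> real" where
  "barrier_operator s p i \<epsilon> x0 \<rho> x = (\<integral>h. indicator {h. \<epsilon> \<le> norm h \<and> norm h < \<rho>} h *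
        (spow (barrier i x0 \<rho> x - barrier i x0 \<rho> (x + h)) (p - 1) * kern (p * s) h) \<partial>lborel)"

text \<open>Averaging over h and -h replaces the integrand by the symmetric difference, whose bound
  leaves the exponent p - p s > 0 and is integrable at 0; hence the constant is free of \<epsilon>.
  Scaling to the unit ball produces \<open>\<rho> powr (- (p * s))\<close>. A one-sided bound
  suffices for a subsolution.\<close>

lemma barrier_truncated_operator_bound:
  fixes p s :: real
  assumes p: "1 < p" and s: "0 < s" "s < 1" and i: "1 \<le> (2 * real i + 1) * (p - 1)"
  shows "\<exists>C\<ge>0. \<forall>(x0::real^'n) x \<rho> \<epsilon>. 0 < \<rho> \<longrightarrow> 0 < \<epsilon> \<longrightarrow> x \<in> ball x0 \<rho> \<longrightarrow>
     barrier_operator s p i \<epsilon> x0 \<rho> x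
      \<le> C * \<rho> powr (- (p * s))"
proof -
  let ?N = "real CARD('n)"
  define q where "q = min p 2"
  define f where "f = (\<lambda>x::real^'n. (x \<bullet> x) ^ Suc i)"
  obtain C where C: "C \<ge> 0" and Cb: "\<forall>x. norm x < 1 \<longrightarrow> (\<exists>e. norm e = 1 \<and>
     (\<forall>h. norm h < 1 \<longrightarrow> e \<bullet> h \<noteq> 0 \<longrightarrow>
        spow (f (x + h) - f x) (p - 1) + spow (f (x - h) - f x) (p - 1)
          \<le> C * (\<bar>e \<bullet> h\<bar> powr (q - 2) * norm h powr (p + 2 - q))))"
    using barrier_symmetric_difference[OF p i, where 'a="real^'n"] unfolding f_def q_def
    by (elim exE conjE) (rule that, simp_all only: f_def q_def)
  have q: "1 < q" "q \<le> 2" using p by (auto simp: q_def)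
  have \<beta>: "p - p * s > 0" using p s by simp
  obtain I where I: "I \<ge> 0" and Ib: "\<forall>e::real^'n. norm e = 1 \<longrightarrow>
     (\<integral>\<^sup>+ h. ennreal (indicator (ball 0 1) h *
            (\<bar>e \<bullet> h\<bar> powr (q - 2) * norm h powr (2 - q + (p - p * s) - ?N))) \<partial>lborel) \<le> ennreal I"
    using nn_integral_directional_powr[OF q \<beta>, where 'n='n]
    by (elim exE conjE) (rule that)
  have main: "barrier_operator s p i \<epsilon> x0 \<rho> x
      \<le> C * I * \<rho> powr (- (p * s))"
    if \<rho>: "0 < \<rho>" and \<epsilon>: "0 < \<epsilon>" and x: "x \<in> ball x0 \<rho>" for x0 x :: "real^'n" and \<rho> \<epsilon> :: real
  proof -
    let ?b = "barrier i x0 \<rho>"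
    define g where "g h = indicator {h. \<epsilon> \<le> norm h \<and> norm h < \<rho>} h *
        (spow (?b x - ?b (x + h)) (p - 1) * kern (p * s) h)" for h
    have g_borel [measurable]: "g \<in> borel_measurable borel" unfolding g_def[abs_def] by measurable
    define X where "X = (x - x0) /\<^sub>R \<rho>"
    have X: "norm X < 1" using x \<rho> by (simp add: X_def dist_norm norm_minus_commute inverse_eq_divide)
    obtain e where e: "norm e = 1" and eb: "\<And>h. norm h < 1 \<Longrightarrow> e \<bullet> h \<noteq> 0 \<Longrightarrow>
        spow (f (X + h) - f X) (p - 1) + spow (f (X - h) - f X) (p - 1)
          \<le> C * (\<bar>e \<bullet> h\<bar> powr (q - 2) * norm h powr (p + 2 - q))"
      using Cb X by blast
    define G where "G h = ennreal (indicator (ball 0 1) h *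
            (\<bar>e \<bullet> h\<bar> powr (q - 2) * norm h powr (2 - q + (p - p * s) - ?N)))" for h :: "real^'n"
    have ball_borel [measurable]: "ball (0::real^'n) 1 \<in> sets borel" by simp
    have G_borel [measurable]: "G \<in> borel_measurable borel" unfolding G_def[abs_def] by measurable
    have fX: "f ((y - x0) /\<^sub>R \<rho>) = (norm (y - x0) / \<rho>) ^ (2 * Suc i)" for y
    proof -
      have "((y - x0) /\<^sub>R \<rho>) \<bullet> ((y - x0) /\<^sub>R \<rho>) = (norm ((y - x0) /\<^sub>R \<rho>))\<^sup>2"
        by (rule power2_norm_eq_inner[symmetric])
      also have "norm ((y - x0) /\<^sub>R \<rho>) = norm (y - x0) / \<rho>" using \<rho> by (simp add: divide_inverse mult.commute)
      finally show ?thesis unfolding f_def by (simp only: power_mult)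
    qed
    have bx: "?b x = 1 - f X"
    proof -
      have "f X \<le> 1" unfolding X_def fX using X \<rho> by (intro power_le_one) (auto simp: X_def divide_inverse mult.commute)
      then show ?thesis by (simp add: barrier_def X_def fX)
    qed
    \<comment> \<open>The maximum in the barrier can only enlarge its value at x + h, while at x,
      inside the ball, it is inactive.\<close>
    have bdiff: "?b x - ?b (x + h) \<le> f (X + h /\<^sub>R \<rho>) - f X" for h
    proof -
      have "X + h /\<^sub>R \<rho> = (x + h - x0) /\<^sub>R \<rho>" by (simp add: X_def algebra_simps)
      then have "f (X + h /\<^sub>R \<rho>) = (norm (x + h - x0) / \<rho>) ^ (2 * Suc i)" using fX by simp
      then show ?thesis unfolding bx by (simp add: barrier_def)
    qed
    have pw: "g h + g (- h) \<le> C * \<rho> powr (- ?N - p * s) * (indicator (ball 0 1) (h /\<^sub>R \<rho>) *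
            (\<bar>e \<bullet> (h /\<^sub>R \<rho>)\<bar> powr (q - 2) * norm (h /\<^sub>R \<rho>) powr (2 - q + (p - p * s) - ?N)))"
      if eh: "e \<bullet> h \<noteq> 0" for h
    proof (cases "\<epsilon> \<le> norm h \<and> norm h < \<rho>")
      case True
      define H where "H = h /\<^sub>R \<rho>"
      have hH: "h = \<rho> *\<^sub>R H" using \<rho> by (simp add: H_def)
      have H: "norm H < 1" "e \<bullet> H \<noteq> 0" using True \<rho> eh by (auto simp: H_def field_simps)
      have nH: "norm H > 0" using H by auto
      have "g h + g (- h) = (spow (?b x - ?b (x + h)) (p - 1) + spow (?b x - ?b (x + (- h))) (p - 1)) * kern (p * s) h"
        using True by (simp add: g_def algebra_simps)
      also have "\<dots> \<le> (spow (f (X + H) - f X) (p - 1) + spow (f (X - H) - f X) (p - 1)) * kern (p * s) h"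
        using bdiff[of h] bdiff[of "- h"] p
        by (intro mult_right_mono add_mono spow_mono) (auto simp: H_def)
      also have "\<dots> \<le> (C * (\<bar>e \<bullet> H\<bar> powr (q - 2) * norm H powr (p + 2 - q))) * kern (p * s) h"
        using eb[OF H] by (intro mult_right_mono) auto
      also have "kern (p * s) h = \<rho> powr (- ?N - p * s) * norm H powr (- (?N + p * s))"
        unfolding hH kern_scale[OF \<rho>] by (simp only: kern_def powr_minus_divide)
      also have "C * (\<bar>e \<bullet> H\<bar> powr (q - 2) * norm H powr (p + 2 - q)) * \<dots>
         = C * \<rho> powr (- ?N - p * s) * (\<bar>e \<bullet> H\<bar> powr (q - 2) * (norm H powr (p + 2 - q) * norm H powr (- (?N + p * s))))"
        by simp
      also have "norm H powr (p + 2 - q) * norm H powr (- (?N + p * s)) = norm H powr (2 - q + (p - p * s) - ?N)"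
        by (subst powr_add[symmetric]) (simp add: algebra_simps)
      finally show ?thesis using H by (simp add: H_def)
    next
      case False
      then have "g h + g (- h) = 0" by (simp add: g_def)
      then show ?thesis using C by simp
    qed
    have AE_eh: "AE h in lborel. e \<bullet> h \<noteq> 0"
    proof -
      have "negligible {h. e \<bullet> h = 0}" using e by (intro negligible_hyperplane) auto
      then have "{h. e \<bullet> h = 0} \<in> null_sets lborel"
        by (subst (asm) negligible_iff_null_sets) (auto simp: null_sets_def)
      then show ?thesis by (rule AE_I') auto
    qed
    have "integral\<^sup>L lborel g \<le> C * I * \<rho> powr (- (p * s))"
    proof (cases "integrable lborel g")
      \<comment> \<open>A non-integrable function has Bochner integral 0, and the bound is
        nonnegative.\<close>
      case False
      then show ?thesis using C I by (simp add: not_integrable_integral_eq)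
    next
      case True
      have refl: "integrable lborel (\<lambda>h. g (0 - h))" "(\<integral>h. g (0 - h) \<partial>lborel) = integral\<^sup>L lborel g"
        using True lborel_distr_reflect[of "0::real^'n"]
          integrable_distr_eq[of "\<lambda>h. 0 - h" lborel borel g] integral_distr[of "\<lambda>h. 0 - h" lborel borel g]
        by simp_all
      \<comment> \<open>The upper bound alone suffices: the nonnegative integral in
        \<open>integral_real_bounded\<close> sees only the positive part.\<close>
      have "(\<integral>h. g h + g (0 - h) \<partial>lborel) \<le> C * \<rho> powr (- (p * s)) * I"
      proof (rule integral_real_bounded)
        show "0 \<le> C * \<rho> powr (- (p * s)) * I" using C I by simp
        have "(\<integral>\<^sup>+ h. ennreal (g h + g (0 - h)) \<partial>lborel) \<le> (\<integral>\<^sup>+ h. ennreal (C * \<rho> powr (- ?N - p * s)) * G ((h - 0) /\<^sub>R \<rho>) \<partial>lborel)"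
          using AE_eh
        proof (intro nn_integral_mono_AE, eventually_elim)
          fix h assume "e \<bullet> h \<noteq> 0"
          from pw[OF this] show "ennreal (g h + g (0 - h)) \<le> ennreal (C * \<rho> powr (- ?N - p * s)) * G ((h - 0) /\<^sub>R \<rho>)"
            unfolding G_def using C by (subst ennreal_mult[symmetric]) (auto intro!: ennreal_leI)
        qed
        also have "\<dots> = ennreal (C * \<rho> powr (- ?N - p * s)) * (ennreal (\<rho> ^ DIM(real^'n)) * (\<integral>\<^sup>+ h. G h \<partial>lborel))"
          using nn_integral_lborel_affine_scale[OF G_borel \<rho>, of 0]
          by (subst nn_integral_cmult) simp_all
        also have "\<dots> \<le> ennreal (C * \<rho> powr (- ?N - p * s)) * (ennreal (\<rho> ^ DIM(real^'n)) * ennreal I)"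
          using Ib[rule_format, OF e] unfolding G_def by (intro mult_left_mono) auto
        also have "\<dots> = ennreal (C * \<rho> powr (- ?N - p * s) * (\<rho> ^ DIM(real^'n) * I))"
          using C I \<rho> by (simp add: ennreal_mult)
        also have "C * \<rho> powr (- ?N - p * s) * (\<rho> ^ DIM(real^'n) * I) = C * \<rho> powr (- (p * s)) * I"
        proof -
          have "\<rho> ^ DIM(real^'n) = \<rho> powr ?N" using \<rho> by (simp add: powr_realpow)
          then have "\<rho> powr (- ?N - p * s) * \<rho> ^ DIM(real^'n) = \<rho> powr (- (p * s))"
            by (simp only: powr_add[symmetric]) simp
          then show ?thesis by (simp only: mult.assoc[symmetric]) (simp only: mult.assoc)
        qed
        finally show "(\<integral>\<^sup>+ h. ennreal (g h + g (0 - h)) \<partial>lborel) \<le> ennreal (C * \<rho> powr (- (p * s)) * I)" .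
      qed
      moreover have "(\<integral>h. g h + g (0 - h) \<partial>lborel) = 2 * integral\<^sup>L lborel g"
        using True refl by simp
      ultimately have "2 * integral\<^sup>L lborel g \<le> C * I * \<rho> powr (- (p * s))" by (simp add: mult_ac)
      moreover have "0 \<le> C * I * \<rho> powr (- (p * s))" using C I by simp
      ultimately show ?thesis by linarith
    qed
    then show ?thesis unfolding g_def[abs_def] barrier_operator_def .
  qed
  show ?thesis
    by (rule exI[of _ "C * I"]) (use C I main in auto)
qed

section \<open>Exterior balls and Hoelder representatives\<close>

lemma lipschitz_derivative_taylor:
  fixes \<gamma> :: "'a::euclidean_space \<Rightarrow> real"
  assumes der: "\<And>z. (\<gamma> has_derivative D z) (at z)"
    and lip: "\<And>z w h. \<bar>D z h - D w h\<bar> \<le> L * norm (z - w) * norm h"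
  shows "\<bar>\<gamma> (z + h) - \<gamma> z - D z h\<bar> \<le> \<bar>L\<bar> * (norm h)\<^sup>2"
proof -
  have lin: "linear (D z)" using der[of z] by (rule has_derivative_linear)
  define g where "g t = \<gamma> (z + t *\<^sub>R h) - t * D z h" for t
  have dg: "(g has_real_derivative (D (z + t *\<^sub>R h) h - D z h)) (at t)" for t
  proof -
    have "((\<lambda>t. \<gamma> (z + t *\<^sub>R h)) has_derivative (\<lambda>s. D (z + t *\<^sub>R h) (s *\<^sub>R h))) (at t)"
      by (rule has_derivative_compose[of "\<lambda>t. z + t *\<^sub>R h" "\<lambda>s. s *\<^sub>R h", OF _ der])
         (auto intro!: derivative_eq_intros)
    moreover have "D (z + t *\<^sub>R h) (s *\<^sub>R h) = s * D (z + t *\<^sub>R h) h" for s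
      using has_derivative_linear[OF der[of "z + t *\<^sub>R h"]] by (simp add: linear_scale)
    ultimately have "((\<lambda>t. \<gamma> (z + t *\<^sub>R h)) has_real_derivative D (z + t *\<^sub>R h) h) (at t)"
      by (simp add: has_field_derivative_def mult_commute_abs)
    then show ?thesis unfolding g_def by (auto intro!: derivative_eq_intros)
  qed
  obtain t where t: "0 < t" "t < 1" "g 1 - g 0 = (1 - 0) * (D (z + t *\<^sub>R h) h - D z h)"
    using MVT2[of 0 1 g "\<lambda>t. D (z + t *\<^sub>R h) h - D z h"] dg by auto
  have "\<bar>\<gamma> (z + h) - \<gamma> z - D z h\<bar> = \<bar>D (z + t *\<^sub>R h) h - D z h\<bar>"
    using t(3) by (simp add: g_def)
  also have "\<dots> \<le> L * norm (z + t *\<^sub>R h - z) * norm h" by (rule lip)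
  also have "\<dots> \<le> \<bar>L\<bar> * (1 * norm h) * norm h"
    using t mult_right_mono[of t 1 "norm h"] by (auto intro!: mult_right_mono mult_mono)
  finally show ?thesis by (simp add: power2_eq_square)
qed

text \<open>Moving from z by \<tau> against the gradient n of \<open>z $ k - \<gamma> z\<close>
  lowers the linear part by \<tau> times the norm of n, which is at least 1. A deviation of \<tau>/8
  costs at most an eighth of this, and the Taylor remainder at distance 9\<tau>/8 is at most
  81\<tau>/128 because \<open>\<bar>L\<bar> * \<tau> \<le> 1 / 2\<close>. The ratio 1/8 is therefore
  independent of L; only the range of \<tau> depends on it.\<close>

lemma epigraph_exterior_ball:
  fixes \<gamma> :: "real^'n \<Rightarrow> real"
  assumes inv: "\<And>z. \<gamma> z = \<gamma> (z + (- (z $ k)) *\<^sub>R axis k (1::real))"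
    and der: "\<And>z. (\<gamma> has_derivative D z) (at z)"
    and lip: "\<And>z w h. \<bar>D z h - D w h\<bar> \<le> L * norm (z - w) * norm h"
    and z: "z $ k \<le> \<gamma> z" and \<tau>: "0 < \<tau>" "\<bar>L\<bar> * \<tau> \<le> 1 / 2"
  shows "\<exists>w. norm w = \<tau> \<and> (\<forall>b. norm b < \<tau> / 8 \<longrightarrow> (z + w + b) $ k \<le> \<gamma> (z + w + b))"
proof -
  define e where "e = (axis k 1 :: real^'n)"
  have lin: "linear (D z)" using der[of z] by (rule has_derivative_linear)
  \<comment> \<open>\<gamma> is constant in direction k, so its derivative along e vanishes. This
    gives F e = 1 and hence the lower bound 1 for the norm of n.\<close>
  have De: "D z e = 0"
  proof -
    have inv': "\<gamma> (z + t *\<^sub>R e) = \<gamma> z" for t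
      using inv[of "z + t *\<^sub>R e"] inv[of z] by (simp add: e_def algebra_simps axis_def)
    have "((\<lambda>t. \<gamma> (z + t *\<^sub>R e)) has_derivative (\<lambda>s. D z (s *\<^sub>R e))) (at 0)"
      by (rule has_derivative_compose[of "\<lambda>t. z + t *\<^sub>R e" "\<lambda>s. s *\<^sub>R e" 0 UNIV \<gamma>])
         (auto intro!: derivative_eq_intros der)
    moreover have "((\<lambda>t. \<gamma> (z + t *\<^sub>R e)) has_derivative (\<lambda>s. 0)) (at (0::real))"
      by (simp add: inv')
    ultimately have "(\<lambda>s. D z (s *\<^sub>R e)) = (\<lambda>s::real. 0)" by (rule has_derivative_unique)
    then show ?thesis by (metis scaleR_one)
  qed
  define F where "F h = h $ k - D z h" for h
  have linF: "linear F" unfolding F_def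
    using lin by (intro linear_compose_sub) (auto intro: linearI)
  \<comment> \<open>The gradient vector representing the functional \<open>F\<close>, obtained as
    its adjoint at 1.\<close>
  define n where "n = adjoint F 1"
  have Fn: "F h = h \<bullet> n" for h
    using adjoint_works[OF linF, of h 1] by (simp add: n_def)
  have "F e = 1" unfolding F_def De by (simp add: e_def axis_def)
  then have "1 \<le> norm e * norm n" using Fn[of e] Cauchy_Schwarz_ineq2[of e n] by simp
  then have n1: "1 \<le> norm n" by (simp add: e_def norm_axis_1)
  define w where "w = (- \<tau> / norm n) *\<^sub>R n"
  have nw: "norm w = \<tau>" using n1 \<tau> by (auto simp: w_def)
  have Fw: "F w = - \<tau> * norm n"
    using n1 unfolding Fn w_def by (simp add: power2_norm_eq_inner[symmetric] power2_eq_square)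
  have "(z + w + b) $ k \<le> \<gamma> (z + w + b)" if b: "norm b < \<tau> / 8" for b
  proof -
    let ?h = "w + b"
    have "F b \<le> norm b * norm n" using Cauchy_Schwarz_ineq2[of b n] by (simp add: Fn)
    also have "\<dots> \<le> \<tau> / 8 * norm n" using b by (intro mult_right_mono) auto
    finally have "F ?h \<le> - (7 / 8 * \<tau>) * norm n" using Fw linF by (simp add: linear_add)
    also have "\<dots> \<le> - (7 / 8 * \<tau>)" using n1 \<tau> by (simp add: mult_le_cancel_left1)
    finally have Fh: "F ?h \<le> - (7 / 8 * \<tau>)" .
    have nh: "norm ?h \<le> 9 / 8 * \<tau>" using norm_triangle_ineq[of w b] nw b by simp
    have "\<bar>L\<bar> * (norm ?h)\<^sup>2 \<le> \<bar>L\<bar> * (9 / 8 * \<tau>)\<^sup>2" using nh by (intro mult_left_mono power_mono) auto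
    also have "\<dots> = (\<bar>L\<bar> * \<tau>) * (81 / 64 * \<tau>)" by (simp add: power2_eq_square)
    also have "\<dots> \<le> 1 / 2 * (81 / 64 * \<tau>)" using \<tau> by (intro mult_right_mono) auto
    also have "\<dots> \<le> 7 / 8 * \<tau>" using \<tau> by simp
    finally have Lh: "\<bar>L\<bar> * (norm ?h)\<^sup>2 \<le> 7 / 8 * \<tau>" .
    have "\<gamma> (z + ?h) \<ge> \<gamma> z + D z ?h - \<bar>L\<bar> * (norm ?h)\<^sup>2"
      using lipschitz_derivative_taylor[of \<gamma> D L z ?h, OF der lip] by linarith
    moreover have "(z + ?h) $ k = z $ k + F ?h + D z ?h" by (simp add: F_def)
    ultimately show ?thesis using Fh Lh z by (simp add: add.assoc)
  qed
  then show ?thesis using nw by blast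
qed

text \<open>A weak form of the uniform exterior ball condition: a ball of fixed relative size near
  each frontier point, not tangent at it. Compactness of the frontier merges the local thresholds
  into one \<tau>0 depending on the domain, while the ratio 1/8 does not.\<close>

lemma C11_domain_exterior_ball:
  fixes \<Omega> :: "(real^'n) set"
  assumes C: "C11_domain \<Omega>"
  shows "\<exists>\<tau>0>0. \<forall>z\<in>frontier \<Omega>. \<forall>\<tau>. 0 < \<tau> \<longrightarrow> \<tau> < \<tau>0 \<longrightarrow>
    (\<exists>y. dist z y = \<tau> \<and> ball y (\<tau> / 8) \<inter> \<Omega> = {})"
proof -
  let ?P = "\<lambda>z \<tau>. \<exists>y. dist z y = \<tau> \<and> ball y (\<tau> / 8) \<inter> \<Omega> = {}"
  have op: "open \<Omega>" and bd: "bounded \<Omega>" using C by (auto simp: C11_domain_def)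
  have loc: "\<exists>r>0. \<exists>\<tau>0>0. \<forall>z\<in>frontier \<Omega> \<inter> ball x0 r. \<forall>\<tau>. 0 < \<tau> \<longrightarrow> \<tau> < \<tau>0 \<longrightarrow> ?P z \<tau>"
    if x0: "x0 \<in> frontier \<Omega>" for x0
  proof -
    from C x0 show ?thesis unfolding C11_domain_def
    proof (elim conjE ballE exE)
      fix r :: real and R :: "real^'n \<Rightarrow> real^'n" and k and \<gamma> :: "real^'n \<Rightarrow> real" and D and L :: real
      assume r: "0 < r" and R: "orthogonal_transformation R"
        and inv': "\<forall>z. \<gamma> z = \<gamma> (z + (- (z $ k)) *\<^sub>R axis k (1::real))"
        and der': "\<forall>z. (\<gamma> has_derivative D z) (at z)"
        and lip': "\<forall>z w h. \<bar>D z h - D w h\<bar> \<le> L * norm (z - w) * norm h"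
        and chart: "\<Omega> \<inter> ball x0 r = {x \<in> ball x0 r. R (x - x0) $ k > \<gamma> (R (x - x0))}"
      note inv = inv'[rule_format] and der = der'[rule_format] and lip = lip'[rule_format]
      \<comment> \<open>The first bound keeps the shifted points in the chart, since r/2 + \<tau> +
        \<tau>/8 < r; the second gives \<open>\<bar>L\<bar> * \<tau> \<le> 1 / 2\<close>.\<close>
      define \<tau>0 where "\<tau>0 = min (r / 4) (1 / (2 * (\<bar>L\<bar> + 1)))"
      have \<tau>0: "\<tau>0 > 0" using r by (simp add: \<tau>0_def)
      have lin: "linear R" using R by (rule orthogonal_transformation_linear)
      have "?P z \<tau>" if z: "z \<in> frontier \<Omega>" "z \<in> ball x0 (r / 2)" and \<tau>: "0 < \<tau>" "\<tau> < \<tau>0" for z \<tau>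
      proof -
        have "z \<notin> \<Omega>" using z op by (simp add: frontier_def interior_open)
        moreover have "z \<in> ball x0 r" using z r by auto
        ultimately have zk: "R (z - x0) $ k \<le> \<gamma> (R (z - x0))" using chart by force
        have "\<bar>L\<bar> * \<tau> \<le> \<bar>L\<bar> * (1 / (2 * (\<bar>L\<bar> + 1)))"
          using \<tau> by (intro mult_left_mono) (auto simp: \<tau>0_def)
        also have "\<dots> \<le> 1 / 2" by (simp add: field_simps)
        finally have L\<tau>: "\<bar>L\<bar> * \<tau> \<le> 1 / 2" .
        obtain w where w: "norm w = \<tau>" and
          wb: "\<And>b. norm b < \<tau> / 8 \<Longrightarrow> (R (z - x0) + w + b) $ k \<le> \<gamma> (R (z - x0) + w + b)"
          using epigraph_exterior_ball[OF inv der lip zk \<tau>(1) L\<tau>] by blast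
        obtain v where v: "R v = w" using orthogonal_transformation_surj[OF R] by (metis surjD)
        have nv: "norm v = \<tau>" using w v orthogonal_transformation_norm[OF R, of v] by simp
        have "x \<notin> \<Omega>" if "x \<in> ball (z + v) (\<tau> / 8)" for x
        proof
          assume x\<Omega>: "x \<in> \<Omega>"
          define b where "b = x - (z + v)"
          have nb: "norm b < \<tau> / 8" using that by (simp add: b_def dist_norm norm_minus_commute)
          have "x - x0 = (z - x0) + v + b" by (simp add: b_def)
          have "norm (x - x0) \<le> norm (z - x0) + norm v + norm b"
            unfolding \<open>x - x0 = (z - x0) + v + b\<close>
              using norm_triangle_ineq[of "z - x0 + v" b] norm_triangle_ineq[of "z - x0" v] by linarith
          also have "\<dots> < r / 2 + \<tau> + \<tau> / 8" using nb nv z by (simp add: dist_norm norm_minus_commute)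
          also have "\<dots> < r" using \<tau> by (auto simp: \<tau>0_def)
          finally have "x \<in> ball x0 r" by (simp add: dist_norm norm_minus_commute)
          then have "R (x - x0) $ k > \<gamma> (R (x - x0))" using chart x\<Omega> by blast
          moreover have "R (x - x0) = R (z - x0) + w + R b"
            unfolding \<open>x - x0 = (z - x0) + v + b\<close> using lin v by (simp add: linear_add)
          moreover have "norm (R b) < \<tau> / 8" using nb orthogonal_transformation_norm[OF R] by simp
          ultimately show False using wb[of "R b"] by simp
        qed
        then show ?thesis by (intro exI[of _ "z + v"]) (auto simp: dist_norm nv)
      qed
      then show ?thesis using r \<tau>0 by (intro exI[of _ "r / 2"] conjI exI[of _ \<tau>0]) auto
    qed (use x0 in simp)
  qed
  then obtain r \<tau>0 where rt: "\<And>x0. x0 \<in> frontier \<Omega> \<Longrightarrow> r x0 > 0 \<and> \<tau>0 x0 > 0 \<and>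
      (\<forall>z\<in>frontier \<Omega> \<inter> ball x0 (r x0). \<forall>\<tau>. 0 < \<tau> \<longrightarrow> \<tau> < \<tau>0 x0 \<longrightarrow> ?P z \<tau>)"
    by metis
  have "compact (frontier \<Omega>)" using bd by (rule compact_frontier_bounded)
  then obtain F where F: "F \<subseteq> frontier \<Omega>" "finite F" "frontier \<Omega> \<subseteq> (\<Union>x\<in>F. ball x (r x))"
    by (rule compactE_image[of "frontier \<Omega>" "frontier \<Omega>" "\<lambda>x. ball x (r x)"]) (use rt in auto)
  define \<tau>1 where "\<tau>1 = Min (insert 1 (\<tau>0 ` F))"
  have "\<tau>1 > 0" unfolding \<tau>1_def using F rt by (subst Min_gr_iff) auto
  moreover have "?P z \<tau>" if z: "z \<in> frontier \<Omega>" and \<tau>: "0 < \<tau>" "\<tau> < \<tau>1" for z \<tau>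
  proof -
    obtain x0 where x0: "x0 \<in> F" "z \<in> ball x0 (r x0)" using F z by blast
    have "\<tau>1 \<le> \<tau>0 x0" unfolding \<tau>1_def using F x0 by (intro Min_le) auto
    then show ?thesis using rt[of x0] F x0 z \<tau> by auto
  qed
  ultimately show ?thesis by blast
qed

text \<open>Off a null set, \<open>u\<close> satisfies the oscillation bound on all balls of a countable family, which
  makes it uniformly continuous there.\<close>
lemma oscillation_decay_imp_holder:
  fixes u :: "real^'n \<Rightarrow> real" and \<Omega> :: "(real^'n) set"
  assumes op: "open \<Omega>" and bnd: "bounded \<Omega>" and \<alpha>: "0 < \<alpha>" and R0: "0 < R0" and \<Lambda>: "0 \<le> \<Lambda>"
    and osc: "\<And>x0 j. x0 \<in> closure \<Omega> \<Longrightarrow>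
      \<exists>m. AE x in lebesgue. dist x0 x < R0 * (1 / 16) ^ j \<longrightarrow> m \<le> u x \<and> u x \<le> m + \<Lambda> * (1 / 16) powr (\<alpha> * real j)"
    and osc0: "AE x in lebesgue. \<bar>u x\<bar> \<le> \<Lambda> / 2"
  shows "\<exists>v. (AE x in lebesgue. x \<in> closure \<Omega> \<longrightarrow> u x = v x) \<and> continuous_on (closure \<Omega>) v \<and>
     (\<forall>x\<in>closure \<Omega>. \<forall>y\<in>closure \<Omega>. \<bar>v x - v y\<bar> \<le> \<Lambda> * (32 / R0) powr \<alpha> * dist x y powr \<alpha>)"
proof -
  let ?K = "closure \<Omega>"
  obtain Q where Q: "countable Q" "Q \<subseteq> ?K" "?K \<subseteq> closure Q"
    using separable[of ?K] by blast
  \<comment> \<open>Fixing the constants once for all centres in a countable dense set and all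
    scales lets the exceptional sets be united into a single null set Z.\<close>
  define m where "m x0 j = (SOME m. AE x in lebesgue. dist x0 x < R0 * (1 / 16) ^ j \<longrightarrow> m \<le> u x \<and> u x \<le> m + \<Lambda> * (1 / 16) powr (\<alpha> * real j))" for x0 and j :: nat
  have m: "AE x in lebesgue. dist x0 x < R0 * (1 / 16) ^ j \<longrightarrow> m x0 j \<le> u x \<and> u x \<le> m x0 j + \<Lambda> * (1 / 16) powr (\<alpha> * real j)"
    if "x0 \<in> ?K" for x0 j
    unfolding m_def by (rule someI_ex) (rule osc[OF that])
  have "AE x in lebesgue. \<forall>q\<in>Q. \<forall>j. dist q x < R0 * (1 / 16) ^ j \<longrightarrow> m q j \<le> u x \<and> u x \<le> m q j + \<Lambda> * (1 / 16) powr (\<alpha> * real j)"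
    using Q m by (auto simp: AE_ball_countable AE_all_countable)
  with osc0 have "AE x in lebesgue. \<bar>u x\<bar> \<le> \<Lambda> / 2 \<and> (\<forall>q\<in>Q. \<forall>j. dist q x < R0 * (1 / 16) ^ j \<longrightarrow> m q j \<le> u x \<and> u x \<le> m q j + \<Lambda> * (1 / 16) powr (\<alpha> * real j))"
    by eventually_elim auto
  then obtain Z where ZZ: "\<And>x. x \<in> space lebesgue - Z \<Longrightarrow> \<bar>u x\<bar> \<le> \<Lambda> / 2 \<and> (\<forall>q\<in>Q. \<forall>j. dist q x < R0 * (1 / 16) ^ j \<longrightarrow> m q j \<le> u x \<and> u x \<le> m q j + \<Lambda> * (1 / 16) powr (\<alpha> * real j))"
    and Z: "Z \<in> null_sets lebesgue"
    by (rule AE_E3) blast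
  have Zb: "\<bar>u x\<bar> \<le> \<Lambda> / 2" if "x \<notin> Z" for x using ZZ[of x] that by simp
  have Zo: "m q j \<le> u x \<and> u x \<le> m q j + \<Lambda> * (1 / 16) powr (\<alpha> * real j)"
    if "x \<notin> Z" "q \<in> Q" "dist q x < R0 * (1 / 16) ^ j" for x q j using ZZ[of x] that by simp
  define S where "S = ?K - Z"
  define H where "H = \<Lambda> * (32 / R0) powr \<alpha>"
  have H: "H \<ge> 0" using \<Lambda> by (simp add: H_def)
  have hold: "\<bar>u x - u y\<bar> \<le> H * dist x y powr \<alpha>" if x: "x \<in> S" and y: "y \<in> S" for x y
  proof (cases "x = y")
    case False
    then have d: "dist x y > 0" by simp
    show ?thesis
    proof (cases "dist x y < R0 / 2")
      case True
      \<comment> \<open>The last scale at which \<open>dist x y\<close> is below half the radius: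
        the ball around a centre q within half the radius of x contains both points, and failure at
        the next scale bounds the radius by 32 = 2 * 16 times \<open>dist x y\<close>.\<close>
      define P where "P j \<longleftrightarrow> dist x y < R0 * (1 / 16) ^ j / 2" for j :: nat
      have P0: "P 0" using True by (simp add: P_def)
      have "\<exists>j. \<not> P j"
      proof -
        have "(\<lambda>j. R0 * (1 / 16) ^ j / 2) \<longlonglongrightarrow> R0 * 0 / 2"
          by (intro tendsto_intros LIMSEQ_realpow_zero) auto
        then have "eventually (\<lambda>j. R0 * (1 / 16) ^ j / 2 < dist x y) sequentially"
          using d by (intro order_tendstoD(2)[where y = "R0 * 0 / 2"]) auto
        then obtain n where "R0 * (1 / 16) ^ n / 2 < dist x y"
          by (auto simp: eventually_sequentially)
        then show ?thesis by (intro exI[of _ n]) (simp add: P_def)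
      qed
      then obtain j where j: "P j" "\<not> P (Suc j)"
        using P0 by (metis nat_induct)
      have rj: "R0 * (1 / 16) ^ j / 2 > 0" using R0 by simp
      obtain q where q: "q \<in> Q" "dist q x < R0 * (1 / 16) ^ j / 2"
        using Q(3) x rj unfolding S_def by (meson DiffD1 closure_approachable subsetD)
      have "dist q y \<le> dist q x + dist x y" by (rule dist_triangle)
      then have "dist q y < R0 * (1 / 16) ^ j" "dist q x < R0 * (1 / 16) ^ j" using q j rj by (auto simp: P_def)
      then have "\<bar>u x - u y\<bar> \<le> \<Lambda> * (1 / 16) powr (\<alpha> * real j)"
        using Zo[of x q j] Zo[of y q j] x y q by (auto simp: S_def)
      also have "(1 / 16) powr (\<alpha> * real j) = ((1 / 16) ^ j) powr \<alpha>"
        by (simp add: powr_realpow[symmetric] powr_powr mult.commute)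
      also have "((1 / 16) ^ j) powr \<alpha> \<le> (32 / R0 * dist x y) powr \<alpha>"
        using j(2) R0 \<alpha> by (intro powr_mono2) (auto simp: P_def field_simps)
      also have "\<dots> = (32 / R0) powr \<alpha> * dist x y powr \<alpha>" using R0 by (intro powr_mult)
      finally show ?thesis using \<Lambda> by (simp add: H_def mult_left_mono mult.assoc)
    next
      case False
      have "\<bar>u x - u y\<bar> \<le> \<Lambda> * 1" using Zb[of x] Zb[of y] x y by (auto simp: S_def)
      also have "1 \<le> (32 / R0 * dist x y) powr \<alpha>"
        using False R0 \<alpha> by (intro ge_one_powr_ge_zero) (auto simp: field_simps)
      also have "\<dots> = (32 / R0) powr \<alpha> * dist x y powr \<alpha>" using R0 by (intro powr_mult)
      finally show ?thesis using \<Lambda> by (simp add: H_def mult_left_mono mult.assoc)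
    qed
  qed simp
  have uc: "uniformly_continuous_on S u"
    unfolding uniformly_continuous_on_def
  proof (intro allI impI)
    fix \<epsilon> :: real assume \<epsilon>: "\<epsilon> > 0"
    define d where "d = (\<epsilon> / (H + 1)) powr (1 / \<alpha>)"
    have "d > 0" using \<epsilon> H by (simp add: d_def)
    moreover have "dist (u x') (u x) < \<epsilon>" if "x \<in> S" "x' \<in> S" "dist x' x < d" for x x'
    proof -
      have "dist x' x powr \<alpha> \<le> d powr \<alpha>" using that \<alpha> by (intro powr_mono2) auto
      also have "d powr \<alpha> = \<epsilon> / (H + 1)" using \<alpha> \<epsilon> H by (simp add: d_def powr_powr)
      finally have "H * dist x' x powr \<alpha> \<le> H * (\<epsilon> / (H + 1))" using H by (intro mult_left_mono)
      also have "\<dots> < \<epsilon>" using H \<epsilon> by (simp add: field_simps)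
      finally show ?thesis using hold[OF that(2,1)] by (simp add: dist_real_def)
    qed
    ultimately show "\<exists>d>0. \<forall>x\<in>S. \<forall>x'\<in>S. dist x' x < d \<longrightarrow> dist (u x') (u x) < \<epsilon>" by blast
  qed
  obtain v where v: "uniformly_continuous_on (closure S) v" "\<And>x. x \<in> S \<Longrightarrow> u x = v x"
    using uniformly_continuous_on_extension_on_closure[OF uc] by metis
  \<comment> \<open>A null set contains no nonempty open set, so removing Z does not shrink the
    closure and the extension is defined on all of it.\<close>
  have clS: "closure S = ?K"
  proof
    show "closure S \<subseteq> ?K" unfolding S_def by (intro closure_minimal) auto
    have "\<Omega> \<subseteq> closure S"
    proof
      fix x assume x: "x \<in> \<Omega>"
      show "x \<in> closure S"
        unfolding closure_approachable
      proof (intro allI impI)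
        fix \<epsilon> :: real assume \<epsilon>: "\<epsilon> > 0"
        let ?B = "\<Omega> \<inter> ball x \<epsilon>"
        have "\<not> negligible ?B" using op x \<epsilon> by (intro open_not_negligible) auto
        then have "\<not> ?B \<subseteq> Z" using Z by (meson negligible_iff_null_sets negligible_subset)
        then obtain y where "y \<in> ?B" "y \<notin> Z" by blast
        then show "\<exists>y\<in>S. dist y x < \<epsilon>"
          using closure_subset[of \<Omega>] by (auto simp: S_def dist_commute intro!: bexI[of _ y])
      qed
    qed
    then show "?K \<subseteq> closure S" by (rule closure_minimal) simp
  qed
  have contv: "continuous_on ?K v"
    using v(1) clS by (simp add: uniformly_continuous_imp_continuous)
  have "\<bar>v x - v y\<bar> \<le> H * dist x y powr \<alpha>" if x: "x \<in> ?K" and y: "y \<in> ?K" for x y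
  proof -
    obtain X where X: "\<And>n. X n \<in> S" "X \<longlonglongrightarrow> x" using x clS closure_sequential[of x S] by auto
    obtain Y where Y: "\<And>n. Y n \<in> S" "Y \<longlonglongrightarrow> y" using y clS closure_sequential[of y S] by auto
    have XY: "X n \<in> ?K" "Y n \<in> ?K" for n using X Y by (auto simp: S_def)
    have vX: "(\<lambda>n. v (X n)) \<longlonglongrightarrow> v x" using contv X XY x by (auto simp: continuous_on_sequentially o_def)
    have vY: "(\<lambda>n. v (Y n)) \<longlonglongrightarrow> v y" using contv Y XY y by (auto simp: continuous_on_sequentially o_def)
    show ?thesis
    proof (rule LIMSEQ_le)
      show "(\<lambda>n. \<bar>v (X n) - v (Y n)\<bar>) \<longlonglongrightarrow> \<bar>v x - v y\<bar>" using vX vY by (intro tendsto_intros)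
      show "(\<lambda>n. H * dist (X n) (Y n) powr \<alpha>) \<longlonglongrightarrow> H * dist x y powr \<alpha>"
        using X Y \<alpha> by (intro tendsto_mult tendsto_const tendsto_powr2 tendsto_dist) auto
      show "\<exists>N. \<forall>n\<ge>N. \<bar>v (X n) - v (Y n)\<bar> \<le> H * dist (X n) (Y n) powr \<alpha>"
        using hold X Y v by metis
    qed
  qed
  moreover have "AE x in lebesgue. x \<in> ?K \<longrightarrow> u x = v x"
    using Z by (rule AE_I') (use v in \<open>auto simp: S_def\<close>)
  ultimately show ?thesis using contv unfolding H_def by blast
qed

section \<open>Energy and boundedness of weak solutions\<close>

text \<open>The energy is an integral over the product of two completed measures; sigma-finiteness,
  transferred from \<open>lborel\<close>, makes Tonelli and Fubini available for this
  product.\<close>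

lemma sigma_finite_lebesgue: "sigma_finite_measure (lebesgue :: 'a::euclidean_space measure)"
proof -
  obtain A :: "nat \<Rightarrow> 'a set" where A: "range A \<subseteq> sets lborel" "(\<Union>i. A i) = space lborel" "\<And>i. emeasure lborel (A i) \<noteq> \<infinity>"
    using lborel.sigma_finite by blast
  show ?thesis
  proof (standard, intro exI[of _ "range A"] conjI ballI)
    show "range A \<subseteq> sets lebesgue" using A(1) by auto
    show "\<Union> (range A) = space lebesgue" using A(2) by simp
    fix a assume "a \<in> range A"
    then show "emeasure lebesgue a \<noteq> \<infinity>" using A(1,3) by auto
  qed simp
qed

interpretation lebesgue: sigma_finite_measure lebesgue
  by (rule sigma_finite_lebesgue)

interpretation lebesgue_pair: pair_sigma_finite lebesgue lebesgue ..

abbreviation leb2 :: "('a::euclidean_space \<times> 'a) measure" where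
  "leb2 \<equiv> lebesgue \<Otimes>\<^sub>M lebesgue"

lemma measurable_ident_lebesgue: "(\<lambda>x. x) \<in> borel_measurable (lebesgue :: 'a::euclidean_space measure)"
  by (rule measurable_completion) simp

lemma measurable_fst_lebesgue:
  "u \<in> borel_measurable lebesgue \<Longrightarrow> (\<lambda>z. u (fst z)) \<in> borel_measurable (lebesgue \<Otimes>\<^sub>M N)"
  by (rule measurable_compose[OF measurable_fst])

lemma measurable_snd_lebesgue:
  "u \<in> borel_measurable lebesgue \<Longrightarrow> (\<lambda>z. u (snd z)) \<in> borel_measurable (N \<Otimes>\<^sub>M lebesgue)"
  by (rule measurable_compose[OF measurable_snd])

lemma measurable_diff_lebesgue [measurable]:
  "(\<lambda>z. fst z - snd z :: 'a::euclidean_space) \<in> borel_measurable leb2"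
  by (intro borel_measurable_diff measurable_fst_lebesgue measurable_snd_lebesgue measurable_ident_lebesgue)

lemma measurable_kern_pair [measurable]:
  "(\<lambda>z. kern a (fst z - snd z :: real^'n)) \<in> borel_measurable leb2"
  by (rule measurable_compose[OF measurable_diff_lebesgue kern_measurable])

lemma AE_pair_lebesgue:
  fixes P :: "'a::euclidean_space \<Rightarrow> bool"
  assumes "AE x in lebesgue. P x"
  shows "AE z in leb2. P (fst z) \<and> P (snd z)"
proof -
  obtain N where N: "\<And>x. x \<in> space lebesgue - N \<Longrightarrow> P x" "N \<in> null_sets lebesgue"
    using assms by (rule AE_E3) blast
  have "N \<times> UNIV \<in> null_sets (leb2 :: ('a \<times> 'a) measure)"
    using N(2) lebesgue.emeasure_pair_measure_Times[of N lebesgue UNIV] by (auto simp: null_sets_def)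
  moreover have "UNIV \<times> N \<in> null_sets (leb2 :: ('a \<times> 'a) measure)"
    using N(2) lebesgue.emeasure_pair_measure_Times[of UNIV lebesgue N] by (auto simp: null_sets_def)
  ultimately have "N \<times> UNIV \<union> UNIV \<times> N \<in> null_sets (leb2 :: ('a \<times> 'a) measure)"
    by (rule null_sets.Un)
  moreover have "P x" if "x \<notin> N" for x using N(1) that by simp
  then have "{z \<in> space leb2. \<not> (P (fst z) \<and> P (snd z))} \<subseteq> N \<times> UNIV \<union> UNIV \<times> N" by force
  ultimately show ?thesis by (rule AE_I')
qed

definition energy_integrand :: "real \<Rightarrow> real \<Rightarrow> (real^'n \<Rightarrow> real) \<Rightarrow> (real^'n \<Rightarrow> real) \<Rightarrow> (real^'n) \<times> (real^'n) \<Rightarrow> real" where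
  "energy_integrand s p u \<phi> z = spow (u (fst z) - u (snd z)) (p - 1) * (\<phi> (fst z) - \<phi> (snd z)) * kern (p * s) (fst z - snd z)"

lemma weak_solution_iff:
  "weak_solution s p \<Omega> f u \<longleftrightarrow> u \<in> W0 s p \<Omega> \<and>
     (\<forall>\<phi> \<in> W0 s p \<Omega>. integral\<^sup>L leb2 (energy_integrand s p u \<phi>) = (\<integral>x\<in>\<Omega>. f x * \<phi> x \<partial>lebesgue))"
  by (simp add: weak_solution_def energy_integrand_def[abs_def] kern_def)

lemma gagliardo_eq:
  "gagliardo s p u = (\<integral>\<^sup>+ z. ennreal (\<bar>u (fst z) - u (snd z)\<bar> powr p * kern (p * s) (fst z - snd z)) \<partial>leb2)"
  by (simp add: gagliardo_def kern_def)

lemma energy_integrand_measurable [measurable]: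
  assumes [measurable]: "u \<in> borel_measurable lebesgue" "\<phi> \<in> borel_measurable lebesgue"
  shows "energy_integrand s p u \<phi> \<in> borel_measurable leb2"
  unfolding energy_integrand_def[abs_def] by measurable

text \<open>Young's inequality in the crude form that the mixed product is at most the p-th power of
  the larger factor. It guarantees that the Bochner integrals of the weak formulation are genuine
  and not the default value 0.\<close>

lemma energy_integrand_integrable:
  fixes u \<phi> :: "real^'n \<Rightarrow> real"
  assumes [measurable]: "u \<in> borel_measurable lebesgue" "\<phi> \<in> borel_measurable lebesgue"
    and p: "1 < p" and gu: "gagliardo s p u < \<infinity>" and g\<phi>: "gagliardo s p \<phi> < \<infinity>"
  shows "integrable leb2 (energy_integrand s p u \<phi>)"
proof (rule integrableI_bounded)
  let ?k = "\<lambda>z. kern (p * s) (fst z - snd z)"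
  have young: "\<bar>spow a (p - 1) * b\<bar> \<le> \<bar>a\<bar> powr p + \<bar>b\<bar> powr p" for a b :: real
  proof -
    define c where "c = max \<bar>a\<bar> \<bar>b\<bar>"
    have "\<bar>spow a (p - 1) * b\<bar> = \<bar>a\<bar> powr (p - 1) * \<bar>b\<bar>" by (simp add: abs_mult abs_spow)
    also have "\<dots> \<le> c powr (p - 1) * c" using p by (intro mult_mono powr_mono2) (auto simp: c_def)
    also have "\<dots> = c powr p"
      using powr_mult_base[of c "p - 1"] by (simp add: c_def mult.commute)
    also have "\<dots> \<le> \<bar>a\<bar> powr p + \<bar>b\<bar> powr p" by (auto simp: c_def max_def)
    finally show ?thesis .
  qed
  have "(\<integral>\<^sup>+ z. ennreal (norm (energy_integrand s p u \<phi> z)) \<partial>leb2)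
     \<le> (\<integral>\<^sup>+ z. ennreal (\<bar>u (fst z) - u (snd z)\<bar> powr p * ?k z) + ennreal (\<bar>\<phi> (fst z) - \<phi> (snd z)\<bar> powr p * ?k z) \<partial>leb2)"
  proof (rule nn_integral_mono)
    fix z :: "(real^'n) \<times> (real^'n)"
    have "norm (energy_integrand s p u \<phi> z) = \<bar>spow (u (fst z) - u (snd z)) (p - 1) * (\<phi> (fst z) - \<phi> (snd z))\<bar> * ?k z"
      by (simp add: energy_integrand_def abs_mult)
    also have "\<dots> \<le> (\<bar>u (fst z) - u (snd z)\<bar> powr p + \<bar>\<phi> (fst z) - \<phi> (snd z)\<bar> powr p) * ?k z"
      by (intro mult_right_mono young) auto
    finally show "ennreal (norm (energy_integrand s p u \<phi> z)) \<le> ennreal (\<bar>u (fst z) - u (snd z)\<bar> powr p * ?k z) + ennreal (\<bar>\<phi> (fst z) - \<phi> (snd z)\<bar> powr p * ?k z)"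
      by (simp del: ennreal_plus add: ennreal_plus[symmetric] ennreal_leI distrib_right)
  qed
  also have "\<dots> = gagliardo s p u + gagliardo s p \<phi>"
    unfolding gagliardo_eq by (rule nn_integral_add) measurable
  also have "\<dots> < \<infinity>" using gu g\<phi> by simp
  finally show "(\<integral>\<^sup>+ z. ennreal (norm (energy_integrand s p u \<phi> z)) \<partial>leb2) < \<infinity>" .
qed measurable

section \<open>Finite energy and integrability of test functions\<close>

lemma gagliardo_finite_dominated:
  assumes [measurable]: "u \<in> borel_measurable lebesgue" "\<phi> \<in> borel_measurable lebesgue"
    and p: "0 < p" and gu: "gagliardo s p u < \<infinity>" and g\<phi>: "gagliardo s p \<phi> < \<infinity>" and c: "0 \<le> c"
    and le: "\<And>x y. \<bar>\<eta> x - \<eta> y\<bar> \<le> c * \<bar>\<phi> x - \<phi> y\<bar> + \<bar>u x - u y\<bar>"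
  shows "gagliardo s p (\<eta> :: real^'n \<Rightarrow> real) < \<infinity>"
proof -
  let ?k = "\<lambda>z::(real^'n) \<times> (real^'n). kern (p * s) (fst z - snd z)"
  define C1 where "C1 = 2 powr p * c powr p"
  have "gagliardo s p \<eta> \<le> (\<integral>\<^sup>+ z. ennreal C1 * ennreal (\<bar>\<phi> (fst z) - \<phi> (snd z)\<bar> powr p * ?k z) + ennreal (2 powr p) * ennreal (\<bar>u (fst z) - u (snd z)\<bar> powr p * ?k z) \<partial>leb2)"
    unfolding gagliardo_eq
  proof (rule nn_integral_mono)
    fix z :: "(real^'n) \<times> (real^'n)"
    let ?a = "\<bar>\<phi> (fst z) - \<phi> (snd z)\<bar>" and ?b = "\<bar>u (fst z) - u (snd z)\<bar>"
    have "\<bar>\<eta> (fst z) - \<eta> (snd z)\<bar> powr p \<le> (c * ?a + ?b) powr p"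
      using p le by (intro powr_mono2) auto
    also have "\<dots> \<le> 2 powr p * ((c * ?a) powr p + ?b powr p)"
      using p c by (intro powr_add_le) auto
    also have "\<dots> = C1 * ?a powr p + 2 powr p * ?b powr p"
      using c by (simp add: powr_mult C1_def distrib_left)
    finally have "\<bar>\<eta> (fst z) - \<eta> (snd z)\<bar> powr p * ?k z \<le> (C1 * ?a powr p + 2 powr p * ?b powr p) * ?k z"
      by (intro mult_right_mono) auto
    then have "\<bar>\<eta> (fst z) - \<eta> (snd z)\<bar> powr p * ?k z \<le> C1 * (?a powr p * ?k z) + 2 powr p * (?b powr p * ?k z)"
      by (simp add: algebra_simps)
    then show "ennreal (\<bar>\<eta> (fst z) - \<eta> (snd z)\<bar> powr p * ?k z) \<le> ennreal C1 * ennreal (?a powr p * ?k z) + ennreal (2 powr p) * ennreal (?b powr p * ?k z)"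
      by (subst (1 2) ennreal_mult[symmetric]) (auto simp: C1_def ennreal_plus[symmetric] intro!: ennreal_leI simp del: ennreal_plus)
  qed
  also have "\<dots> = ennreal C1 * gagliardo s p \<phi> + ennreal (2 powr p) * gagliardo s p u"
    unfolding gagliardo_eq by (simp add: nn_integral_add nn_integral_cmult)
  also have "\<dots> < \<infinity>" using gu g\<phi> by (simp add: ennreal_mult_less_top)
  finally show ?thesis .
qed

lemma gagliardo_0 [simp]: "gagliardo s p (\<lambda>_. 0) = 0"
  by (simp add: gagliardo_eq)

text \<open>The case q = 2 of the directional weight. By the convention \<open>0 powr 0 = 0\<close>
  the two integrands may differ on a hyperplane, hence the passage through a null set.\<close>

lemma nn_integral_powr_inside_ball:
  assumes \<beta>: "0 < \<beta>"
  shows "(\<integral>\<^sup>+ h. ennreal (indicator (ball 0 1) h * norm (h :: real^'n) powr (\<beta> - real CARD('n))) \<partial>lborel) < \<infinity>"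
proof -
  let ?e = "axis undefined 1 :: real^'n"
  have e: "?e \<in> Basis" by (auto simp: Basis_vec_def)
  have "(\<integral>\<^sup>+ h. ennreal (indicator (ball 0 1) h * norm (h :: real^'n) powr (\<beta> - real CARD('n))) \<partial>lborel)
    \<le> (\<integral>\<^sup>+ h. ennreal (indicator (ball 0 1) h *
            (\<bar>?e \<bullet> h\<bar> powr (2 - 2) * norm h powr (2 - 2 + \<beta> - real CARD('n)))) \<partial>lborel)"
    using negligible_hyperplanes_AE[where 'a="real^'n"]
  proof (intro nn_integral_mono_AE, eventually_elim)
    fix h :: "real^'n" assume "\<forall>i\<in>Basis. h \<bullet> i \<noteq> 0"
    then have "h \<bullet> ?e \<noteq> 0" using e by blast
    then have "?e \<bullet> h \<noteq> 0" by (subst inner_commute)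
    then show "ennreal (indicator (ball 0 1) h * norm h powr (\<beta> - real CARD('n)))
       \<le> ennreal (indicator (ball 0 1) h * (\<bar>?e \<bullet> h\<bar> powr (2 - 2) * norm h powr (2 - 2 + \<beta> - real CARD('n))))"
      by simp
  qed
  also have "\<dots> < \<infinity>"
    by (rule nn_integral_directional_powr_axis) (use \<beta> in auto)
  finally show ?thesis .
qed

lemma nn_integral_lebesgue_diff:
  fixes g :: "'a::euclidean_space \<Rightarrow> ennreal"
  assumes [measurable]: "g \<in> borel_measurable borel"
  shows "(\<integral>\<^sup>+ y. g (x - y) \<partial>lebesgue) = (\<integral>\<^sup>+ h. g h \<partial>lborel)"
proof -
  have "(\<integral>\<^sup>+ y. g (x - y) \<partial>lebesgue) = (\<integral>\<^sup>+ y. g y \<partial>distr lborel borel (\<lambda>y. x - y))"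
    by (simp add: nn_integral_completion nn_integral_distr)
  then show ?thesis by (simp add: lborel_distr_reflect)
qed

lemma nn_integral_pair_convolution:
  fixes g :: "'a::euclidean_space \<Rightarrow> ennreal"
  assumes [measurable]: "a \<in> borel_measurable lebesgue" "g \<in> borel_measurable borel"
  shows "(\<integral>\<^sup>+ z. a (fst z) * g (fst z - snd z) \<partial>leb2) = (\<integral>\<^sup>+ x. a x \<partial>lebesgue) * (\<integral>\<^sup>+ h. g h \<partial>lborel)"
proof -
  have m: "(\<lambda>z. a (fst z) * g (fst z - snd z)) \<in> borel_measurable leb2"
    using measurable_compose[OF measurable_diff_lebesgue, of g borel] by measurable
  have "(\<lambda>y. g (x - y)) \<in> borel_measurable lebesgue" for x
    by (rule measurable_completion) measurable
  then have "(\<integral>\<^sup>+ y. a x * g (x - y) \<partial>lebesgue) = a x * (\<integral>\<^sup>+ h. g h \<partial>lborel)" for x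
    by (subst nn_integral_cmult) (simp_all add: nn_integral_lebesgue_diff)
  then show ?thesis
    using lebesgue.nn_integral_fst[OF m] by (simp add: nn_integral_multc)
qed

text \<open>Near the diagonal the Lipschitz bound leaves the degree p - p s - N, integrable because
  s < 1; at distance at least 1 the kernel itself is integrable. A pair contributes only if one of
  its points lies in the bounded support, so the energy is at most a sum of two convolution
  integrals.\<close>

lemma gagliardo_lipschitz_finite:
  fixes \<phi> :: "real^'n \<Rightarrow> real"
  assumes p: "1 < p" and s: "0 < s" "s < 1" and [measurable]: "\<phi> \<in> borel_measurable borel"
    and lip: "\<And>x y. \<bar>\<phi> x - \<phi> y\<bar> \<le> L * norm (x - y)" and L: "0 \<le> L"
    and b: "\<And>x. 0 \<le> \<phi> x \<and> \<phi> x \<le> 1" and supp: "\<And>x. x \<notin> ball x0 r \<Longrightarrow> \<phi> x = 0"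
  shows "gagliardo s p \<phi> < \<infinity>"
proof -
  let ?N = "real CARD('n)"
  let ?B = "ball x0 r"
  define g where "g h = ennreal (L powr p) * ennreal (indicator (ball 0 1) h * norm (h :: real^'n) powr ((p - p * s) - ?N))
     + ennreal (indicator {h. 1 \<le> norm h} h * kern (p * s) h)" for h
  have [measurable]: "ball (0::real^'n) 1 \<in> sets borel" by simp
  have g_borel [measurable]: "g \<in> borel_measurable borel" unfolding g_def[abs_def] by measurable
  have gfin: "(\<integral>\<^sup>+ h. g h \<partial>lborel) < \<infinity>"
  proof -
    have "(\<integral>\<^sup>+ h. g h \<partial>lborel) = ennreal (L powr p) * (\<integral>\<^sup>+ h. ennreal (indicator (ball 0 1) h * norm (h :: real^'n) powr ((p - p * s) - ?N)) \<partial>lborel)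
     + (\<integral>\<^sup>+ h. ennreal (indicator {h. 1 \<le> norm h} h * kern (p * s) (h :: real^'n)) \<partial>lborel)"
      unfolding g_def by (subst nn_integral_add) (auto simp: nn_integral_cmult)
    also have "\<dots> < \<infinity>"
      using nn_integral_powr_inside_ball[of "p - p * s", where 'n='n] nn_integral_powr_outside_ball[of "p * s" 1, where 'n='n] p s
      by (simp add: ennreal_mult_less_top)
    finally show ?thesis .
  qed
  define a where "a x = (indicator ?B x :: ennreal)" for x
  have a_meas [measurable]: "a \<in> borel_measurable lebesgue"
    unfolding a_def[abs_def] by (rule measurable_completion) (intro borel_measurable_indicator, simp)
  have afin: "(\<integral>\<^sup>+ x. a x \<partial>lebesgue) < \<infinity>"
  proof -
    have "(\<integral>\<^sup>+ x. a x \<partial>lebesgue) = emeasure lborel ?B"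
      unfolding a_def by (simp add: nn_integral_completion)
    then show ?thesis using emeasure_bounded_finite[OF bounded_ball, of x0 r] by (simp add: less_top)
  qed
  have pw: "ennreal (\<bar>\<phi> x - \<phi> y\<bar> powr p * kern (p * s) (x - y)) \<le> a x * g (x - y) + a y * g (y - x)" for x y
  proof (cases "x \<in> ?B \<or> y \<in> ?B")
    case False
    then have "\<phi> x = 0" "\<phi> y = 0" using supp by blast+
    then show ?thesis by simp
  next
    case True
    have "ennreal (\<bar>\<phi> x - \<phi> y\<bar> powr p * kern (p * s) (x - y)) \<le> g (x - y)"
    proof (cases "norm (x - y) < 1")
      case True
      have "\<bar>\<phi> x - \<phi> y\<bar> powr p \<le> (L * norm (x - y)) powr p" using p lip by (intro powr_mono2) auto
      then have "\<bar>\<phi> x - \<phi> y\<bar> powr p * kern (p * s) (x - y) \<le> (L * norm (x - y)) powr p * kern (p * s) (x - y)"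
        by (intro mult_right_mono) auto
      also have "\<dots> = (L * norm (x - y)) powr p * norm (x - y) powr (- (?N + p * s))"
        by (simp only: kern_def powr_minus_divide)
      also have "\<dots> = L powr p * (norm (x - y) powr p * norm (x - y) powr (- (?N + p * s)))"
        using L by (simp add: powr_mult)
      also have "norm (x - y) powr p * norm (x - y) powr (- (?N + p * s)) = norm (x - y) powr ((p - p * s) - ?N)"
        by (subst powr_add[symmetric]) (simp add: algebra_simps)
      finally have "ennreal (\<bar>\<phi> x - \<phi> y\<bar> powr p * kern (p * s) (x - y)) \<le> ennreal (L powr p * norm (x - y) powr ((p - p * s) - ?N))"
        by (rule ennreal_leI)
      then show ?thesis using True by (simp add: g_def ennreal_mult)
    next
      case False
      have "\<bar>\<phi> x - \<phi> y\<bar> \<le> 1" using b[of x] b[of y] by (auto simp: abs_le_iff)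
      then have "\<bar>\<phi> x - \<phi> y\<bar> powr p \<le> 1 powr p" using p by (intro powr_mono2) auto
      then have "\<bar>\<phi> x - \<phi> y\<bar> powr p * kern (p * s) (x - y) \<le> 1 * kern (p * s) (x - y)"
        by (intro mult_right_mono) auto
      then show ?thesis using False by (simp add: g_def ennreal_leI)
    qed
    moreover have "g (y - x) = g (x - y)"
      by (simp add: g_def indicator_def norm_minus_commute kern_commute[of _ x y])
    ultimately show ?thesis using True by (auto simp: a_def add_increasing add_increasing2)
  qed
  have swap: "(\<integral>\<^sup>+ z. a (snd z) * g (snd z - fst z) \<partial>leb2) = (\<integral>\<^sup>+ z. a (fst z) * g (fst z - snd z) \<partial>leb2)"
  proof -
    have m: "(\<lambda>z. a (fst z) * g (fst z - snd z)) \<in> borel_measurable leb2"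
      using measurable_compose[OF measurable_diff_lebesgue g_borel] by measurable
    show ?thesis
      by (subst (2) lebesgue_pair.distr_pair_swap, subst nn_integral_distr[OF measurable_pair_swap'])
         (use m in \<open>simp_all add: case_prod_beta\<close>)
  qed
  have "gagliardo s p \<phi> \<le> (\<integral>\<^sup>+ z. a (fst z) * g (fst z - snd z) + a (snd z) * g (snd z - fst z) \<partial>leb2)"
    unfolding gagliardo_eq by (intro nn_integral_mono pw)
  also have "\<dots> = (\<integral>\<^sup>+ z. a (fst z) * g (fst z - snd z) \<partial>leb2) + (\<integral>\<^sup>+ z. a (snd z) * g (snd z - fst z) \<partial>leb2)"
  proof (rule nn_integral_add)
    show "(\<lambda>z. a (fst z) * g (fst z - snd z)) \<in> borel_measurable leb2"
      using measurable_compose[OF measurable_diff_lebesgue g_borel] by measurable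
    have "(\<lambda>z. snd z - fst z :: real^'n) \<in> borel_measurable leb2"
      by (intro borel_measurable_diff measurable_fst_lebesgue measurable_snd_lebesgue measurable_ident_lebesgue)
    from measurable_compose[OF this g_borel]
    show "(\<lambda>z. a (snd z) * g (snd z - fst z)) \<in> borel_measurable leb2" by measurable
  qed
  also have "\<dots> < \<infinity>"
    unfolding swap using gfin afin
    by (subst (1 2) nn_integral_pair_convolution) (auto simp: ennreal_mult_less_top)
  finally show ?thesis .
qed

lemma W0_D:
  assumes "u \<in> W0 s p \<Omega>"
  shows "u \<in> borel_measurable lebesgue" "gagliardo s p u < \<infinity>" "AE x in lebesgue. x \<notin> \<Omega> \<longrightarrow> u x = 0"
    "(\<integral>\<^sup>+ x. ennreal (\<bar>u x\<bar> powr p) \<partial>lebesgue) < \<infinity>"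
  using assms by (auto simp: W0_def)

lemma emeasure_lebesgue_bounded_open:
  assumes "open \<Omega>" "bounded \<Omega>"
  shows "\<Omega> \<in> sets lebesgue" "emeasure lebesgue \<Omega> < \<infinity>"
  using assms emeasure_bounded_finite[OF assms(2)] by auto

text \<open>As p > 1, \<open>\<bar>u\<bar>\<close> is almost everywhere at most the indicator of the
  domain, of finite measure, plus \<open>\<bar>u\<bar> powr p\<close>.\<close>

lemma W0_integrable:
  assumes u: "u \<in> W0 s p \<Omega>" and \<Omega>: "open \<Omega>" "bounded \<Omega>" and p: "1 < p"
  shows "integrable lebesgue u"
proof (rule integrableI_bounded)
  note [measurable] = W0_D(1)[OF u] and [simp] = emeasure_lebesgue_bounded_open[OF \<Omega>]
  show "u \<in> borel_measurable lebesgue" by measurable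
  have "(\<integral>\<^sup>+ x. ennreal (norm (u x)) \<partial>lebesgue) \<le> (\<integral>\<^sup>+ x. indicator \<Omega> x + ennreal (\<bar>u x\<bar> powr p) \<partial>lebesgue)"
    using W0_D(3)[OF u]
  proof (intro nn_integral_mono_AE, eventually_elim)
    fix x assume x: "x \<notin> \<Omega> \<longrightarrow> u x = 0"
    have "\<bar>u x\<bar> \<le> 1 + \<bar>u x\<bar> powr p"
    proof (cases "\<bar>u x\<bar> \<le> 1")
      case False
      then show ?thesis using powr_mono[of 1 p "\<bar>u x\<bar>"] p by simp
    qed (simp add: add_increasing2)
    then have "ennreal \<bar>u x\<bar> \<le> 1 + ennreal (\<bar>u x\<bar> powr p)"
      by (simp del: ennreal_plus add: ennreal_plus[symmetric] ennreal_leI flip: ennreal_1)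
    then show "ennreal (norm (u x)) \<le> indicator \<Omega> x + ennreal (\<bar>u x\<bar> powr p)"
      using x by (auto simp: indicator_def)
  qed
  also have "\<dots> = emeasure lebesgue \<Omega> + (\<integral>\<^sup>+ x. ennreal (\<bar>u x\<bar> powr p) \<partial>lebesgue)"
    by (subst nn_integral_add) (auto intro: borel_measurable_indicator)
  also have "\<dots> < \<infinity>" using W0_D(4)[OF u] emeasure_lebesgue_bounded_open[OF \<Omega>] by (simp only: ennreal_add_less_top infinity_ennreal_def)
  finally show "(\<integral>\<^sup>+ x. ennreal (norm (u x)) \<partial>lebesgue) < \<infinity>" .
qed

lemma rhs_bound:
  assumes f: "set_borel_measurable lebesgue \<Omega> f" and K: "AE x in lebesgue. x \<in> \<Omega> \<longrightarrow> \<bar>f x\<bar> \<le> K" and K0: "0 \<le> K"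
    and \<eta>: "\<eta> \<in> W0 s p \<Omega>" "\<And>x. 0 \<le> \<eta> x" and \<Omega>: "open \<Omega>" "bounded \<Omega>" and p: "1 < p"
  shows "\<bar>\<integral>x\<in>\<Omega>. f x * \<eta> x \<partial>lebesgue\<bar> \<le> K * integral\<^sup>L lebesgue \<eta>"
proof -
  have int: "integrable lebesgue \<eta>" by (rule W0_integrable[OF \<eta>(1) \<Omega> p])
  let ?g = "\<lambda>x. indicator \<Omega> x *\<^sub>R (f x * \<eta> x)"
  have eq: "?g = (\<lambda>x. (indicator \<Omega> x *\<^sub>R f x) * \<eta> x)" by (simp add: fun_eq_iff)
  have m: "?g \<in> borel_measurable lebesgue"
    unfolding eq using f W0_D(1)[OF \<eta>(1)] unfolding set_borel_measurable_def by (intro borel_measurable_times)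
  have ae: "AE x in lebesgue. norm (?g x) \<le> K * \<eta> x"
    using K by eventually_elim (use \<eta>(2) K0 in \<open>auto simp: indicator_def abs_mult intro!: mult_right_mono\<close>)
  have intK: "integrable lebesgue (\<lambda>x. K * \<eta> x)" using int by simp
  have "norm (integral\<^sup>L lebesgue ?g) \<le> (\<integral>x. norm (?g x) \<partial>lebesgue)" by (rule integral_norm_bound)
  also have "\<dots> \<le> (\<integral>x. K * \<eta> x \<partial>lebesgue)"
  proof (rule integral_mono_AE[OF _ intK ae])
    show "integrable lebesgue (\<lambda>x. norm (?g x))"
    proof (rule Bochner_Integration.integrable_bound[OF intK])
      show "AE x in lebesgue. norm (norm (?g x)) \<le> norm (K * \<eta> x)"
        using ae by eventually_elim (use \<eta>(2) K0 in \<open>simp add: abs_mult\<close>)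
    qed (use m in measurable)
  qed
  finally have "norm (integral\<^sup>L lebesgue ?g) \<le> (\<integral>x. K * \<eta> x \<partial>lebesgue)" .
  then show ?thesis using int by (simp add: set_lebesgue_integral_def)
qed

section \<open>The essential supremum norm\<close>

lemma Linf_norm_nonneg:
  assumes "f \<in> Linf \<Omega>"
  shows "0 \<le> Linf_norm \<Omega> f"
proof -
  obtain C where "AE x in lebesgue. x \<in> \<Omega> \<longrightarrow> \<bar>f x\<bar> \<le> C" using assms by (auto simp: Linf_def)
  then have "AE x in lebesgue. x \<in> \<Omega> \<longrightarrow> \<bar>f x\<bar> \<le> max 0 C" by eventually_elim auto
  then have "{C. 0 \<le> C \<and> (AE x in lebesgue. x \<in> \<Omega> \<longrightarrow> \<bar>f x\<bar> \<le> C)} \<noteq> {}" by (auto intro!: exI[of _ "max 0 C"])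
  then show ?thesis unfolding Linf_norm_def by (rule cInf_greatest) auto
qed

lemma Linf_norm_le:
  assumes "0 \<le> C" "AE x in lebesgue. x \<in> \<Omega> \<longrightarrow> \<bar>f x\<bar> \<le> C"
  shows "Linf_norm \<Omega> f \<le> C"
  unfolding Linf_norm_def by (rule cInf_lower) (use assms in \<open>auto intro!: bdd_belowI[of _ 0]\<close>)

lemma AE_le_Linf_norm:
  assumes "f \<in> Linf \<Omega>"
  shows "AE x in lebesgue. x \<in> \<Omega> \<longrightarrow> \<bar>f x\<bar> \<le> Linf_norm \<Omega> f"
proof -
  let ?S = "{C. 0 \<le> C \<and> (AE x in lebesgue. x \<in> \<Omega> \<longrightarrow> \<bar>f x\<bar> \<le> C)}"
  obtain C where "AE x in lebesgue. x \<in> \<Omega> \<longrightarrow> \<bar>f x\<bar> \<le> C" using assms by (auto simp: Linf_def)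
  then have "AE x in lebesgue. x \<in> \<Omega> \<longrightarrow> \<bar>f x\<bar> \<le> max 0 C" by eventually_elim auto
  then have ne: "?S \<noteq> {}" by (auto intro!: exI[of _ "max 0 C"])
  have "AE x in lebesgue. x \<in> \<Omega> \<longrightarrow> \<bar>f x\<bar> \<le> Linf_norm \<Omega> f + 1 / real (Suc n)" for n
  proof -
    obtain C where C: "C \<in> ?S" "C < Linf_norm \<Omega> f + 1 / real (Suc n)"
      using cInf_lessD[OF ne, of "Linf_norm \<Omega> f + 1 / real (Suc n)"] unfolding Linf_norm_def by auto
    then have "AE x in lebesgue. x \<in> \<Omega> \<longrightarrow> \<bar>f x\<bar> \<le> C" by simp
    then show ?thesis by eventually_elim (use C in auto)
  qed
  then have "AE x in lebesgue. \<forall>n. x \<in> \<Omega> \<longrightarrow> \<bar>f x\<bar> \<le> Linf_norm \<Omega> f + 1 / real (Suc n)"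
    by (subst AE_all_countable) blast
  then show ?thesis
  proof eventually_elim
    fix x assume *: "\<forall>n. x \<in> \<Omega> \<longrightarrow> \<bar>f x\<bar> \<le> Linf_norm \<Omega> f + 1 / real (Suc n)"
    show "x \<in> \<Omega> \<longrightarrow> \<bar>f x\<bar> \<le> Linf_norm \<Omega> f"
    proof
      assume "x \<in> \<Omega>"
      have "(\<lambda>n. Linf_norm \<Omega> f + 1 / real (Suc n)) \<longlonglongrightarrow> Linf_norm \<Omega> f + 0"
        by (intro tendsto_intros LIMSEQ_Suc[OF lim_1_over_n])
      then show "\<bar>f x\<bar> \<le> Linf_norm \<Omega> f"
        using * \<open>x \<in> \<Omega>\<close> by (intro LIMSEQ_le_const[where X = "\<lambda>n. Linf_norm \<Omega> f + 1 / real (Suc n)"]) auto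
    qed
  qed
qed

section \<open>Symmetries of the weak formulation\<close>

lemma energy_integrand_uminus: "energy_integrand s p (\<lambda>x. - u x) \<phi> z = - energy_integrand s p u \<phi> z"
proof -
  have "- u (fst z) - - u (snd z) = - (u (fst z) - u (snd z))" by simp
  then show ?thesis unfolding energy_integrand_def by (simp only: spow_minus mult_minus_left)
qed

lemma energy_integrand_const_add: "energy_integrand s p (\<lambda>x. c + u x) \<phi> z = energy_integrand s p u \<phi> z"
  by (simp add: energy_integrand_def)

lemma gagliardo_uminus: "gagliardo s p (\<lambda>x. - u x) = gagliardo s p u"
  by (simp add: gagliardo_def minus_diff_commute abs_minus_commute)

lemma gagliardo_const_add: "gagliardo s p (\<lambda>x. c + u x) = gagliardo s p u"
  by (simp add: gagliardo_def)

lemma W0_uminus: "u \<in> W0 s p \<Omega> \<Longrightarrow> (\<lambda>x. - u x) \<in> W0 s p \<Omega>"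
  by (auto simp: W0_def gagliardo_uminus)

lemma weak_solution_uminus:
  assumes "weak_solution s p \<Omega> f u"
  shows "weak_solution s p \<Omega> (\<lambda>x. - f x) (\<lambda>x. - u x)"
  using assms unfolding weak_solution_iff
  by (auto simp: W0_uminus energy_integrand_uminus[abs_def] set_lebesgue_integral_def)

text \<open>Permits replacing a solution by a truncation that is bounded everywhere and not merely
  almost everywhere.\<close>

lemma weak_solution_cong_AE:
  assumes w: "weak_solution s p \<Omega> f u" and eq: "AE x in lebesgue. u x = v x" and v: "v \<in> borel_measurable lebesgue"
  shows "weak_solution s p \<Omega> f v"
proof -
  have u: "u \<in> W0 s p \<Omega>" using w by (simp add: weak_solution_iff)
  note [measurable] = W0_D(1)[OF u] v
  have eq2: "AE z in leb2. u (fst z) = v (fst z) \<and> u (snd z) = v (snd z)"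
    by (rule AE_pair_lebesgue[OF eq])
  have "gagliardo s p v = gagliardo s p u"
    unfolding gagliardo_eq using eq2 by (intro nn_integral_cong_AE, eventually_elim) simp
  moreover have "(\<integral>\<^sup>+ x. ennreal (\<bar>v x\<bar> powr p) \<partial>lebesgue) = (\<integral>\<^sup>+ x. ennreal (\<bar>u x\<bar> powr p) \<partial>lebesgue)"
    using eq by (intro nn_integral_cong_AE, eventually_elim) simp
  moreover have "AE x in lebesgue. x \<notin> \<Omega> \<longrightarrow> v x = 0"
    using eq W0_D(3)[OF u] by eventually_elim auto
  ultimately have "v \<in> W0 s p \<Omega>" using u v by (simp add: W0_def)
  moreover have "integral\<^sup>L leb2 (energy_integrand s p v \<phi>) = integral\<^sup>L leb2 (energy_integrand s p u \<phi>)"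
    if "\<phi> \<in> W0 s p \<Omega>" for \<phi>
  proof -
    note [measurable] = W0_D(1)[OF that]
    show ?thesis
    proof (rule integral_cong_AE)
      show "AE z in leb2. energy_integrand s p v \<phi> z = energy_integrand s p u \<phi> z"
        using eq2 by eventually_elim (simp add: energy_integrand_def)
    qed measurable
  qed
  ultimately show ?thesis using w by (simp add: weak_solution_iff)
qed

text \<open>Test with \<open>(u - \<kappa>)\<^sup>+\<close>: the interaction with a ball \<open>Y\<close> far away from the domain, where \<open>u\<close>
  vanishes, already bounds the energy from below by \<open>\<kappa> powr (p - 1)\<close> times the integral of the test function.\<close>
lemma weak_solution_upper_bound:
  fixes \<Omega> :: "(real^'n) set"
  assumes \<Omega>: "open \<Omega>" "bounded \<Omega>" and p: "1 < p" and s: "0 < s"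
  shows "\<exists>c>0. \<forall>f u K. weak_solution s p \<Omega> f u \<longrightarrow> set_borel_measurable lebesgue \<Omega> f \<longrightarrow> 0 \<le> K \<longrightarrow>
     (AE x in lebesgue. x \<in> \<Omega> \<longrightarrow> \<bar>f x\<bar> \<le> K) \<longrightarrow> (AE x in lebesgue. u x \<le> (K / c) powr (1 / (p - 1)))"
proof -
  obtain B where B: "B > 0" "\<Omega> \<subseteq> ball 0 B" using bounded_subset_ballD[OF \<Omega>(2), of 0] by blast
  obtain e :: "real^'n" where e: "norm e = 1" using vector_choose_size[of 1] by auto
  \<comment> \<open>A unit ball just outside \<open>ball 0 B\<close>. Its points have norm between B
    and B + 2, so they are within d = 2B + 2 of every point of the domain.\<close>
  define Y where "Y = ball ((B + 1) *\<^sub>R e) 1"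
  define d where "d = 2 * B + 2"
  define ck where "ck = 1 / d powr (real CARD('n) + p * s)"
  have ck: "ck > 0" using B by (simp add: ck_def d_def)
  have Y_lm: "Y \<in> sets lebesgue" "emeasure lebesgue Y < \<infinity>"
    using emeasure_lebesgue_bounded_open[of Y] by (auto simp: Y_def)
  have Ypos: "measure lebesgue Y > 0"
  proof -
    have "\<not> negligible Y" unfolding Y_def by (intro open_not_negligible) auto
    then show ?thesis using Y_lm by (simp add: negligible_iff_measure0 fmeasurable_def zero_less_measure_iff)
  qed
  have Ysep: "y \<notin> \<Omega>" "kern (p * s) (x - y) \<ge> ck" if y: "y \<in> Y" and x: "x \<in> ball 0 B" for x y
  proof -
    have ny: "norm (y - (B + 1) *\<^sub>R e) < 1" using y by (simp add: Y_def dist_norm norm_minus_commute)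
    have "norm ((B + 1) *\<^sub>R e) \<le> norm y + norm (y - (B + 1) *\<^sub>R e)"
      using norm_triangle_ineq4[of y "y - (B + 1) *\<^sub>R e"] by simp
    then have yB: "norm y > B" using ny e B by simp
    then show "y \<notin> \<Omega>" using B by auto
    have "norm y \<le> norm ((B + 1) *\<^sub>R e) + norm (y - (B + 1) *\<^sub>R e)"
      using norm_triangle_ineq[of "(B + 1) *\<^sub>R e" "y - (B + 1) *\<^sub>R e"] by simp
    then have "norm y \<le> B + 2" using ny e B by simp
    then have "norm (x - y) \<le> d" using norm_triangle_ineq4[of x y] x by (simp add: d_def)
    moreover have "x \<noteq> y" using x yB by auto
    ultimately show "kern (p * s) (x - y) \<ge> ck"
      unfolding kern_def ck_def using p s by (intro divide_left_mono powr_mono2 mult_pos_pos) (auto simp: d_def)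
  qed
  define c where "c = ck * measure lebesgue Y"
  have c: "c > 0" using ck Ypos by (simp add: c_def)
  have main: "AE x in lebesgue. u x \<le> \<kappa>"
    if w: "weak_solution s p \<Omega> f u" and f: "set_borel_measurable lebesgue \<Omega> f" and K0: "0 \<le> K"
      and K: "AE x in lebesgue. x \<in> \<Omega> \<longrightarrow> \<bar>f x\<bar> \<le> K" and \<kappa>: "\<kappa> > 0" and big: "K < c * \<kappa> powr (p - 1)" for f u K \<kappa>
  proof -
    have uW: "u \<in> W0 s p \<Omega>" using w by (simp add: weak_solution_iff)
    note u_meas [measurable] = W0_D(1)[OF uW]
    define \<eta> where "\<eta> x = max 0 (u x - \<kappa>)" for x
    have \<eta>_meas [measurable]: "\<eta> \<in> borel_measurable lebesgue" unfolding \<eta>_def[abs_def] by measurable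
    have \<eta>0: "0 \<le> \<eta> x" for x by (simp add: \<eta>_def)
    have \<eta>u: "\<eta> x \<le> \<bar>u x\<bar>" for x using \<kappa> by (simp add: \<eta>_def)
    have \<eta>W: "\<eta> \<in> W0 s p \<Omega>"
    proof -
      have "(\<integral>\<^sup>+ x. ennreal (\<bar>\<eta> x\<bar> powr p) \<partial>lebesgue) \<le> (\<integral>\<^sup>+ x. ennreal (\<bar>u x\<bar> powr p) \<partial>lebesgue)"
        using \<eta>0 \<eta>u p by (intro nn_integral_mono ennreal_leI powr_mono2) auto
      also have "\<dots> < \<infinity>" by (rule W0_D(4)[OF uW])
      finally have "(\<integral>\<^sup>+ x. ennreal (\<bar>\<eta> x\<bar> powr p) \<partial>lebesgue) < \<infinity>" .
      moreover have "gagliardo s p \<eta> < \<infinity>"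
        by (rule gagliardo_finite_dominated[of u "\<lambda>_. 0" p s 0])
           (use p W0_D(2)[OF uW] in \<open>auto simp: \<eta>_def\<close>)
      moreover have "AE x in lebesgue. x \<notin> \<Omega> \<longrightarrow> \<eta> x = 0"
        using W0_D(3)[OF uW] by eventually_elim (use \<kappa> in \<open>auto simp: \<eta>_def\<close>)
      ultimately show ?thesis by (simp add: W0_def)
    qed
    have int\<eta>: "integrable lebesgue \<eta>" by (rule W0_integrable[OF \<eta>W \<Omega> p])
    let ?G = "energy_integrand s p u \<eta>"
    \<comment> \<open>\<eta> is a nondecreasing function of u, so the integrand is nonnegative
      everywhere and the energy is at least its part over pairs whose second point lies in
      Y.\<close>
    have G0: "0 \<le> ?G z" for z
    proof -
      have "0 \<le> spow (u (fst z) - u (snd z)) (p - 1) * (\<eta> (fst z) - \<eta> (snd z))"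
      proof (cases "u (fst z) \<ge> u (snd z)")
        case True
        then show ?thesis by (intro mult_nonneg_nonneg) (auto simp: \<eta>_def)
      next
        case False
        then have "spow (u (fst z) - u (snd z)) (p - 1) \<le> 0" by (simp add: spow_nonpos_eq)
        moreover have "\<eta> (fst z) - \<eta> (snd z) \<le> 0" using False by (auto simp: \<eta>_def)
        ultimately show ?thesis by (rule mult_nonpos_nonpos)
      qed
      then show ?thesis unfolding energy_integrand_def by (rule mult_nonneg_nonneg) simp
    qed
    have intG: "integrable leb2 ?G"
      by (rule energy_integrand_integrable) (use p W0_D(2)[OF uW] W0_D(2)[OF \<eta>W] in auto)
    have "integral\<^sup>L leb2 ?G = (\<integral>x\<in>\<Omega>. f x * \<eta> x \<partial>lebesgue)"
      using w \<eta>W by (simp add: weak_solution_iff)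
    also have "\<dots> \<le> K * integral\<^sup>L lebesgue \<eta>"
      using rhs_bound[OF f K K0 \<eta>W \<eta>0 \<Omega> p] by linarith
    finally have up: "integral\<^sup>L leb2 ?G \<le> K * integral\<^sup>L lebesgue \<eta>" .
    \<comment> \<open>Where \<eta> is positive at the first point, u exceeds \<kappa> there, while u
      and \<eta> vanish at the second point; the increment of u is thus at least \<kappa> and that
      of \<eta> is \<eta> itself.\<close>
    let ?L = "\<lambda>z. ennreal (\<kappa> powr (p - 1) * ck) * (ennreal (\<eta> (fst z)) * indicator Y (snd z))"
    have "(\<integral>\<^sup>+ z. ?L z \<partial>leb2) \<le> (\<integral>\<^sup>+ z. ennreal (?G z) \<partial>leb2)"
      using AE_pair_lebesgue[OF W0_D(3)[OF uW]]
    proof (intro nn_integral_mono_AE, eventually_elim)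
      fix z :: "(real^'n) \<times> (real^'n)"
      assume z: "(fst z \<notin> \<Omega> \<longrightarrow> u (fst z) = 0) \<and> (snd z \<notin> \<Omega> \<longrightarrow> u (snd z) = 0)"
      show "?L z \<le> ennreal (?G z)"
      proof (cases "snd z \<in> Y \<and> \<eta> (fst z) > 0")
        case False
        then have "?L z = 0" using \<eta>0[of "fst z"] by (auto simp: indicator_def)
        then show ?thesis by (simp only: zero_le)
      next
        case True
        then have ux: "u (fst z) > \<kappa>" by (auto simp: \<eta>_def max_def split: if_splits)
        then have "fst z \<in> \<Omega>" using z \<kappa> by auto
        then have x: "fst z \<in> ball 0 B" using B by blast
        have y: "u (snd z) = 0" using z Ysep(1)[of "snd z" "fst z"] True x by blast
        then have \<eta>y: "\<eta> (snd z) = 0" using \<kappa> by (simp add: \<eta>_def)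
        have "\<kappa> powr (p - 1) * ck * \<eta> (fst z) \<le> u (fst z) powr (p - 1) * kern (p * s) (fst z - snd z) * \<eta> (fst z)"
          using ux \<kappa> p ck True Ysep(2)[OF _ x, of "snd z"] by (intro mult_mono powr_mono2 mult_nonneg_nonneg) auto
        also have "\<dots> = ?G z" using y \<eta>y ux \<kappa> by (simp add: energy_integrand_def spow_nonneg_eq)
        finally show ?thesis using True ck \<eta>0 by (simp add: ennreal_mult[symmetric] ennreal_leI)
      qed
    qed
    also have "\<dots> = ennreal (integral\<^sup>L leb2 ?G)"
      using intG G0 by (intro nn_integral_eq_integral) auto
    also have "\<dots> \<le> ennreal (K * integral\<^sup>L lebesgue \<eta>)" using up by (rule ennreal_leI)
    also have "(\<integral>\<^sup>+ z. ?L z \<partial>leb2) = ennreal (\<kappa> powr (p - 1) * ck) * (ennreal (integral\<^sup>L lebesgue \<eta>) * ennreal (measure lebesgue Y))"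
    proof -
      have m: "(\<lambda>z. ennreal (\<eta> (fst z)) * indicator Y (snd z)) \<in> borel_measurable leb2"
        using Y_lm(1) by measurable
      have "(\<integral>\<^sup>+ z. ennreal (\<eta> (fst z)) * indicator Y (snd z) \<partial>leb2) = (\<integral>\<^sup>+ x. (\<integral>\<^sup>+ y. ennreal (\<eta> x) * indicator Y y \<partial>lebesgue) \<partial>lebesgue)"
        using lebesgue.nn_integral_fst[OF m] by simp
      also have "\<dots> = (\<integral>\<^sup>+ x. ennreal (\<eta> x) * emeasure lebesgue Y \<partial>lebesgue)"
        using Y_lm(1) by (simp add: nn_integral_cmult_indicator)
      also have "\<dots> = (\<integral>\<^sup>+ x. ennreal (\<eta> x) \<partial>lebesgue) * emeasure lebesgue Y"
        by (rule nn_integral_multc) measurable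
      also have "(\<integral>\<^sup>+ x. ennreal (\<eta> x) \<partial>lebesgue) = ennreal (integral\<^sup>L lebesgue \<eta>)"
        using int\<eta> \<eta>0 by (intro nn_integral_eq_integral) auto
      also have "emeasure lebesgue Y = ennreal (measure lebesgue Y)"
        using Y_lm by (intro emeasure_eq_ennreal_measure) auto
      finally show ?thesis using m by (simp add: nn_integral_cmult)
    qed
    finally have "ennreal (c * \<kappa> powr (p - 1) * integral\<^sup>L lebesgue \<eta>) \<le> ennreal (K * integral\<^sup>L lebesgue \<eta>)"
      using ck \<eta>0 by (simp add: c_def ennreal_mult[symmetric] Bochner_Integration.integral_nonneg mult_ac)
    then have "c * \<kappa> powr (p - 1) * integral\<^sup>L lebesgue \<eta> \<le> K * integral\<^sup>L lebesgue \<eta>"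
      using K0 \<eta>0 by (subst (asm) ennreal_le_iff) (auto intro!: mult_nonneg_nonneg Bochner_Integration.integral_nonneg)
    then have "(c * \<kappa> powr (p - 1) - K) * integral\<^sup>L lebesgue \<eta> \<le> 0" by (simp add: algebra_simps)
    moreover have "0 \<le> integral\<^sup>L lebesgue \<eta>" using \<eta>0 by (intro Bochner_Integration.integral_nonneg) auto
    ultimately have "integral\<^sup>L lebesgue \<eta> = 0" using big by (simp add: mult_le_0_iff)
    then have "AE x in lebesgue. \<eta> x = 0"
      using integral_nonneg_eq_0_iff_AE[OF int\<eta>] \<eta>0 by simp
    then show ?thesis by eventually_elim (simp add: \<eta>_def max_def split: if_splits)
  qed
  have "AE x in lebesgue. u x \<le> (K / c) powr (1 / (p - 1))"
    if w: "weak_solution s p \<Omega> f u" and f: "set_borel_measurable lebesgue \<Omega> f" and K0: "0 \<le> K"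
      and K: "AE x in lebesgue. x \<in> \<Omega> \<longrightarrow> \<bar>f x\<bar> \<le> K" for f u K
  proof -
    define b where "b = (K / c) powr (1 / (p - 1))"
    have b: "b \<ge> 0" "K = c * b powr (p - 1)"
      using c K0 p by (auto simp: b_def powr_powr)
    \<comment> \<open>The test function argument needs a positive level and a strict inequality for
      K, so it is run at levels slightly above the critical b.\<close>
    have "AE x in lebesgue. u x \<le> b + 1 / real (Suc n)" for n
    proof (rule main[OF w f K0 K])
      show "0 < b + 1 / real (Suc n)" using b by (simp add: add_nonneg_pos)
      show "K < c * (b + 1 / real (Suc n)) powr (p - 1)"
        unfolding b(2) using c p b by (intro mult_strict_left_mono powr_less_mono2) auto
    qed
    then have "AE x in lebesgue. \<forall>n. u x \<le> b + 1 / real (Suc n)" by (simp add: AE_all_countable)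
    then have "AE x in lebesgue. u x \<le> b"
    proof eventually_elim
      fix x assume *: "\<forall>n. u x \<le> b + 1 / real (Suc n)"
      have "(\<lambda>n. b + 1 / real (Suc n)) \<longlonglongrightarrow> b + 0"
        by (intro tendsto_intros LIMSEQ_Suc[OF lim_1_over_n])
      then show "u x \<le> b" using * by (intro LIMSEQ_le_const[where X = "\<lambda>n. b + 1 / real (Suc n)"]) auto
    qed
    then show ?thesis by (simp add: b_def)
  qed
  then show ?thesis using c by blast
qed

lemma weak_solution_bound:
  fixes \<Omega> :: "(real^'n) set"
  assumes \<Omega>: "open \<Omega>" "bounded \<Omega>" and p: "1 < p" and s: "0 < s"
  shows "\<exists>c>0. \<forall>f u K. weak_solution s p \<Omega> f u \<longrightarrow> set_borel_measurable lebesgue \<Omega> f \<longrightarrow> 0 \<le> K \<longrightarrow>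
     (AE x in lebesgue. x \<in> \<Omega> \<longrightarrow> \<bar>f x\<bar> \<le> K) \<longrightarrow> (AE x in lebesgue. \<bar>u x\<bar> \<le> (K / c) powr (1 / (p - 1)))"
proof -
  obtain c where c: "c > 0" and ub: "\<forall>f u K. weak_solution s p \<Omega> f u \<longrightarrow> set_borel_measurable lebesgue \<Omega> f \<longrightarrow> 0 \<le> K \<longrightarrow>
     (AE x in lebesgue. x \<in> \<Omega> \<longrightarrow> \<bar>f x\<bar> \<le> K) \<longrightarrow> (AE x in lebesgue. u x \<le> (K / c) powr (1 / (p - 1)))"
    using weak_solution_upper_bound[OF assms] by (elim exE conjE) (rule that)
  have "AE x in lebesgue. \<bar>u x\<bar> \<le> (K / c) powr (1 / (p - 1))"
    if w: "weak_solution s p \<Omega> f u" and f: "set_borel_measurable lebesgue \<Omega> f" and K0: "0 \<le> K"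
      and K: "AE x in lebesgue. x \<in> \<Omega> \<longrightarrow> \<bar>f x\<bar> \<le> K" for f u K
  proof -
    have "set_borel_measurable lebesgue \<Omega> (\<lambda>x. - f x)"
      using f borel_measurable_uminus unfolding set_borel_measurable_def by fastforce
    then have "AE x in lebesgue. - u x \<le> (K / c) powr (1 / (p - 1))"
      using ub[rule_format, OF weak_solution_uminus[OF w] _ K0] K by simp
    with ub[rule_format, OF w f K0 K] show ?thesis by eventually_elim auto
  qed
  then show ?thesis using c by blast
qed

section \<open>Growth of supersolutions\<close>

text \<open>At unit scale and height, the far contribution to the operator when the values outside a ball grow like
  the \<open>\<sigma>/16\<close>-th power of the distance, as they do in the iteration of the oscillation estimate.\<close>
definition tail_kern :: "real \<Rightarrow> real \<Rightarrow> real \<Rightarrow> real^'n \<Rightarrow> real" where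
  "tail_kern s p \<sigma> h = indicator {h. 1 / 8 \<le> norm h} h *
     ((\<sigma> + 2 * ((32 * norm h) powr (\<sigma> / 16) - 1)) powr (p - 1) * kern (p * s) h)"

lemma tail_kern_nonneg [simp]: "0 \<le> tail_kern s p \<sigma> h"
  by (simp add: tail_kern_def)

lemma tail_kern_measurable [measurable]: "tail_kern s p \<sigma> \<in> borel_measurable borel"
  unfolding tail_kern_def[abs_def] by measurable

text \<open>All requirements become easier as \<sigma> decreases. Although \<sigma> also sets the
  growth exponent of the tail, the bracket in \<open>tail_kern\<close> tends to 0 pointwise and a
  multiple of \<open>kern (p * s / 2)\<close> dominates, so dominated convergence applies and C and
  c can be fixed before \<sigma>.\<close>

lemma small_parameter_exists:
  fixes p s C c :: real
  assumes p: "1 < p" and s: "0 < s" and C: "0 \<le> C" and c: "0 < c"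
  shows "\<exists>\<sigma>. 0 < \<sigma> \<and> \<sigma> \<le> 1 / 2 \<and> \<sigma> / 16 \<le> s \<and> \<sigma> / 16 * (p - 1) \<le> p * s \<and> \<sigma> powr (p - 1) * C \<le> c \<and>
    (\<integral>\<^sup>+ h. ennreal (tail_kern s p \<sigma> (h :: real^'n)) \<partial>lborel) \<le> ennreal c"
proof -
  \<comment> \<open>The entry 16 s ensures \<sigma>/16 \<le> s. The entry 8 p s/(p - 1) lets the
    growth consume at most half of the decay p s of the kernel, which leaves a majorant uniform in
    \<sigma>.\<close>
  define \<sigma>1 where "\<sigma>1 = min (1 / 2) (min (16 * s) (8 * p * s / (p - 1)))"
  define \<sigma> where "\<sigma> n = \<sigma>1 / real (Suc n)" for n
  have \<sigma>1: "0 < \<sigma>1" "\<sigma>1 \<le> 1 / 2" "\<sigma>1 \<le> 16 * s" "\<sigma>1 \<le> 8 * p * s / (p - 1)"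
    using p s by (auto simp: \<sigma>1_def)
  have \<sigma>: "0 < \<sigma> n" "\<sigma> n \<le> \<sigma>1" for n
    using \<sigma>1 by (auto simp: \<sigma>_def divide_le_eq mult_le_cancel_left1)
  have \<sigma>p: "\<sigma> n / 16 * (p - 1) \<le> p * s / 2" for n
  proof -
    have "\<sigma> n \<le> 8 * p * s / (p - 1)" using \<sigma>(2)[of n] \<sigma>1 by linarith
    then show ?thesis using p by (simp add: field_simps)
  qed
  have \<sigma>lim: "\<sigma> \<longlonglongrightarrow> 0"
    unfolding \<sigma>_def[abs_def] using tendsto_mult[OF tendsto_const LIMSEQ_Suc[OF lim_1_over_n], of \<sigma>1] by simp
  let ?N = "real CARD('n)"
  define D where "D = 2 powr (p - 1) * 32 powr (p * s / 2)"
  have D: "D \<ge> 0" by (simp add: D_def)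
  define w where "w h = ennreal D * ennreal (indicator {h. 1 / 8 \<le> norm h} h * kern (p * s / 2) (h :: real^'n))" for h
  have dom: "ennreal (tail_kern s p (\<sigma> n) h) \<le> w h" for n h
  proof (cases "1 / 8 \<le> norm h")
    case True
    then have nh: "norm h > 0" by linarith
    have X: "1 \<le> 32 * norm h" using True by simp
    have "1 \<le> (32 * norm h) powr (\<sigma> n / 16)" using X \<sigma>(1)[of n] by (intro ge_one_powr_ge_zero) auto
    then have "(\<sigma> n + 2 * ((32 * norm h) powr (\<sigma> n / 16) - 1)) powr (p - 1) \<le> (2 * (32 * norm h) powr (\<sigma> n / 16)) powr (p - 1)"
      using \<sigma>[of n] \<sigma>1 p by (intro powr_mono2) auto
    also have "\<dots> = 2 powr (p - 1) * (32 * norm h) powr (\<sigma> n / 16 * (p - 1))"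
      by (subst powr_mult) (simp add: powr_powr)
    also have "(32 * norm h) powr (\<sigma> n / 16 * (p - 1)) \<le> (32 * norm h) powr (p * s / 2)"
      using X \<sigma>p by (intro powr_mono) auto
    also have "(32 * norm h) powr (p * s / 2) = 32 powr (p * s / 2) * norm h powr (p * s / 2)"
      by (rule powr_mult)
    finally have "(\<sigma> n + 2 * ((32 * norm h) powr (\<sigma> n / 16) - 1)) powr (p - 1) \<le> D * norm h powr (p * s / 2)"
      by (simp add: D_def mult.assoc)
    then have "tail_kern s p (\<sigma> n) h \<le> (D * norm h powr (p * s / 2)) * kern (p * s) h"
      using True by (simp add: tail_kern_def mult_right_mono)
    also have "\<dots> = D * (norm h powr (p * s / 2) * norm h powr (- (?N + p * s)))"
      by (simp only: kern_def powr_minus_divide mult.assoc)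
    also have "norm h powr (p * s / 2) * norm h powr (- (?N + p * s)) = norm h powr (- (?N + p * s / 2))"
    proof -
      have "p * s / 2 + - (?N + p * s) = - (?N + p * s / 2)" by simp
      then show ?thesis by (simp only: powr_add[symmetric])
    qed
    also have "\<dots> = kern (p * s / 2) h"
      by (simp only: kern_def powr_minus_divide)
    finally show ?thesis using True D by (simp add: w_def ennreal_mult[symmetric] ennreal_leI)
  qed (simp add: tail_kern_def)
  have [measurable]: "w \<in> borel_measurable borel" unfolding w_def[abs_def] by measurable
  have wfin: "(\<integral>\<^sup>+ h. w h \<partial>lborel) < \<infinity>"
    unfolding w_def using nn_integral_powr_outside_ball[of "p * s / 2" "1 / 8", where 'n='n] p s
    by (subst nn_integral_cmult) (auto simp: ennreal_mult_less_top)
  have ptw: "(\<lambda>n. ennreal (tail_kern s p (\<sigma> n) h)) \<longlonglongrightarrow> 0" for h :: "real^'n"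
  proof (cases "1 / 8 \<le> norm h")
    case True
    then have X: "1 \<le> 32 * norm h" "32 * norm h \<noteq> 0" by auto
    have "(\<lambda>n. (32 * norm h) powr (\<sigma> n / 16)) \<longlonglongrightarrow> (32 * norm h) powr (0 / 16)"
      using X \<sigma>lim by (intro tendsto_powr tendsto_intros) auto
    then have pl: "(\<lambda>n. (32 * norm h) powr (\<sigma> n / 16)) \<longlonglongrightarrow> 1" using X by simp
    have "(\<lambda>n. \<sigma> n + 2 * ((32 * norm h) powr (\<sigma> n / 16) - 1)) \<longlonglongrightarrow> 0 + 2 * (1 - 1)"
      by (intro tendsto_intros \<sigma>lim pl)
    then have l0: "(\<lambda>n. \<sigma> n + 2 * ((32 * norm h) powr (\<sigma> n / 16) - 1)) \<longlonglongrightarrow> 0" by simp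
    have "0 \<le> \<sigma> n + 2 * ((32 * norm h) powr (\<sigma> n / 16) - 1)" for n
      using ge_one_powr_ge_zero[of "32 * norm h" "\<sigma> n / 16"] X \<sigma>(1)[of n] by simp
    then have "(\<lambda>n. (\<sigma> n + 2 * ((32 * norm h) powr (\<sigma> n / 16) - 1)) powr (p - 1)) \<longlonglongrightarrow> 0 powr (p - 1)"
      using p by (intro tendsto_powr2[OF l0 tendsto_const]) auto
    then have "(\<lambda>n. (\<sigma> n + 2 * ((32 * norm h) powr (\<sigma> n / 16) - 1)) powr (p - 1) * kern (p * s) h) \<longlonglongrightarrow> 0 * kern (p * s) h"
      by (intro tendsto_intros) auto
    then have "(\<lambda>n. tail_kern s p (\<sigma> n) h) \<longlonglongrightarrow> 0" using True by (simp add: tail_kern_def)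
    then show ?thesis using tendsto_ennrealI by fastforce
  qed (simp add: tail_kern_def)
  have "(\<lambda>n. \<integral>\<^sup>+ h. ennreal (tail_kern s p (\<sigma> n) (h :: real^'n)) \<partial>lborel) \<longlonglongrightarrow> (\<integral>\<^sup>+ h. (0::ennreal) \<partial>(lborel :: (real^'n) measure))"
    by (rule nn_integral_dominated_convergence[where w = w]) (use dom ptw wfin in auto)
  then have ev1: "eventually (\<lambda>n. (\<integral>\<^sup>+ h. ennreal (tail_kern s p (\<sigma> n) (h :: real^'n)) \<partial>lborel) < ennreal c) sequentially"
    using c by (intro order_tendstoD(2)) auto
  have "(\<lambda>n. \<sigma> n powr (p - 1)) \<longlonglongrightarrow> 0 powr (p - 1)"
    using p \<sigma>(1) by (intro tendsto_powr2[OF \<sigma>lim tendsto_const]) (auto intro!: always_eventually less_imp_le)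
  then have "(\<lambda>n. \<sigma> n powr (p - 1) * C) \<longlonglongrightarrow> 0 * C"
    by (intro tendsto_intros) auto
  then have ev2: "eventually (\<lambda>n. \<sigma> n powr (p - 1) * C < c) sequentially"
    using c by (intro order_tendstoD(2)) auto
  obtain n where n: "(\<integral>\<^sup>+ h. ennreal (tail_kern s p (\<sigma> n) (h :: real^'n)) \<partial>lborel) < ennreal c" "\<sigma> n powr (p - 1) * C < c"
    using eventually_happens[OF eventually_conj[OF ev1 ev2]] by auto
  have "\<sigma> n / 16 * (p - 1) \<le> p * s" using \<sigma>p[of n] p s by (smt (verit) field_sum_of_halves mult_pos_pos)
  then show ?thesis
    using n \<sigma>[of n] \<sigma>1 by (intro exI[of _ "\<sigma> n"]) auto
qed

lemma integrable_kern_truncated: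
  assumes "0 < a" "0 < \<epsilon>"
  shows "integrable lebesgue (\<lambda>y. indicator {y. \<epsilon> \<le> norm (x - y)} y * kern a (x - y :: real^'n))"
proof (rule integrableI_bounded)
  show "(\<lambda>y. indicator {y. \<epsilon> \<le> norm (x - y)} y * kern a (x - y)) \<in> borel_measurable lebesgue"
    by (rule measurable_completion) measurable
  let ?g = "\<lambda>h::real^'n. ennreal (indicator {h. \<epsilon> \<le> norm h} h * kern a h)"
  have "(\<integral>\<^sup>+ y. ennreal (norm (indicator {y. \<epsilon> \<le> norm (x - y)} y * kern a (x - y))) \<partial>lebesgue) = (\<integral>\<^sup>+ y. ?g (x - y) \<partial>lebesgue)"
    by (intro nn_integral_cong) (auto simp: indicator_def)
  also have "\<dots> = (\<integral>\<^sup>+ h. ?g h \<partial>lborel)" by (rule nn_integral_lebesgue_diff) measurable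
  also have "\<dots> < \<infinity>" using assms by (rule nn_integral_powr_outside_ball)
  finally show "(\<integral>\<^sup>+ y. ennreal (norm (indicator {y. \<epsilon> \<le> norm (x - y)} y * kern a (x - y))) \<partial>lebesgue) < \<infinity>" .
qed

text \<open>The integral is split by the position of y. Within distance R/8 of x, w lies above the
  scaled barrier and the barrier operator bounds the contribution; farther away the growth of -w
  gives the tail; on A, w exceeds the barrier value at x by at least \<mu>/2, which yields the
  negative term. All three scale like
  \<open>\<mu> powr (p - 1) * R powr (- (p * s))\<close>.\<close>

lemma truncated_operator_estimate:
  fixes w :: "real^'n \<Rightarrow> real"
  assumes p: "1 < p" and s: "0 < s"
    and C1: "\<forall>(x0::real^'n) x \<rho> \<epsilon>. 0 < \<rho> \<longrightarrow> 0 < \<epsilon> \<longrightarrow> x \<in> ball x0 \<rho> \<longrightarrow>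
      barrier_operator s p i \<epsilon> x0 \<rho> x \<le> C1 * \<rho> powr (- (p * s))"
    and \<sigma>: "0 < \<sigma>" "\<sigma> \<le> 1 / 2" and \<delta>: "0 \<le> \<delta>"
    and tail: "(\<integral>\<^sup>+ h. ennreal (tail_kern s p \<sigma> (h :: real^'n)) \<partial>lborel) \<le> ennreal \<delta>"
    and w_meas [measurable]: "w \<in> borel_measurable lebesgue" and M: "\<And>y. \<bar>w y\<bar> \<le> M"
    and R: "0 < R" and lam: "0 < \<mu>" and x: "x \<in> ball x0 (R / 8)" and \<epsilon>: "0 < \<epsilon>" "\<epsilon> \<le> R / 8"
    and A: "A \<in> sets lebesgue" "A \<subseteq> ball x0 R - ball x0 (R / 4)" and mA: "m0 * R ^ CARD('n) \<le> measure lebesgue A"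
    and hin: "AE y in lebesgue. y \<in> ball x0 R \<longrightarrow> \<sigma> * \<mu> * barrier i x0 (R / 8) y \<le> w y"
    and hA: "AE y in lebesgue. y \<in> A \<longrightarrow> \<mu> \<le> w y"
    and hout: "AE y in lebesgue. y \<notin> ball x0 R \<longrightarrow> - (2 * \<mu> * ((16 * dist x0 y / R) powr (\<sigma> / 16) - 1)) \<le> w y"
  shows "(\<integral>y. indicator {y. \<epsilon> \<le> norm (x - y)} y * (spow (\<sigma> * \<mu> * barrier i x0 (R / 8) x - w y) (p - 1) * kern (p * s) (x - y)) \<partial>lebesgue)
     \<le> \<mu> powr (p - 1) * R powr (- (p * s)) *
        (\<sigma> powr (p - 1) * (C1 * 8 powr (p * s)) + \<delta> - (1 / 2) powr (p - 1) * 2 powr (- real CARD('n) - p * s) * m0)"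
proof -
  let ?N = "real CARD('n)"
  define \<rho> where "\<rho> = R / 8"
  define k where "k = \<sigma> * \<mu>"
  \<comment> \<open>On A the difference is at most -\<mu>/2, because \<sigma> \<le> 1/2, and points
    are at most 2R from x; a is the resulting gain per unit volume.\<close>
  define a where "a = (\<mu> / 2) powr (p - 1) * (2 * R) powr (- ?N - p * s)"
  let ?b = "barrier i x0 \<rho>"
  have \<rho>: "\<rho> > 0" using R by (simp add: \<rho>_def)
  have k: "k > 0" "k \<le> \<mu> / 2" using \<sigma> lam mult_right_mono[of \<sigma> "1 / 2" \<mu>] by (auto simp: k_def)
  have ps: "0 < p * s" using p s by simp
  \<comment> \<open>F is the integrand, Fn its majorant near x taken from the barrier, Ff its far
    majorant, a rescaled \<open>tail_kern\<close>.\<close>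
  define F where "F y = indicator {y. \<epsilon> \<le> norm (x - y)} y * (spow (k * ?b x - w y) (p - 1) * kern (p * s) (x - y))" for y
  define Fn where "Fn y = indicator {y. \<epsilon> \<le> norm (x - y) \<and> norm (x - y) < \<rho>} y * (k powr (p - 1) * spow (?b x - ?b y) (p - 1) * kern (p * s) (x - y))" for y
  define Ff where "Ff y = \<mu> powr (p - 1) * (R powr (- ?N - p * s) * tail_kern s p \<sigma> ((y - x) /\<^sub>R R))" for y
  have dx: "norm (x - x0) < \<rho>" using x by (simp add: \<rho>_def dist_norm norm_minus_commute)
  have kk: "kern (p * s) (x - y) = R powr (- ?N - p * s) * kern (p * s) ((y - x) /\<^sub>R R)" for y
    using kern_scale[OF R, of "p * s" "(y - x) /\<^sub>R R"] R by (simp add: kern_commute)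
  have Ff_eq: "Ff y = indicator {y. \<rho> \<le> norm (x - y)} y * ((\<mu> * (\<sigma> + 2 * ((32 * norm (x - y) / R) powr (\<sigma> / 16) - 1))) powr (p - 1) * kern (p * s) (x - y))" for y
  proof -
    have n: "norm ((y - x) /\<^sub>R R) = norm (x - y) / R" using R by (simp add: norm_minus_commute divide_inverse mult.commute)
    have c: "1 / 8 \<le> norm (x - y) / R \<longleftrightarrow> \<rho> \<le> norm (x - y)" using R by (simp add: \<rho>_def field_simps)
    have pm: "(\<mu> * Z) powr (p - 1) = \<mu> powr (p - 1) * Z powr (p - 1)" for Z by (rule powr_mult)
    show ?thesis
      unfolding Ff_def tail_kern_def pm kk mem_Collect_eq indicator_def n c by simp
  qed
  have Ff0: "0 \<le> Ff y" for y by (simp add: Ff_def)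
  have pw: "AE y in lebesgue. F y \<le> Fn y + Ff y - a * indicator A y"
    using hin hA hout
  proof eventually_elim
    fix y
    assume h1: "y \<in> ball x0 R \<longrightarrow> \<sigma> * \<mu> * barrier i x0 (R / 8) y \<le> w y"
      and h2: "y \<in> A \<longrightarrow> \<mu> \<le> w y"
      and h3: "y \<notin> ball x0 R \<longrightarrow> - (2 * \<mu> * ((16 * dist x0 y / R) powr (\<sigma> / 16) - 1)) \<le> w y"
    have tri: "norm (y - x0) \<le> norm (x - y) + norm (x - x0)"
      using norm_triangle_ineq4[of "x - x0" "x - y"] by (simp add: algebra_simps)
    have tri2: "norm (x - y) \<le> norm (x - x0) + norm (y - x0)"
      using norm_triangle_ineq4[of "x - x0" "y - x0"] by simp
    \<comment> \<open>A avoids \<open>ball x0 (R / 4)\<close> and x lies in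
      \<open>ball x0 (R / 8)\<close>, so A is contained in the far region, where Fn
      vanishes.\<close>
    have yA: "\<rho> \<le> norm (x - y)" if "y \<in> A"
    proof -
      have "R / 4 \<le> norm (y - x0)" using that A(2) by (auto simp: dist_norm norm_minus_commute)
      then show ?thesis using tri dx by (simp add: \<rho>_def)
    qed
    consider "norm (x - y) < \<epsilon>" | "\<epsilon> \<le> norm (x - y)" "norm (x - y) < \<rho>" | "\<rho> \<le> norm (x - y)" "y \<in> A" | "\<rho> \<le> norm (x - y)" "y \<notin> A"
      by linarith
    then show "F y \<le> Fn y + Ff y - a * indicator A y"
    proof cases
      case 1
      then have "y \<notin> A" using yA \<epsilon> by (auto simp: \<rho>_def)
      then show ?thesis using 1 Ff0[of y] by (simp add: F_def Fn_def)
    next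
      case 2
      then have yA': "y \<notin> A" using yA by auto
      have "norm (y - x0) < R" using tri 2 dx R by (simp add: \<rho>_def)
      then have "k * ?b y \<le> w y" using h1 by (simp add: k_def \<rho>_def dist_norm norm_minus_commute)
      then have "spow (k * ?b x - w y) (p - 1) \<le> spow (k * (?b x - ?b y)) (p - 1)"
        using p by (intro spow_mono) (auto simp: algebra_simps)
      also have "\<dots> = k powr (p - 1) * spow (?b x - ?b y) (p - 1)" using k by (simp add: spow_mult)
      finally have "F y \<le> Fn y" using 2 by (simp add: F_def Fn_def mult_right_mono)
      then show ?thesis using yA' Ff0[of y] by simp
    next
      case 3
      have "w y \<ge> \<mu>" using h2 3 by simp
      moreover have "k * ?b x \<le> k" using k \<rho> by (simp add: mult_left_le)
      ultimately have "k * ?b x - w y \<le> - (\<mu> / 2)" using k by linarith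
      then have "spow (k * ?b x - w y) (p - 1) \<le> spow (- (\<mu> / 2)) (p - 1)"
        using p by (intro spow_mono) auto
      also have "\<dots> = - ((\<mu> / 2) powr (p - 1))" using lam by (simp add: spow_nonpos_eq)
      finally have s1: "spow (k * ?b x - w y) (p - 1) \<le> - ((\<mu> / 2) powr (p - 1))" .
      have ny: "norm (y - x0) < R" using 3 A(2) by (auto simp: dist_norm norm_minus_commute)
      have nle: "norm (x - y) \<le> 2 * R" using tri2 dx ny R by (simp add: \<rho>_def)
      have pos: "norm (x - y) > 0" using 3 \<rho> by linarith
      have "(2 * R) powr (- ?N - p * s) = 1 / (2 * R) powr (?N + p * s)"
        using powr_minus_divide[of "2 * R" "?N + p * s"] by simp
      also have "\<dots> \<le> kern (p * s) (x - y)"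
        unfolding kern_def using nle pos ps R by (intro divide_left_mono powr_mono2 mult_pos_pos) auto
      finally have kge: "(2 * R) powr (- ?N - p * s) \<le> kern (p * s) (x - y)" .
      have "F y = spow (k * ?b x - w y) (p - 1) * kern (p * s) (x - y)"
        using 3 \<epsilon> by (simp add: F_def \<rho>_def)
      also have "\<dots> \<le> - ((\<mu> / 2) powr (p - 1)) * kern (p * s) (x - y)"
        using s1 by (intro mult_right_mono) auto
      also have "\<dots> \<le> - a" unfolding a_def using kge by (simp add: mult_left_mono)
      finally have "F y \<le> - a" .
      moreover have "Fn y = 0" using 3 by (simp add: Fn_def)
      ultimately show ?thesis using 3 Ff0[of y] by simp
    next
      case 4
      let ?X = "(32 * norm (x - y) / R) powr (\<sigma> / 16)"
      have X1: "1 \<le> ?X" using 4 R \<sigma> by (intro ge_one_powr_ge_zero) (auto simp: \<rho>_def field_simps)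
      have kb: "k * ?b x \<le> k" using k \<rho> by (simp add: mult_left_le)
      have "k * ?b x - w y \<le> \<mu> * (\<sigma> + 2 * (?X - 1))"
      proof (cases "y \<in> ball x0 R")
        case True
        have "0 \<le> k * ?b y" using k by simp
        then have "0 \<le> w y" using h1 True unfolding k_def \<rho>_def by linarith
        then have "k * ?b x - w y \<le> \<mu> * \<sigma>" using kb by (simp add: k_def mult.commute)
        also have "\<dots> \<le> \<mu> * (\<sigma> + 2 * (?X - 1))" using lam X1 by (intro mult_left_mono) auto
        finally show ?thesis .
      next
        case False
        \<comment> \<open>x is closer to x0 than to y, so distances from x0 are at most twice those
          from x: this turns the 16 of the growth hypothesis into the 32 of
          \<open>tail_kern\<close>.\<close>
        have "norm (y - x0) \<le> 2 * norm (x - y)" using tri dx 4 by linarith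
        then have "16 * dist x0 y / R \<le> 32 * norm (x - y) / R"
          using R by (intro divide_right_mono) (auto simp: dist_norm norm_minus_commute)
        then have "(16 * dist x0 y / R) powr (\<sigma> / 16) \<le> ?X"
          using R \<sigma> by (intro powr_mono2) auto
        then have "2 * \<mu> * ((16 * dist x0 y / R) powr (\<sigma> / 16) - 1) \<le> 2 * \<mu> * (?X - 1)"
          using lam by (intro mult_left_mono) auto
        then have "- w y \<le> 2 * \<mu> * (?X - 1)" using h3 False by linarith
        then show ?thesis using kb by (simp add: k_def algebra_simps)
      qed
      then have "spow (k * ?b x - w y) (p - 1) \<le> spow (\<mu> * (\<sigma> + 2 * (?X - 1))) (p - 1)"
        using p by (intro spow_mono) auto
      also have "\<dots> = (\<mu> * (\<sigma> + 2 * (?X - 1))) powr (p - 1)"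
        using lam \<sigma> X1 by (intro spow_nonneg_eq mult_nonneg_nonneg) auto
      finally have "F y \<le> Ff y"
        using 4 \<epsilon> by (simp add: F_def Ff_eq mult_right_mono \<rho>_def)
      moreover have "Fn y = 0" using 4 by (simp add: Fn_def)
      ultimately show ?thesis using 4 by simp
    qed
  qed
  have M0: "0 \<le> M" using M[of x] by linarith
  let ?T = "\<lambda>y. indicator {y. \<epsilon> \<le> norm (x - y)} y * kern (p * s) (x - y)"
  have intT: "integrable lebesgue ?T" by (rule integrable_kern_truncated[OF ps \<epsilon>(1)])
  have leb [measurable]: "(\<lambda>y. kern (p * s) (x - y)) \<in> borel_measurable lebesgue" "(\<lambda>y. norm (x - y)) \<in> borel_measurable lebesgue" "?b \<in> borel_measurable lebesgue"
    by (rule measurable_completion, measurable)+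
  \<comment> \<open>Boundedness of w and the cut-off at \<epsilon> give integrability; the constants
    of the estimate stay free of M and \<epsilon>.\<close>
  have intF: "integrable lebesgue F"
  proof (rule Bochner_Integration.integrable_bound)
    show "integrable lebesgue (\<lambda>y. (k + M) powr (p - 1) * ?T y)" using intT by simp
    show "F \<in> borel_measurable lebesgue" unfolding F_def[abs_def] by measurable
    have "norm (F y) \<le> norm ((k + M) powr (p - 1) * ?T y)" for y
    proof -
      have "\<bar>k * ?b x\<bar> \<le> k" using k \<rho> by (simp add: abs_mult mult_left_le)
      then have "\<bar>k * ?b x - w y\<bar> \<le> k + M" using M[of y] by linarith
      then have "\<bar>spow (k * ?b x - w y) (p - 1)\<bar> \<le> (k + M) powr (p - 1)"
        unfolding abs_spow using p by (intro powr_mono2) auto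
      then show ?thesis by (simp add: F_def abs_mult mult_right_mono indicator_def)
    qed
    then show "AE y in lebesgue. norm (F y) \<le> norm ((k + M) powr (p - 1) * ?T y)" by simp
  qed
  have Fn_borel: "Fn \<in> borel_measurable borel" unfolding Fn_def[abs_def] by measurable
  have intFn: "integrable lebesgue Fn"
  proof (rule Bochner_Integration.integrable_bound)
    show "integrable lebesgue (\<lambda>y. k powr (p - 1) * ?T y)" using intT by simp
    show "Fn \<in> borel_measurable lebesgue" using Fn_borel by (intro measurable_completion) simp
    have "norm (Fn y) \<le> norm (k powr (p - 1) * ?T y)" for y
    proof -
      have "\<bar>?b x - ?b y\<bar> \<le> 1" using barrier_nonneg[of i x0 \<rho> x] barrier_nonneg[of i x0 \<rho> y] \<rho> barrier_le_1[of \<rho> i x0 x] barrier_le_1[of \<rho> i x0 y] by linarith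
      then have "\<bar>spow (?b x - ?b y) (p - 1)\<bar> \<le> 1 powr (p - 1)"
        unfolding abs_spow using p by (intro powr_mono2) auto
      then have "k powr (p - 1) * \<bar>spow (?b x - ?b y) (p - 1)\<bar> * kern (p * s) (x - y) \<le> k powr (p - 1) * 1 * kern (p * s) (x - y)"
        by (intro mult_right_mono mult_left_mono) auto
      then show ?thesis by (simp add: Fn_def abs_mult indicator_def)
    qed
    then show "AE y in lebesgue. norm (Fn y) \<le> norm (k powr (p - 1) * ?T y)" by simp
  qed
  have Ff_nn: "(\<integral>\<^sup>+ y. ennreal (Ff y) \<partial>lebesgue) \<le> ennreal (\<mu> powr (p - 1) * (R powr (- (p * s)) * \<delta>))"
  proof -
    have "(\<integral>\<^sup>+ y. ennreal (Ff y) \<partial>lebesgue) = (\<integral>\<^sup>+ y. ennreal (\<mu> powr (p - 1) * R powr (- ?N - p * s)) * ennreal (tail_kern s p \<sigma> ((y - x) /\<^sub>R R)) \<partial>lborel)"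
      unfolding nn_integral_completion by (intro nn_integral_cong) (simp add: Ff_def ennreal_mult[symmetric] mult.assoc)
    also have "\<dots> = ennreal (\<mu> powr (p - 1) * R powr (- ?N - p * s)) * (ennreal (R ^ DIM(real^'n)) * (\<integral>\<^sup>+ h. ennreal (tail_kern s p \<sigma> (h :: real^'n)) \<partial>lborel))"
      using nn_integral_lborel_affine_scale[of "\<lambda>h. ennreal (tail_kern s p \<sigma> h)" R x, OF _ R]
      by (subst nn_integral_cmult) auto
    also have "\<dots> \<le> ennreal (\<mu> powr (p - 1) * R powr (- ?N - p * s)) * (ennreal (R ^ DIM(real^'n)) * ennreal \<delta>)"
      using tail by (intro mult_left_mono) auto
    also have "\<dots> = ennreal (\<mu> powr (p - 1) * R powr (- ?N - p * s) * (R ^ DIM(real^'n) * \<delta>))"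
      using \<delta> R by (simp add: ennreal_mult)
    also have "\<mu> powr (p - 1) * R powr (- ?N - p * s) * (R ^ DIM(real^'n) * \<delta>) = \<mu> powr (p - 1) * ((R powr (- ?N - p * s) * R ^ DIM(real^'n)) * \<delta>)"
      by simp
    also have "R powr (- ?N - p * s) * R ^ DIM(real^'n) = R powr (- (p * s))"
    proof -
      have "R ^ DIM(real^'n) = R powr ?N" using R by (simp add: powr_realpow)
      then show ?thesis by (simp only: powr_add[symmetric]) simp
    qed
    finally show ?thesis .
  qed
  have intFf: "integrable lebesgue Ff"
  proof (rule integrableI_bounded)
    show "Ff \<in> borel_measurable lebesgue"
      unfolding Ff_def[abs_def] by (rule measurable_completion) measurable
    have "(\<integral>\<^sup>+ y. ennreal (norm (Ff y)) \<partial>lebesgue) = (\<integral>\<^sup>+ y. ennreal (Ff y) \<partial>lebesgue)" using Ff0 by simp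
    also have "\<dots> < \<infinity>" using Ff_nn by (rule le_less_trans) simp
    finally show "(\<integral>\<^sup>+ y. ennreal (norm (Ff y)) \<partial>lebesgue) < \<infinity>" .
  qed
  have Ff_le: "integral\<^sup>L lebesgue Ff \<le> \<mu> powr (p - 1) * (R powr (- (p * s)) * \<delta>)"
    using \<delta> by (intro integral_real_bounded Ff_nn) auto
  have Afin: "emeasure lebesgue A < \<infinity>"
  proof -
    have "emeasure lebesgue A \<le> emeasure lebesgue (ball x0 R)" using A by (intro emeasure_mono) auto
    also have "\<dots> < \<infinity>" by (rule emeasure_lebesgue_bounded_open) auto
    finally show ?thesis .
  qed
  have intA: "integrable lebesgue (\<lambda>y. a * indicator A y)" using A(1) Afin by simp
  have A_eq: "(\<integral>y. a * indicator A y \<partial>lebesgue) = a * measure lebesgue A" using A(1) Afin by simp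
  have Fn_le: "integral\<^sup>L lebesgue Fn \<le> k powr (p - 1) * (C1 * \<rho> powr (- (p * s)))"
  proof -
    have "integral\<^sup>L lebesgue Fn = integral\<^sup>L lborel Fn" using Fn_borel by (intro integral_completion) simp
    also have "\<dots> = integral\<^sup>L (distr lborel borel ((+) x)) Fn" by (simp add: lborel_distr_plus)
    also have "\<dots> = (\<integral>h. Fn (x + h) \<partial>lborel)" using Fn_borel by (intro integral_distr) auto
    also have "\<dots> = (\<integral>h. k powr (p - 1) * (indicator {h. \<epsilon> \<le> norm h \<and> norm h < \<rho>} h *
        (spow (?b x - ?b (x + h)) (p - 1) * kern (p * s) h)) \<partial>lborel)"
      by (intro Bochner_Integration.integral_cong) (auto simp: Fn_def indicator_def)
    also have "\<dots> = k powr (p - 1) * (\<integral>h. indicator {h. \<epsilon> \<le> norm h \<and> norm h < \<rho>} h *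
        (spow (?b x - ?b (x + h)) (p - 1) * kern (p * s) h) \<partial>lborel)"
      by (rule integral_mult_right_zero)
    also have "\<dots> \<le> k powr (p - 1) * (C1 * \<rho> powr (- (p * s)))"
      using C1[rule_format, OF \<rho> \<epsilon>(1), of x x0] x 
      by (intro mult_left_mono) (auto simp: \<rho>_def barrier_operator_def)
    finally show ?thesis .
  qed
  have "integral\<^sup>L lebesgue F \<le> (\<integral>y. Fn y + Ff y - a * indicator A y \<partial>lebesgue)"
    by (rule integral_mono_AE[OF intF _ pw]) (intro Bochner_Integration.integrable_add Bochner_Integration.integrable_diff intFn intFf intA)
  also have "\<dots> = integral\<^sup>L lebesgue Fn + integral\<^sup>L lebesgue Ff - a * measure lebesgue A"
    using intFn intFf intA A_eq by simp
  also have "\<dots> \<le> k powr (p - 1) * (C1 * \<rho> powr (- (p * s))) + \<mu> powr (p - 1) * (R powr (- (p * s)) * \<delta>) - a * (m0 * R ^ CARD('n))"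
    using Fn_le Ff_le mA by (intro diff_mono add_mono mult_left_mono) (auto simp: a_def)
  also have "k powr (p - 1) = \<sigma> powr (p - 1) * \<mu> powr (p - 1)" unfolding k_def by (rule powr_mult)
  also have "\<rho> powr (- (p * s)) = R powr (- (p * s)) * 8 powr (p * s)"
  proof -
    have "\<rho> powr (- (p * s)) = R powr (- (p * s)) / 8 powr (- (p * s))" unfolding \<rho>_def by (rule powr_divide)
    then show ?thesis using powr_minus_divide[of 8 "p * s"] by simp
  qed
  also have "a * (m0 * R ^ CARD('n)) = \<mu> powr (p - 1) * R powr (- (p * s)) * ((1 / 2) powr (p - 1) * 2 powr (- ?N - p * s) * m0)"
  proof -
    have "(\<mu> / 2) powr (p - 1) = \<mu> powr (p - 1) * (1 / 2) powr (p - 1)"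
      using powr_mult[of \<mu> "1 / 2" "p - 1"] by simp
    moreover have "(2 * R) powr (- ?N - p * s) * R ^ CARD('n) = 2 powr (- ?N - p * s) * R powr (- (p * s))"
    proof -
      have "R ^ CARD('n) = R powr ?N" using R by (simp add: powr_realpow)
      then have "R powr (- ?N - p * s) * R ^ CARD('n) = R powr (- (p * s))" by (simp only: powr_add[symmetric]) simp
      then show ?thesis by (simp add: powr_mult)
    qed
    moreover have "a * (m0 * R ^ CARD('n)) = (\<mu> / 2) powr (p - 1) * ((2 * R) powr (- ?N - p * s) * R ^ CARD('n)) * m0"
      unfolding a_def by (simp only: mult_ac)
    ultimately show ?thesis by (simp only: mult_ac)
  qed
  finally have "integral\<^sup>L lebesgue F \<le> \<mu> powr (p - 1) * R powr (- (p * s)) *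
        (\<sigma> powr (p - 1) * (C1 * 8 powr (p * s)) + \<delta> - (1 / 2) powr (p - 1) * 2 powr (- ?N - p * s) * m0)"
    by (simp only: algebra_simps)
  then show ?thesis unfolding F_def[abs_def] k_def \<rho>_def .
qed

text \<open>Comparison with \<open>\<sigma> \<mu>\<close> times the barrier: the test function \<open>\<eta>\<close> is the positive part of its
  difference with \<open>V\<close>. By monotonicity the energy of \<open>V\<close> against \<open>\<eta>\<close> is at most that of
  \<open>V + \<eta>\<close>, which is estimated pointwise after cutting off a neighbourhood of the diagonal.\<close>
lemma supersolution_lower_bound:
  fixes V :: "real^'n \<Rightarrow> real" and \<Omega> :: "(real^'n) set"
  assumes p: "1 < p" and s: "0 < s" "s < 1"
    and C1: "\<forall>(x0::real^'n) x \<rho> \<epsilon>. 0 < \<rho> \<longrightarrow> 0 < \<epsilon> \<longrightarrow> x \<in> ball x0 \<rho> \<longrightarrow>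
      barrier_operator s p i \<epsilon> x0 \<rho> x \<le> C1 * \<rho> powr (- (p * s))"
    and \<sigma>: "0 < \<sigma>" "\<sigma> \<le> 1 / 2" and \<delta>: "0 \<le> \<delta>"
    and tail: "(\<integral>\<^sup>+ h. ennreal (tail_kern s p \<sigma> (h :: real^'n)) \<partial>lborel) \<le> ennreal \<delta>"
    and small: "\<sigma> powr (p - 1) * (C1 * 8 powr (p * s)) + \<delta> - (1 / 2) powr (p - 1) * 2 powr (- real CARD('n) - p * s) * m0 \<le> - c0"
    and \<Omega>: "open \<Omega>" "bounded \<Omega>"
    and V_meas [measurable]: "V \<in> borel_measurable lebesgue" and Vb: "\<And>x. \<bar>V x\<bar> \<le> b" and gV: "gagliardo s p V < \<infinity>"
    and super: "\<And>\<eta>. \<eta> \<in> W0 s p \<Omega> \<Longrightarrow> (\<And>x. 0 \<le> \<eta> x) \<Longrightarrow>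
       - K * integral\<^sup>L lebesgue \<eta> \<le> integral\<^sup>L leb2 (energy_integrand s p V \<eta>)"
    and R: "0 < R" and lam: "0 < \<mu>"
    and A: "A \<in> sets lebesgue" "A \<subseteq> ball x0 R - ball x0 (R / 4)" and mA: "m0 * R ^ CARD('n) \<le> measure lebesgue A"
    and V0: "AE y in lebesgue. y \<in> ball x0 R \<longrightarrow> 0 \<le> V y"
    and V\<Omega>: "AE y in lebesgue. y \<in> ball x0 (R / 8) - \<Omega> \<longrightarrow> \<mu> \<le> V y"
    and VA: "AE y in lebesgue. y \<in> A \<longrightarrow> \<mu> \<le> V y"
    and Vout: "AE y in lebesgue. y \<notin> ball x0 R \<longrightarrow> - (2 * \<mu> * ((16 * dist x0 y / R) powr (\<sigma> / 16) - 1)) \<le> V y"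
    and K: "K < 2 * c0 * (\<mu> powr (p - 1) * R powr (- (p * s)))"
  shows "AE y in lebesgue. y \<in> ball x0 (R / 16) \<longrightarrow> \<sigma> * \<mu> / 2 \<le> V y"
proof -
  define \<rho> where "\<rho> = R / 8"
  define k where "k = \<sigma> * \<mu>"
  let ?b = "barrier i x0 \<rho>"
  have \<rho>: "\<rho> > 0" using R by (simp add: \<rho>_def)
  have k: "k > 0" "k \<le> \<mu>" using \<sigma> lam mult_right_mono[of \<sigma> 1 \<mu>] by (auto simp: k_def)
  have ps: "0 < p * s" using p s by simp
  have b_leb [measurable]: "?b \<in> borel_measurable lebesgue"
    by (rule measurable_completion) measurable
  \<comment> \<open>In \<open>ball x0 R\<close>, where V is nonnegative, this is the positive part
    of the scaled barrier minus V. The inner minimum keeps \<eta> below the scaled barrier, hence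
    supported in \<open>ball x0 \<rho>\<close>, even where V is negative.\<close>
  define \<eta> where "\<eta> x = max 0 (min (k * ?b x) (k * ?b x - V x))" for x
  have \<eta>_meas [measurable]: "\<eta> \<in> borel_measurable lebesgue" unfolding \<eta>_def[abs_def] by measurable
  have \<eta>0: "0 \<le> \<eta> x" for x by (simp add: \<eta>_def)
  have kb: "0 \<le> k * ?b x" "k * ?b x \<le> k" for x using k \<rho> by (auto simp: mult_left_le)
  have \<eta>k: "\<eta> x \<le> k" for x unfolding \<eta>_def using kb(2)[of x] k by linarith
  have \<eta>D: "\<eta> x = 0" if "x \<notin> ball x0 \<rho>" for x using barrier_outside[OF \<rho> that] by (simp add: \<eta>_def)
  have b0: "0 \<le> b" using Vb[of x0] by linarith
  have g\<phi>: "gagliardo s p ?b < \<infinity>"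
  proof (rule gagliardo_lipschitz_finite[OF p s barrier_measurable barrier_lipschitz[OF \<rho>]])
    show "?b x = 0" if "x \<notin> ball x0 \<rho>" for x by (rule barrier_outside[OF \<rho> that])
  qed (use \<rho> in auto)
  have g\<eta>: "gagliardo s p \<eta> < \<infinity>"
  proof (rule gagliardo_finite_dominated[OF V_meas b_leb _ gV g\<phi>])
    show "0 \<le> k" "0 < p" using k p by auto
    fix x y
    have "\<bar>\<eta> x - \<eta> y\<bar> \<le> \<bar>k * ?b x - k * ?b y\<bar> + \<bar>V x - V y\<bar>"
      unfolding \<eta>_def by (auto simp: max_def min_def abs_if)
    also have "\<bar>k * ?b x - k * ?b y\<bar> = k * \<bar>?b x - ?b y\<bar>"
      using k by (simp add: right_diff_distrib[symmetric] abs_mult)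
    finally show "\<bar>\<eta> x - \<eta> y\<bar> \<le> k * \<bar>?b x - ?b y\<bar> + \<bar>V x - V y\<bar>" .
  qed
  have \<eta>W: "\<eta> \<in> W0 s p \<Omega>"
  proof -
    have "(\<integral>\<^sup>+ x. ennreal (\<bar>\<eta> x\<bar> powr p) \<partial>lebesgue) \<le> (\<integral>\<^sup>+ x. ennreal (k powr p) * indicator (ball x0 \<rho>) x \<partial>lebesgue)"
    proof (rule nn_integral_mono)
      fix x
      show "ennreal (\<bar>\<eta> x\<bar> powr p) \<le> ennreal (k powr p) * indicator (ball x0 \<rho>) x"
      proof (cases "x \<in> ball x0 \<rho>")
        case True
        then show ?thesis using \<eta>0[of x] \<eta>k[of x] p by (auto intro!: ennreal_leI powr_mono2)
      qed (simp add: \<eta>D)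
    qed
    also have "\<dots> = ennreal (k powr p) * emeasure lebesgue (ball x0 \<rho>)"
      by (rule nn_integral_cmult_indicator) simp
    also have "\<dots> < \<infinity>"
      using emeasure_lebesgue_bounded_open(2)[of "ball x0 \<rho>"] by (simp add: ennreal_mult_less_top del: emeasure_completion)
    finally have "(\<integral>\<^sup>+ x. ennreal (\<bar>\<eta> x\<bar> powr p) \<partial>lebesgue) < \<infinity>" .
    \<comment> \<open>In the small ball outside the domain V is at least \<mu>, hence at least the
      height k of the scaled barrier; this makes \<eta> admissible also across the boundary.\<close>
    moreover have "AE x in lebesgue. x \<notin> \<Omega> \<longrightarrow> \<eta> x = 0"
      using V\<Omega>
    proof eventually_elim
      fix x assume h: "x \<in> ball x0 (R / 8) - \<Omega> \<longrightarrow> \<mu> \<le> V x"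
      show "x \<notin> \<Omega> \<longrightarrow> \<eta> x = 0"
      proof
        assume "x \<notin> \<Omega>"
        show "\<eta> x = 0"
        proof (cases "x \<in> ball x0 \<rho>")
          case True
          then have "\<mu> \<le> V x" using h \<open>x \<notin> \<Omega>\<close> by (simp add: \<rho>_def)
          then have "k * ?b x - V x \<le> 0" using kb(2)[of x] k by linarith
          then show ?thesis by (simp add: \<eta>_def)
        qed (rule \<eta>D)
      qed
    qed
    ultimately show ?thesis using g\<eta> by (simp add: W0_def)
  qed
  have int\<eta>: "integrable lebesgue \<eta>" by (rule W0_integrable[OF \<eta>W \<Omega> p])
  \<comment> \<open>In \<open>ball x0 R\<close> this is the maximum of V and the scaled
    barrier.\<close>
  define w where "w x = V x + \<eta> x" for x
  have w_meas [measurable]: "w \<in> borel_measurable lebesgue" unfolding w_def[abs_def] by measurable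
  have wM: "\<bar>w y\<bar> \<le> b + k" for y using Vb[of y] \<eta>0[of y] \<eta>k[of y] by (auto simp: w_def)
  have wV: "V y \<le> w y" for y using \<eta>0[of y] by (simp add: w_def)
  have win: "AE y in lebesgue. y \<in> ball x0 R \<longrightarrow> k * ?b y \<le> w y"
    using V0 by eventually_elim (auto simp: w_def \<eta>_def)
  have wA: "AE y in lebesgue. y \<in> A \<longrightarrow> \<mu> \<le> w y"
    using VA by eventually_elim (use wV order_trans in blast)
  have wout: "AE y in lebesgue. y \<notin> ball x0 R \<longrightarrow> - (2 * \<mu> * ((16 * dist x0 y / R) powr (\<sigma> / 16) - 1)) \<le> w y"
    using Vout by eventually_elim (use wV order_trans in blast)
  define c where "c = c0 * (\<mu> powr (p - 1) * R powr (- (p * s)))"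
  define T where "T \<epsilon> z = (indicator {z. \<epsilon> \<le> norm (fst z - snd z)} z :: real)" for \<epsilon> and z :: "(real^'n) \<times> (real^'n)"
  have T_meas [measurable]: "T \<epsilon> \<in> borel_measurable leb2" for \<epsilon>
    unfolding T_def[abs_def] using measurable_compose[OF measurable_diff_lebesgue borel_measurable_norm]
    by measurable
  \<comment> \<open>Only the value of \<eta> at the first point occurs. By antisymmetry the
    truncated energy of w against \<eta> is P plus its reflection, and P can be integrated in y for
    fixed x.\<close>
  define P where "P \<epsilon> z = T \<epsilon> z * (spow (w (fst z) - w (snd z)) (p - 1) * \<eta> (fst z) * kern (p * s) (fst z - snd z))" for \<epsilon> z
  have P_meas [measurable]: "P \<epsilon> \<in> borel_measurable leb2" for \<epsilon> unfolding P_def[abs_def] by measurable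
  have intP: "integrable leb2 (P \<epsilon>)" if \<epsilon>: "0 < \<epsilon>" for \<epsilon>
  proof (rule integrableI_bounded)
    define B where "B = (2 * (b + k)) powr (p - 1)"
    let ?g = "\<lambda>h::real^'n. ennreal (indicator {h. \<epsilon> \<le> norm h} h * kern (p * s) h)"
    have "(\<integral>\<^sup>+ z. ennreal (norm (P \<epsilon> z)) \<partial>leb2) \<le> (\<integral>\<^sup>+ z. ennreal (B * \<eta> (fst z)) * ?g (fst z - snd z) \<partial>leb2)"
    proof (rule nn_integral_mono)
      fix z :: "(real^'n) \<times> (real^'n)"
      have "\<bar>w (fst z) - w (snd z)\<bar> \<le> \<bar>w (fst z)\<bar> + \<bar>w (snd z)\<bar>" by (rule abs_triangle_ineq4)
      also have "\<dots> \<le> 2 * (b + k)" using wM[of "fst z"] wM[of "snd z"] by simp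
      finally have "\<bar>w (fst z) - w (snd z)\<bar> \<le> 2 * (b + k)" .
      then have "\<bar>spow (w (fst z) - w (snd z)) (p - 1)\<bar> \<le> B"
        unfolding abs_spow B_def using p by (intro powr_mono2) auto
      then have "norm (P \<epsilon> z) \<le> T \<epsilon> z * (B * \<eta> (fst z) * kern (p * s) (fst z - snd z))"
        unfolding P_def using \<eta>0 by (auto simp: abs_mult T_def indicator_def intro!: mult_right_mono)
      also have "\<dots> = B * \<eta> (fst z) * (indicator {h. \<epsilon> \<le> norm h} (fst z - snd z) * kern (p * s) (fst z - snd z))"
        by (simp add: T_def indicator_def)
      finally show "ennreal (norm (P \<epsilon> z)) \<le> ennreal (B * \<eta> (fst z)) * ?g (fst z - snd z)"
        using \<eta>0 by (subst ennreal_mult[symmetric]) (auto intro!: ennreal_leI simp: B_def)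
    qed
    also have "\<dots> = (\<integral>\<^sup>+ x. ennreal (B * \<eta> x) \<partial>lebesgue) * (\<integral>\<^sup>+ h. ?g h \<partial>lborel)"
      by (rule nn_integral_pair_convolution) measurable
    also have "\<dots> < \<infinity>"
    proof -
      have "(\<integral>\<^sup>+ x. ennreal (B * \<eta> x) \<partial>lebesgue) = ennreal (\<integral>x. B * \<eta> x \<partial>lebesgue)"
        using int\<eta> \<eta>0 by (intro nn_integral_eq_integral) (auto simp: B_def)
      then show ?thesis
        using nn_integral_powr_outside_ball[OF ps \<epsilon>, where 'n='n] by (simp add: ennreal_mult_less_top)
    qed
    finally show "(\<integral>\<^sup>+ z. ennreal (norm (P \<epsilon> z)) \<partial>leb2) < \<infinity>" .
  qed measurable
  have P_le: "integral\<^sup>L leb2 (P \<epsilon>) \<le> - c * integral\<^sup>L lebesgue \<eta>" if \<epsilon>: "0 < \<epsilon>" "\<epsilon> \<le> R / 8" for \<epsilon>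
  proof -
    have "integral\<^sup>L leb2 (P \<epsilon>) = (\<integral>x. (\<integral>y. P \<epsilon> (x, y) \<partial>lebesgue) \<partial>lebesgue)"
      by (rule lebesgue_pair.integral_fst'[OF intP[OF \<epsilon>(1)], symmetric])
    also have "\<dots> \<le> (\<integral>x. - c * \<eta> x \<partial>lebesgue)"
    proof (rule integral_mono_AE)
      show "integrable lebesgue (\<lambda>x. \<integral>y. P \<epsilon> (x, y) \<partial>lebesgue)"
        by (rule lebesgue_pair.integrable_fst'[OF intP[OF \<epsilon>(1)]])
      show "integrable lebesgue (\<lambda>x. - c * \<eta> x)" using int\<eta> by simp
      show "AE x in lebesgue. (\<integral>y. P \<epsilon> (x, y) \<partial>lebesgue) \<le> - c * \<eta> x"
        using V0
      proof eventually_elim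
        fix x assume Vx: "x \<in> ball x0 R \<longrightarrow> 0 \<le> V x"
        show "(\<integral>y. P \<epsilon> (x, y) \<partial>lebesgue) \<le> - c * \<eta> x"
        proof (cases "\<eta> x = 0")
          case True
          then show ?thesis by (simp add: P_def)
        next
          case False
          then have x: "x \<in> ball x0 \<rho>" using \<eta>D by blast
          then have "x \<in> ball x0 R" using R by (auto simp: \<rho>_def)
          then have "0 \<le> V x" using Vx by blast
          \<comment> \<open>Where \<eta> is nonzero, w coincides with the scaled barrier, so the
            pointwise estimate applies at x; elsewhere P vanishes.\<close>
          then have wx: "w x = k * ?b x"
            using False by (auto simp: w_def \<eta>_def max_def min_def split: if_splits)
          have "(\<integral>y. P \<epsilon> (x, y) \<partial>lebesgue) = (\<integral>y. \<eta> x * (indicator {y. \<epsilon> \<le> norm (x - y)} y * (spow (\<sigma> * \<mu> * barrier i x0 (R / 8) x - w y) (p - 1) * kern (p * s) (x - y))) \<partial>lebesgue)"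
            by (intro Bochner_Integration.integral_cong) (auto simp: P_def T_def wx k_def \<rho>_def indicator_def)
          also have "\<dots> = \<eta> x * (\<integral>y. indicator {y. \<epsilon> \<le> norm (x - y)} y * (spow (\<sigma> * \<mu> * barrier i x0 (R / 8) x - w y) (p - 1) * kern (p * s) (x - y)) \<partial>lebesgue)"
            by (rule integral_mult_right_zero)
          also have "\<dots> \<le> \<eta> x * (\<mu> powr (p - 1) * R powr (- (p * s)) *
        (\<sigma> powr (p - 1) * (C1 * 8 powr (p * s)) + \<delta> - (1 / 2) powr (p - 1) * 2 powr (- real CARD('n) - p * s) * m0))"
            using win wA wout x \<epsilon>
            by (intro mult_left_mono \<eta>0 truncated_operator_estimate[OF p s(1) C1 \<sigma> \<delta> tail w_meas wM R lam _ _ _ A mA])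
               (simp_all add: k_def \<rho>_def)
          also have "\<dots> \<le> \<eta> x * (\<mu> powr (p - 1) * R powr (- (p * s)) * (- c0))"
            using small \<eta>0 by (intro mult_left_mono) auto
          also have "\<dots> = - c * \<eta> x" by (simp add: c_def)
          finally show ?thesis .
        qed
      qed
    qed
    also have "\<dots> = - c * integral\<^sup>L lebesgue \<eta>" by simp
    finally show ?thesis .
  qed
  have trunc: "(\<integral>z. T \<epsilon> z * energy_integrand s p V \<eta> z \<partial>leb2) \<le> 2 * (- c * integral\<^sup>L lebesgue \<eta>)"
    if \<epsilon>: "0 < \<epsilon>" "\<epsilon> \<le> R / 8" for \<epsilon>
  proof -
    have intE: "integrable leb2 (energy_integrand s p V \<eta>)"
      by (rule energy_integrand_integrable[OF V_meas \<eta>_meas p gV g\<eta>])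
    have swap: "integrable leb2 (\<lambda>z. P \<epsilon> (snd z, fst z))" "(\<integral>z. P \<epsilon> (snd z, fst z) \<partial>leb2) = integral\<^sup>L leb2 (P \<epsilon>)"
      using lebesgue_pair.integrable_product_swap[OF intP[OF \<epsilon>(1)]] lebesgue_pair.integral_product_swap[OF P_meas[of \<epsilon>]]
      by (simp_all add: case_prod_beta')
    have "(\<integral>z. T \<epsilon> z * energy_integrand s p V \<eta> z \<partial>leb2) \<le> (\<integral>z. P \<epsilon> z + P \<epsilon> (snd z, fst z) \<partial>leb2)"
    proof (rule integral_mono)
      show "integrable leb2 (\<lambda>z. T \<epsilon> z * energy_integrand s p V \<eta> z)"
        by (rule Bochner_Integration.integrable_bound[OF intE]) (auto simp: T_def indicator_def)
      show "integrable leb2 (\<lambda>z. P \<epsilon> z + P \<epsilon> (snd z, fst z))" using intP[OF \<epsilon>(1)] swap by simp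
      fix z :: "(real^'n) \<times> (real^'n)"
      let ?x = "fst z" and ?y = "snd z"
      \<comment> \<open>Passing from V to w = V + \<eta> changes the increment by that of \<eta>, so
        monotonicity of \<open>spow\<close> gives the right sign after multiplication by the
        increment of \<eta>.\<close>
      have mono: "spow (V ?x - V ?y) (p - 1) * (\<eta> ?x - \<eta> ?y) \<le> spow (w ?x - w ?y) (p - 1) * (\<eta> ?x - \<eta> ?y)"
      proof (cases "\<eta> ?x \<ge> \<eta> ?y")
        case True
        then show ?thesis using p by (intro mult_right_mono spow_mono) (auto simp: w_def)
      next
        case False
        then show ?thesis using p by (intro mult_right_mono_neg spow_mono) (auto simp: w_def)
      qed
      have "T \<epsilon> z * energy_integrand s p V \<eta> z \<le> T \<epsilon> z * (spow (w ?x - w ?y) (p - 1) * (\<eta> ?x - \<eta> ?y) * kern (p * s) (?x - ?y))"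
        unfolding energy_integrand_def by (rule mult_left_mono[OF mult_right_mono[OF mono]]) (auto simp: T_def)
      also have "\<dots> = P \<epsilon> z + P \<epsilon> (?y, ?x)"
      proof -
        have "spow (w ?y - w ?x) (p - 1) = - spow (w ?x - w ?y) (p - 1)"
          using spow_minus[of "w ?x - w ?y" "p - 1"] by simp
        moreover have "T \<epsilon> (?y, ?x) = T \<epsilon> z" by (simp add: T_def indicator_def norm_minus_commute)
        ultimately show ?thesis
          by (simp add: P_def kern_commute[of "p * s" ?y ?x] algebra_simps)
      qed
      finally show "T \<epsilon> z * energy_integrand s p V \<eta> z \<le> P \<epsilon> z + P \<epsilon> (?y, ?x)" .
    qed
    also have "\<dots> = 2 * integral\<^sup>L leb2 (P \<epsilon>)" using intP[OF \<epsilon>(1)] swap by simp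
    also have "\<dots> \<le> 2 * (- c * integral\<^sup>L lebesgue \<eta>)" using P_le[OF \<epsilon>] by simp
    finally show ?thesis .
  qed
  \<comment> \<open>The full energy of V against \<eta> converges absolutely, which allows
    \<epsilon> to tend to 0 in an inequality whose right-hand side is free of \<epsilon>.\<close>
  have lim: "(\<lambda>n. \<integral>z. T (1 / real (Suc n)) z * energy_integrand s p V \<eta> z \<partial>leb2) \<longlonglongrightarrow> integral\<^sup>L leb2 (energy_integrand s p V \<eta>)"
  proof (rule integral_dominated_convergence[where w = "\<lambda>z. norm (energy_integrand s p V \<eta> z)"])
    show "integrable leb2 (\<lambda>z. norm (energy_integrand s p V \<eta> z))"
      by (intro integrable_norm energy_integrand_integrable[OF V_meas \<eta>_meas p gV g\<eta>])
    show "AE z in leb2. (\<lambda>n. T (1 / real (Suc n)) z * energy_integrand s p V \<eta> z) \<longlonglongrightarrow> energy_integrand s p V \<eta> z"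
    proof (rule AE_I2)
      fix z :: "(real^'n) \<times> (real^'n)"
      show "(\<lambda>n. T (1 / real (Suc n)) z * energy_integrand s p V \<eta> z) \<longlonglongrightarrow> energy_integrand s p V \<eta> z"
      proof (cases "fst z = snd z")
        case True
        then show ?thesis by (simp add: energy_integrand_def)
      next
        case False
        then have "eventually (\<lambda>n. 1 / real (Suc n) < norm (fst z - snd z)) sequentially"
          using LIMSEQ_Suc[OF lim_1_over_n[where 'a=real]] by (intro order_tendstoD(2)) auto
        then have "eventually (\<lambda>n. T (1 / real (Suc n)) z * energy_integrand s p V \<eta> z = energy_integrand s p V \<eta> z) sequentially"
          by eventually_elim (simp add: T_def)
        then show ?thesis by (rule tendsto_eventually)
      qed
    qed
    show "AE z in leb2. norm (T (1 / real (Suc n)) z * energy_integrand s p V \<eta> z) \<le> norm (energy_integrand s p V \<eta> z)" for n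
      by (rule AE_I2) (simp add: T_def indicator_def)
  qed measurable
  have "eventually (\<lambda>n. 1 / real (Suc n) < R / 8) sequentially"
    using R LIMSEQ_Suc[OF lim_1_over_n[where 'a=real]] by (intro order_tendstoD(2)) auto
  then have "eventually (\<lambda>n. (\<integral>z. T (1 / real (Suc n)) z * energy_integrand s p V \<eta> z \<partial>leb2) \<le> 2 * (- c * integral\<^sup>L lebesgue \<eta>)) sequentially"
    by eventually_elim (intro trunc, auto)
  then have "integral\<^sup>L leb2 (energy_integrand s p V \<eta>) \<le> 2 * (- c * integral\<^sup>L lebesgue \<eta>)"
    by (rule tendsto_upperbound[OF lim]) simp
  \<comment> \<open>The factor 2 comes from the two reflected halves; K < 2c then forces the
    integral of \<eta> to vanish.\<close>
  then have "(2 * c - K) * integral\<^sup>L lebesgue \<eta> \<le> 0"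
    using super[OF \<eta>W \<eta>0] by (simp add: algebra_simps)
  moreover have "0 \<le> integral\<^sup>L lebesgue \<eta>" using \<eta>0 by (intro Bochner_Integration.integral_nonneg) auto
  ultimately have "integral\<^sup>L lebesgue \<eta> = 0" using K by (simp add: mult_le_0_iff c_def)
  then have "AE x in lebesgue. \<eta> x = 0"
    using integral_nonneg_eq_0_iff_AE[OF int\<eta>] \<eta>0 by simp
  with V0 show ?thesis
  proof eventually_elim
    fix y assume y: "y \<in> ball x0 R \<longrightarrow> 0 \<le> V y" and \<eta>y: "\<eta> y = 0"
    show "y \<in> ball x0 (R / 16) \<longrightarrow> \<sigma> * \<mu> / 2 \<le> V y"
    proof
      assume yb: "y \<in> ball x0 (R / 16)"
      \<comment> \<open>R/16 is half of the barrier's radius, where the barrier is at least 1/2;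
        this fixes the ratio 16 of successive balls.\<close>
      then have "1 / 2 \<le> ?b y" using \<rho> by (intro barrier_ge_half) (auto simp: \<rho>_def dist_norm norm_minus_commute)
      then have "k / 2 \<le> k * ?b y" using k by simp
      moreover have "k * ?b y \<le> V y" using \<eta>y k \<open>k / 2 \<le> k * ?b y\<close> by (auto simp: \<eta>_def max_def min_def split: if_splits)
      ultimately show "\<sigma> * \<mu> / 2 \<le> V y" by (simp add: k_def)
    qed
  qed
qed

section \<open>Oscillation decay\<close>

lemma measure_lebesgue_ball:
  "0 \<le> r \<Longrightarrow> measure lebesgue (ball (c :: real^'n) r) = unit_ball_vol (real CARD('n)) * r ^ CARD('n)"
  using content_ball[of r c] by simp

text \<open>Turns the bound attached to another scale i into growth in the distance d relative to
  scale j, the form of the exterior hypothesis of \<open>supersolution_lower_bound\<close>.\<close>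

lemma geometric_powr_quotient:
  fixes \<alpha> R0 \<Lambda> d :: real
  assumes "0 < \<alpha>" "0 < R0" "0 \<le> \<Lambda>" and d: "R0 * (1 / 16) ^ i \<le> 16 * d"
  shows "\<Lambda> * ((1 / 16) ^ i) powr \<alpha> \<le> \<Lambda> * ((1 / 16) ^ j) powr \<alpha> * (16 * d / (R0 * (1 / 16) ^ j)) powr \<alpha>"
proof -
  have "((1 / 16) ^ i) powr \<alpha> = ((1 / 16) ^ j * ((1 / 16) ^ i / (1 / 16) ^ j)) powr \<alpha>" by simp
  also have "\<dots> = ((1 / 16) ^ j) powr \<alpha> * ((1 / 16) ^ i / (1 / 16) ^ j) powr \<alpha>" by (rule powr_mult)
  also have "((1 / 16) ^ i / (1 / 16) ^ j) powr \<alpha> \<le> (16 * d / (R0 * (1 / 16) ^ j)) powr \<alpha>"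
  proof (rule powr_mono2)
    have "(1 / 16) ^ i / (1 / 16) ^ j = (R0 * (1 / 16) ^ i) / (R0 * (1 / 16) ^ j)" using assms by simp
    also have "\<dots> \<le> 16 * d / (R0 * (1 / 16) ^ j)" using assms by (intro divide_right_mono) auto
    finally show "(1 / 16) ^ i / (1 / 16) ^ j \<le> 16 * d / (R0 * (1 / 16) ^ j)" .
  qed (use assms in auto)
  finally have "((1 / 16) ^ i) powr \<alpha> \<le> ((1 / 16) ^ j) powr \<alpha> * (16 * d / (R0 * (1 / 16) ^ j)) powr \<alpha>"
    by (simp add: mult_left_mono)
  then show ?thesis using assms by (simp add: mult.assoc mult_left_mono)
qed

text \<open>At each scale one of the two distances of u from the ends of its interval is at least
  half the length on a set of fixed relative measure, and the growth estimate trims the interval on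
  the next ball from that side. \<open>K\<Lambda>\<close> expresses smallness of the data at the
  coarsest scale.\<close>

lemma oscillation_decay:
  fixes u f :: "real^'n \<Rightarrow> real" and \<Omega> :: "(real^'n) set"
  assumes p: "1 < p" and s: "0 < s" "s < 1"
    and C1: "\<forall>(x0::real^'n) x \<rho> \<epsilon>. 0 < \<rho> \<longrightarrow> 0 < \<epsilon> \<longrightarrow> x \<in> ball x0 \<rho> \<longrightarrow>
      barrier_operator s p i0 \<epsilon> x0 \<rho> x \<le> C1 * \<rho> powr (- (p * s))"
    and \<sigma>: "0 < \<sigma>" "\<sigma> \<le> 1 / 2" and \<delta>: "0 \<le> \<delta>"
    and tail: "(\<integral>\<^sup>+ h. ennreal (tail_kern s p \<sigma> (h :: real^'n)) \<partial>lborel) \<le> ennreal \<delta>"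
    and small: "\<sigma> powr (p - 1) * (C1 * 8 powr (p * s)) + \<delta> - (1 / 2) powr (p - 1) * 2 powr (- real CARD('n) - p * s) *
        (unit_ball_vol (real CARD('n)) * (1 / 16) ^ CARD('n)) \<le> - c0"
    and c0: "0 < c0" and \<alpha>: "\<alpha> = \<sigma> / 16" and \<alpha>p: "\<alpha> * (p - 1) \<le> p * s"
    and \<Omega>: "open \<Omega>" "bounded \<Omega>"
    and ext: "\<forall>z\<in>frontier \<Omega>. \<forall>\<tau>. 0 < \<tau> \<longrightarrow> \<tau> < R0 \<longrightarrow> (\<exists>y. dist z y = \<tau> \<and> ball y (\<tau> / 8) \<inter> \<Omega> = {})"
    and R0: "0 < R0"
    and sol: "weak_solution s p \<Omega> f u" and f: "set_borel_measurable lebesgue \<Omega> f" and K0: "0 \<le> K"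
    and K: "AE x in lebesgue. x \<in> \<Omega> \<longrightarrow> \<bar>f x\<bar> \<le> K"
    and \<Lambda>: "0 < \<Lambda>" and ub: "\<And>x. \<bar>u x\<bar> \<le> \<Lambda> / 2"
    and K\<Lambda>: "K < 2 * c0 * ((\<Lambda> / 2) powr (p - 1) * R0 powr (- (p * s)))"
    and x0: "x0 \<in> closure \<Omega>"
  shows "\<exists>m. AE x in lebesgue. dist x0 x < R0 * (1 / 16) ^ j \<longrightarrow> m \<le> u x \<and> u x \<le> m + \<Lambda> * ((1 / 16) ^ j) powr \<alpha>"
proof -
  define R where "R j = R0 * (1 / 16) ^ j" for j :: nat
  define L where "L j = \<Lambda> * ((1 / 16) ^ j) powr \<alpha>" for j :: nat
  have \<alpha>0: "0 < \<alpha>" using \<sigma> \<alpha> by simp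
  have R: "0 < R j" for j using R0 by (simp add: R_def)
  have L: "0 < L j" for j using \<Lambda> by (simp add: L_def)
  have L0: "L 0 = \<Lambda>" by (simp add: L_def)
  have RSuc: "R (Suc j) = R j / 16" for j by (simp add: R_def)
  have Rle: "R j \<le> R0" for j using R0 by (simp add: R_def power_le_one mult_left_le)
  \<comment> \<open>With \<alpha> = \<sigma>/16 and ln 16 \<le> 4, the required decrease of
    \<open>L j\<close> is at most its fraction \<sigma>/4, which is the gain \<sigma>\<mu>/2 of the
    growth estimate for \<mu> half of \<open>L j\<close>. This is the origin of the value of
    \<alpha>.\<close>
  have LSuc: "L j * (1 - \<sigma> / 4) \<le> L (Suc j)" "L (Suc j) \<le> L j" for j
  proof -
    have eq: "L (Suc j) = L j * (1 / 16) powr \<alpha>"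
      unfolding L_def power_Suc powr_mult by simp
    have "(1 / 16) powr \<alpha> = exp (- (\<alpha> * ln 16))" by (simp add: powr_def ln_div)
    moreover have "1 - \<alpha> * ln 16 \<le> exp (- (\<alpha> * ln 16))" using exp_ge_add_one_self[of "- (\<alpha> * ln 16)"] by simp
    moreover have "\<alpha> * ln 16 \<le> \<sigma> / 4"
    proof -
      have "ln (16::real) = 4 * ln 2" using ln_realpow[of 2 4] by simp
      also have "\<dots> \<le> 4 * 1" using ln_2_less_1 by simp
      finally have "\<alpha> * ln 16 \<le> \<alpha> * 4" using \<alpha>0 by (intro mult_left_mono) auto
      then show ?thesis by (simp add: \<alpha>)
    qed
    ultimately have "1 - \<sigma> / 4 \<le> (1 / 16) powr \<alpha>" by linarith
    then show "L j * (1 - \<sigma> / 4) \<le> L (Suc j)" unfolding eq using L[of j] by (intro mult_left_mono) auto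
    have "(1 / 16) powr \<alpha> \<le> 1" using \<alpha>0 by (intro powr_le1) auto
    then show "L (Suc j) \<le> L j" unfolding eq using L[of j] by (simp add: mult_left_le)
  qed
  have uW: "u \<in> W0 s p \<Omega>" using sol by (simp add: weak_solution_iff)
  note u_meas [measurable] = W0_D(1)[OF uW]
  have u0: "AE x in lebesgue. x \<notin> \<Omega> \<longrightarrow> u x = 0" by (rule W0_D(3)[OF uW])
  have en: "\<bar>integral\<^sup>L leb2 (energy_integrand s p u \<eta>)\<bar> \<le> K * integral\<^sup>L lebesgue \<eta>"
    if "\<eta> \<in> W0 s p \<Omega>" "\<And>x. 0 \<le> \<eta> x" for \<eta>
    using rhs_bound[OF f K K0 that \<Omega> p] sol that by (simp add: weak_solution_iff)
  \<comment> \<open>If the current interval is contained in earlier ones [m_i, m_i + L i], these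
    bounds follow by eliminating m_i. Stating them through m alone avoids carrying the whole
    sequence through the induction.\<close>
  define Inv where "Inv j m \<longleftrightarrow> - (\<Lambda> / 2) \<le> m \<and> m + L j \<le> \<Lambda> / 2 \<and>
     (\<forall>i\<le>j. AE y in lebesgue. dist x0 y < R i \<longrightarrow> m + L j - L i \<le> u y \<and> u y \<le> m + L i)" for j m
  have step: "\<exists>m'. Inv (Suc j) m'" if inv: "Inv j m" for j m
  proof -
    define \<mu> where "\<mu> = L j / 2"
    have \<mu>: "\<mu> > 0" "2 * \<mu> = L j" using L[of j] by (auto simp: \<mu>_def)
    have nest: "- (\<Lambda> / 2) \<le> m" "m + L j \<le> \<Lambda> / 2" using inv by (auto simp: Inv_def)
    have all: "AE y in lebesgue. \<forall>i\<le>j. dist x0 y < R i \<longrightarrow> m + L j - L i \<le> u y \<and> u y \<le> m + L i"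
    proof -
      have "AE y in lebesgue. i \<le> j \<longrightarrow> dist x0 y < R i \<longrightarrow> m + L j - L i \<le> u y \<and> u y \<le> m + L i" for i
        using inv by (cases "i \<le> j") (auto simp: Inv_def)
      then show ?thesis by (subst AE_all_countable) blast
    qed
    have inB: "AE y in lebesgue. dist x0 y < R j \<longrightarrow> m \<le> u y \<and> u y \<le> m + L j"
      using all by eventually_elim force
    have out: "AE y in lebesgue. y \<notin> ball x0 (R j) \<longrightarrow>
        - (2 * \<mu> * ((16 * dist x0 y / R j) powr (\<sigma> / 16) - 1)) \<le> - m + u y \<and>
        - (2 * \<mu> * ((16 * dist x0 y / R j) powr (\<sigma> / 16) - 1)) \<le> (m + L j) + (- u y)"
      using all
    proof (eventually_elim, intro impI)
      fix y assume H: "\<forall>i\<le>j. dist x0 y < R i \<longrightarrow> m + L j - L i \<le> u y \<and> u y \<le> m + L i" and y: "y \<notin> ball x0 (R j)"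
      \<comment> \<open>i is the scale of the annulus containing y; beyond \<open>R 0\<close> the
        global bound on u takes the place of scale 0.\<close>
      have "\<exists>i. R i \<le> 16 * dist x0 y \<and> m + L j - L i \<le> u y \<and> u y \<le> m + L i"
      proof (cases "dist x0 y < R 0")
        case True
        define S where "S i \<longleftrightarrow> dist x0 y < R i" for i
        have "\<exists>i<j. S i \<and> \<not> S (Suc i)"
        proof (rule ccontr)
          assume "\<not> (\<exists>i<j. S i \<and> \<not> S (Suc i))"
          then have "i \<le> j \<longrightarrow> S i" for i by (induction i) (use True in \<open>auto simp: S_def\<close>)
          then show False using y by (auto simp: S_def)
        qed
        then obtain i where i: "i < j" "S i" "\<not> S (Suc i)" by blast
        then have "R i \<le> 16 * dist x0 y" by (simp add: S_def RSuc)
        then show ?thesis using H i by (intro exI[of _ i]) (auto simp: S_def)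
      next
        case False
        then have "R 0 \<le> 16 * dist x0 y" using R[of 0] by simp
        moreover have "m + L j - L 0 \<le> u y" "u y \<le> m + L 0" using ub[of y] nest by (auto simp: L0 abs_le_iff)
        ultimately show ?thesis by blast
      qed
      then obtain i where i: "R i \<le> 16 * dist x0 y" "m + L j - L i \<le> u y" "u y \<le> m + L i" by blast
      have "L i \<le> L j * (16 * dist x0 y / R j) powr \<alpha>"
        unfolding L_def R_def using i(1) \<alpha>0 R0 \<Lambda> by (intro geometric_powr_quotient) (auto simp: R_def)
      then have "L i - L j \<le> 2 * \<mu> * ((16 * dist x0 y / R j) powr (\<sigma> / 16) - 1)"
        by (simp add: \<mu>(2) \<alpha> right_diff_distrib)
      then show "- (2 * \<mu> * ((16 * dist x0 y / R j) powr (\<sigma> / 16) - 1)) \<le> - m + u y \<and>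
        - (2 * \<mu> * ((16 * dist x0 y / R j) powr (\<sigma> / 16) - 1)) \<le> (m + L j) + (- u y)"
        using i by linarith
    qed
    \<comment> \<open>The threshold at scale j is the coarsest one times
      \<open>t powr (\<alpha> * (p - 1) - p * s)\<close> with t \<le> 1 and a nonpositive exponent,
      so it is smallest at the coarsest scale.\<close>
    have Kj: "K < 2 * c0 * (\<mu> powr (p - 1) * R j powr (- (p * s)))"
    proof -
      define t where "t = (1 / 16 :: real) ^ j"
      have t: "0 < t" "t \<le> 1" by (auto simp: t_def power_le_one)
      have "\<mu> = \<Lambda> / 2 * t powr \<alpha>" by (simp add: \<mu>_def L_def t_def)
      then have "\<mu> powr (p - 1) = (\<Lambda> / 2) powr (p - 1) * t powr (\<alpha> * (p - 1))"
        by (simp only: powr_mult powr_powr)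
      moreover have "R j powr (- (p * s)) = R0 powr (- (p * s)) * t powr (- (p * s))"
        by (simp only: R_def t_def powr_mult)
      ultimately have "\<mu> powr (p - 1) * R j powr (- (p * s)) = ((\<Lambda> / 2) powr (p - 1) * R0 powr (- (p * s))) * (t powr (\<alpha> * (p - 1)) * t powr (- (p * s)))"
        by simp
      also have "t powr (\<alpha> * (p - 1)) * t powr (- (p * s)) = t powr (\<alpha> * (p - 1) - p * s)"
        by (simp add: powr_add[symmetric])
      finally have eq: "\<mu> powr (p - 1) * R j powr (- (p * s)) = ((\<Lambda> / 2) powr (p - 1) * R0 powr (- (p * s))) * t powr (\<alpha> * (p - 1) - p * s)" .
      have "1 = t powr 0" using t by simp
      also have "\<dots> \<le> t powr (\<alpha> * (p - 1) - p * s)" using t \<alpha>p by (intro powr_mono') auto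
      finally have "(\<Lambda> / 2) powr (p - 1) * R0 powr (- (p * s)) \<le> \<mu> powr (p - 1) * R j powr (- (p * s))"
        unfolding eq using mult_left_mono[of 1 "t powr (\<alpha> * (p - 1) - p * s)" "(\<Lambda> / 2) powr (p - 1) * R0 powr (- (p * s))"] by simp
      then have "2 * c0 * ((\<Lambda> / 2) powr (p - 1) * R0 powr (- (p * s))) \<le> 2 * c0 * (\<mu> powr (p - 1) * R j powr (- (p * s)))"
        using c0 by (intro mult_left_mono) auto
      then show ?thesis using K\<Lambda> by linarith
    qed
    \<comment> \<open>The relative volume of a ball of radius R/16, the size of the exterior ball
      provided at distance R/2.\<close>
    define m0 where "m0 = unit_ball_vol (real CARD('n)) * (1 / 16) ^ CARD('n)"
    have m0_ball: "measure lebesgue (ball y (R j / 16)) = m0 * R j ^ CARD('n)" for y :: "real^'n"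
      using R[of j] by (subst measure_lebesgue_ball) (auto simp: m0_def power_divide)
    have growth_low: "AE y in lebesgue. y \<in> ball x0 (R j / 16) \<longrightarrow> \<sigma> * \<mu> / 2 \<le> - m + u y"
      if A: "A \<in> sets lebesgue" "A \<subseteq> ball x0 (R j) - ball x0 (R j / 4)" "m0 * R j ^ CARD('n) \<le> measure lebesgue A"
        and VA: "AE y in lebesgue. y \<in> A \<longrightarrow> \<mu> \<le> - m + u y"
        and V\<Omega>: "AE y in lebesgue. y \<in> ball x0 (R j / 8) - \<Omega> \<longrightarrow> \<mu> \<le> - m + u y" for A
    proof (rule supersolution_lower_bound[OF p s C1 \<sigma> \<delta> tail small[folded m0_def] \<Omega> _ _ _ _ R \<mu>(1) A _ V\<Omega> VA _ Kj])
      show "(\<lambda>y. - m + u y) \<in> borel_measurable lebesgue" by measurable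
      show "\<bar>- m + u y\<bar> \<le> \<bar>m\<bar> + \<Lambda> / 2" for y using ub[of y] by linarith
      show "gagliardo s p (\<lambda>y. - m + u y) < \<infinity>" unfolding gagliardo_const_add by (rule W0_D(2)[OF uW])
      show "- K * integral\<^sup>L lebesgue \<eta> \<le> integral\<^sup>L leb2 (energy_integrand s p (\<lambda>y. - m + u y) \<eta>)"
        if "\<eta> \<in> W0 s p \<Omega>" "\<And>x. 0 \<le> \<eta> x" for \<eta>
        unfolding energy_integrand_const_add[abs_def] using en[OF that] by linarith
      show "AE y in lebesgue. y \<in> ball x0 (R j) \<longrightarrow> 0 \<le> - m + u y" using inB by eventually_elim auto
      show "AE y in lebesgue. y \<notin> ball x0 (R j) \<longrightarrow> - (2 * \<mu> * ((16 * dist x0 y / R j) powr (\<sigma> / 16) - 1)) \<le> - m + u y"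
        using out by eventually_elim blast
    qed
    have growth_high: "AE y in lebesgue. y \<in> ball x0 (R j / 16) \<longrightarrow> \<sigma> * \<mu> / 2 \<le> (m + L j) + (- u y)"
      if A: "A \<in> sets lebesgue" "A \<subseteq> ball x0 (R j) - ball x0 (R j / 4)" "m0 * R j ^ CARD('n) \<le> measure lebesgue A"
        and VA: "AE y in lebesgue. y \<in> A \<longrightarrow> \<mu> \<le> (m + L j) + (- u y)"
        and V\<Omega>: "AE y in lebesgue. y \<in> ball x0 (R j / 8) - \<Omega> \<longrightarrow> \<mu> \<le> (m + L j) + (- u y)" for A
    proof (rule supersolution_lower_bound[OF p s C1 \<sigma> \<delta> tail small[folded m0_def] \<Omega> _ _ _ _ R \<mu>(1) A _ V\<Omega> VA _ Kj])
      show "(\<lambda>y. (m + L j) + (- u y)) \<in> borel_measurable lebesgue" by measurable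
      show "\<bar>(m + L j) + (- u y)\<bar> \<le> \<bar>m + L j\<bar> + \<Lambda> / 2" for y using ub[of y] by linarith
      show "gagliardo s p (\<lambda>y. (m + L j) + (- u y)) < \<infinity>" unfolding gagliardo_const_add gagliardo_uminus by (rule W0_D(2)[OF uW])
      show "- K * integral\<^sup>L lebesgue \<eta> \<le> integral\<^sup>L leb2 (energy_integrand s p (\<lambda>y. (m + L j) + (- u y)) \<eta>)"
        if "\<eta> \<in> W0 s p \<Omega>" "\<And>x. 0 \<le> \<eta> x" for \<eta>
        unfolding energy_integrand_const_add[abs_def] energy_integrand_uminus[abs_def] using en[OF that] by simp
      show "AE y in lebesgue. y \<in> ball x0 (R j) \<longrightarrow> 0 \<le> (m + L j) + (- u y)" using inB by eventually_elim auto
      show "AE y in lebesgue. y \<notin> ball x0 (R j) \<longrightarrow> - (2 * \<mu> * ((16 * dist x0 y / R j) powr (\<sigma> / 16) - 1)) \<le> (m + L j) + (- u y)"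
        using out by eventually_elim blast
    qed
    have improve: "(AE y in lebesgue. y \<in> ball x0 (R j / 16) \<longrightarrow> \<sigma> * \<mu> / 2 \<le> - m + u y) \<or>
       (AE y in lebesgue. y \<in> ball x0 (R j / 16) \<longrightarrow> \<sigma> * \<mu> / 2 \<le> (m + L j) + (- u y))"
    proof (cases "ball x0 (R j / 8) \<subseteq> \<Omega>")
      case True
      obtain e :: "real^'n" where e: "norm e = 1" using vector_choose_size[of 1] by auto
      \<comment> \<open>Centre at distance 5R/8 and radius R/4 place Y between the radii 3R/8 and
        7R/8. The two candidate functions sum to 2\<mu>, so at every point of Y one of them is at
        least \<mu>, and one of the two sets carries half the volume of Y, itself 4^N times
        \<open>m0 * R j ^ CARD('n)\<close>.\<close>
      define Y where "Y = ball (x0 + (5 * R j / 8) *\<^sub>R e) (R j / 4)"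
      have Ysub: "Y \<subseteq> ball x0 (R j) - ball x0 (R j / 4)"
      proof
        fix y assume "y \<in> Y"
        define q where "q = (5 * R j / 8) *\<^sub>R e"
        have nq: "norm q = 5 * R j / 8" using e R[of j] by (simp add: q_def)
        have yq: "norm (y - x0 - q) < R j / 4"
          using \<open>y \<in> Y\<close> by (simp add: Y_def q_def dist_norm norm_minus_commute algebra_simps)
        have "norm (y - x0) \<le> norm q + norm (y - x0 - q)" using norm_triangle_ineq[of q "y - x0 - q"] by simp
        moreover have "norm q \<le> norm (y - x0) + norm (y - x0 - q)" using norm_triangle_ineq4[of "y - x0" "y - x0 - q"] by simp
        ultimately show "y \<in> ball x0 (R j) - ball x0 (R j / 4)"
          using nq yq R[of j] by (auto simp: dist_norm norm_minus_commute)
      qed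
      define A1 where "A1 = Y \<inter> {y. \<mu> \<le> - m + u y}"
      define A2 where "A2 = Y \<inter> {y. \<mu> \<le> (m + L j) + (- u y)}"
      have Ys: "Y \<in> sets lebesgue" by (simp add: Y_def)
      have half: "{y. \<mu> \<le> - m + u y} \<in> sets lebesgue" "{y. \<mu> \<le> (m + L j) + (- u y)} \<in> sets lebesgue"
        using borel_measurable_le[of "\<lambda>_. \<mu>" lebesgue "\<lambda>y. - m + u y"] borel_measurable_le[of "\<lambda>_. \<mu>" lebesgue "\<lambda>y. (m + L j) + (- u y)"]
        by simp_all
      have As: "A1 \<in> sets lebesgue" "A2 \<in> sets lebesgue" unfolding A1_def A2_def using Ys half by (auto intro: sets.Int)
      have "Y = A1 \<union> A2" using \<mu> by (auto simp: A1_def A2_def)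
      then have "measure lebesgue Y \<le> measure lebesgue A1 + measure lebesgue A2"
        using As by (simp add: measure_Un_le)
      moreover have "2 * (m0 * R j ^ CARD('n)) \<le> measure lebesgue Y"
      proof -
        have "measure lebesgue Y = unit_ball_vol (real CARD('n)) * (R j / 4) ^ CARD('n)"
          unfolding Y_def using R[of j] by (intro measure_lebesgue_ball) simp
        also have "(R j / 4) ^ CARD('n) = 4 ^ CARD('n) * (R j / 16) ^ CARD('n)"
          by (simp add: power_mult_distrib[symmetric])
        finally have "measure lebesgue Y = 4 ^ CARD('n) * (m0 * R j ^ CARD('n))"
          by (simp add: m0_def power_divide)
        moreover have "(4::real) ^ 1 \<le> 4 ^ CARD('n)" by (intro power_increasing) (auto simp: Suc_leI)
        then have "2 \<le> (4::real) ^ CARD('n)" by simp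
        moreover have "0 \<le> m0 * R j ^ CARD('n)" using R[of j] by (simp add: m0_def)
        ultimately show ?thesis using mult_right_mono by metis
      qed
      ultimately consider "m0 * R j ^ CARD('n) \<le> measure lebesgue A1" | "m0 * R j ^ CARD('n) \<le> measure lebesgue A2"
        by linarith
      then show ?thesis
      proof cases
        case 1
        have "AE y in lebesgue. y \<in> ball x0 (R j / 16) \<longrightarrow> \<sigma> * \<mu> / 2 \<le> - m + u y"
        proof (rule growth_low[OF As(1) _ 1])
          show "A1 \<subseteq> ball x0 (R j) - ball x0 (R j / 4)" using Ysub by (auto simp: A1_def)
        qed (use True in \<open>auto intro!: AE_I2 simp: A1_def simp del: mem_ball\<close>)
        then show ?thesis ..
      next
        case 2
        have "AE y in lebesgue. y \<in> ball x0 (R j / 16) \<longrightarrow> \<sigma> * \<mu> / 2 \<le> (m + L j) + (- u y)"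
        proof (rule growth_high[OF As(2) _ 2])
          show "A2 \<subseteq> ball x0 (R j) - ball x0 (R j / 4)" using Ysub by (auto simp: A2_def)
        qed (use True in \<open>auto intro!: AE_I2 simp: A2_def simp del: mem_ball\<close>)
        then show ?thesis ..
      qed
    next
      case False
      have R8: "0 < R j / 8" using R[of j] by simp
      have "\<Omega> \<inter> ball x0 (R j / 8) \<noteq> {}"
        using x0 R8 unfolding closure_approachable by (metis disjoint_iff dist_commute mem_ball)
      then have "ball x0 (R j / 8) \<inter> frontier \<Omega> \<noteq> {}"
        using False by (intro connected_Int_frontier) auto
      then obtain z where z: "z \<in> frontier \<Omega>" "dist x0 z < R j / 8" by auto
      \<comment> \<open>The frontier point z is within R/8 of x0, so an exterior ball at distance
        R/2 from z with radius R/16 lies between the radii 5R/16 and 11R/16 around x0.\<close>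
      have "R j / 2 < R0" using Rle[of j] R[of j] by linarith
      then obtain y0 where y0: "dist z y0 = R j / 2" "ball y0 (R j / 2 / 8) \<inter> \<Omega> = {}"
        using ext z R[of j] by (metis half_gt_zero)
      define A where "A = ball y0 (R j / 16)"
      have A\<Omega>: "A \<inter> \<Omega> = {}" using y0(2) by (simp add: A_def)
      have Asub: "A \<subseteq> ball x0 (R j) - ball x0 (R j / 4)"
      proof
        fix y assume "y \<in> A"
        then have yy: "dist y0 y < R j / 16" by (simp add: A_def)
        have "dist x0 y \<le> dist x0 z + dist z y0 + dist y0 y"
          by (metis add_right_mono dist_triangle order_trans)
        moreover have "dist z y0 \<le> dist x0 z + dist x0 y + dist y0 y"
          by (smt (verit) dist_commute dist_triangle)
        ultimately show "y \<in> ball x0 (R j) - ball x0 (R j / 4)"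
          using yy y0(1) z(2) R[of j] by auto
      qed
      have As: "A \<in> sets lebesgue" by (simp add: A_def)
      have mA: "m0 * R j ^ CARD('n) \<le> measure lebesgue A" by (simp add: A_def m0_ball)
      have m_sign: "m \<le> 0" "0 \<le> m + L j"
      proof -
        have ae: "AE y in lebesgue. y \<in> A \<longrightarrow> m \<le> 0 \<and> 0 \<le> m + L j"
          using inB u0
        proof (eventually_elim, intro impI)
          fix y assume "dist x0 y < R j \<longrightarrow> m \<le> u y \<and> u y \<le> m + L j" "y \<notin> \<Omega> \<longrightarrow> u y = 0" "y \<in> A"
          moreover have "dist x0 y < R j" "y \<notin> \<Omega>" using \<open>y \<in> A\<close> Asub A\<Omega> by auto
          ultimately show "m \<le> 0 \<and> 0 \<le> m + L j" by auto
        qed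
        have nA: "\<not> (AE y in lebesgue. y \<notin> A)"
        proof
          assume "AE y in lebesgue. y \<notin> A"
          then have "A \<in> null_sets lebesgue" using As by (simp add: AE_iff_null_sets)
          then have "negligible A" by (simp add: negligible_iff_null_sets)
          moreover have "\<not> negligible A" unfolding A_def using R[of j] by (intro open_not_negligible) auto
          ultimately show False by blast
        qed
        have "m \<le> 0 \<and> 0 \<le> m + L j"
        proof (rule ccontr)
          assume "\<not> (m \<le> 0 \<and> 0 \<le> m + L j)"
          with ae have "AE y in lebesgue. y \<notin> A" by simp
          with nA show False ..
        qed
        then show "m \<le> 0" "0 \<le> m + L j" by auto
      qed
      \<comment> \<open>-m and m + L j sum to 2\<mu>, so one of them is at least \<mu>. These are
        the values of the two functions where u = 0, which covers both A and the part of the small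
        ball outside the domain.\<close>
      show ?thesis
      proof (cases "\<mu> \<le> - m")
        case True
        have h: "AE y in lebesgue. y \<notin> \<Omega> \<longrightarrow> \<mu> \<le> - m + u y" using u0 by eventually_elim (use True in auto)
        have "AE y in lebesgue. y \<in> ball x0 (R j / 16) \<longrightarrow> \<sigma> * \<mu> / 2 \<le> - m + u y"
          by (rule growth_low[OF As Asub mA]; use h in eventually_elim) (use A\<Omega> in auto)
        then show ?thesis ..
      next
        case False
        then have \<mu>m: "\<mu> \<le> m + L j" using \<mu> by linarith
        have h: "AE y in lebesgue. y \<notin> \<Omega> \<longrightarrow> \<mu> \<le> (m + L j) + (- u y)"
          using u0 by eventually_elim (use \<mu>m in auto)
        have "AE y in lebesgue. y \<in> ball x0 (R j / 16) \<longrightarrow> \<sigma> * \<mu> / 2 \<le> (m + L j) + (- u y)"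
          by (rule growth_high[OF As Asub mA]; use h in eventually_elim) (use A\<Omega> in auto)
        then show ?thesis ..
      qed
    qed
    have gain: "L j - L (Suc j) \<le> \<sigma> * \<mu> / 2" using LSuc(1)[of j] by (simp add: \<mu>_def algebra_simps)
    \<comment> \<open>Every subinterval of length L (Suc j) of the current interval preserves the
      bounds at coarser scales; the two alternatives select the upper or the lower one.\<close>
    have InvSuc: "Inv (Suc j) m'" if m': "m \<le> m'" "m' + L (Suc j) \<le> m + L j"
      and new: "AE y in lebesgue. y \<in> ball x0 (R j / 16) \<longrightarrow> m' \<le> u y \<and> u y \<le> m' + L (Suc j)" for m'
      unfolding Inv_def
    proof (intro conjI allI impI)
      show "- (\<Lambda> / 2) \<le> m'" "m' + L (Suc j) \<le> \<Lambda> / 2" using m' nest by auto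
      fix i assume "i \<le> Suc j"
      show "AE y in lebesgue. dist x0 y < R i \<longrightarrow> m' + L (Suc j) - L i \<le> u y \<and> u y \<le> m' + L i"
      proof (cases "i = Suc j")
        case True
        then show ?thesis using new by (simp add: RSuc)
      next
        case False
        with \<open>i \<le> Suc j\<close> have ij: "i \<le> j" by simp
        from all show ?thesis
        proof eventually_elim
          fix y assume "\<forall>i\<le>j. dist x0 y < R i \<longrightarrow> m + L j - L i \<le> u y \<and> u y \<le> m + L i"
          then have "dist x0 y < R i \<longrightarrow> m + L j - L i \<le> u y \<and> u y \<le> m + L i" using ij by blast
          then show "dist x0 y < R i \<longrightarrow> m' + L (Suc j) - L i \<le> u y \<and> u y \<le> m' + L i" using m' by linarith
        qed
      qed
    qed
    have inB': "AE y in lebesgue. y \<in> ball x0 (R j / 16) \<longrightarrow> m \<le> u y \<and> u y \<le> m + L j"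
      using inB by eventually_elim (use R[of j] in auto)
    from improve show ?thesis
    proof
      assume "AE y in lebesgue. y \<in> ball x0 (R j / 16) \<longrightarrow> \<sigma> * \<mu> / 2 \<le> - m + u y"
      with inB' have "AE y in lebesgue. y \<in> ball x0 (R j / 16) \<longrightarrow> m + L j - L (Suc j) \<le> u y \<and> u y \<le> m + L j - L (Suc j) + L (Suc j)"
        by eventually_elim (use gain in linarith)
      then have "Inv (Suc j) (m + L j - L (Suc j))" using LSuc(2)[of j] by (intro InvSuc) auto
      then show ?thesis ..
    next
      assume "AE y in lebesgue. y \<in> ball x0 (R j / 16) \<longrightarrow> \<sigma> * \<mu> / 2 \<le> (m + L j) + (- u y)"
      with inB' have "AE y in lebesgue. y \<in> ball x0 (R j / 16) \<longrightarrow> m \<le> u y \<and> u y \<le> m + L (Suc j)"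
        by eventually_elim (use gain in linarith)
      then have "Inv (Suc j) m" using LSuc(2)[of j] by (intro InvSuc) auto
      then show ?thesis ..
    qed
  qed
  have "\<exists>m. Inv j m" for j
  proof (induction j)
    case 0
    have "- (\<Lambda> / 2) \<le> u y \<and> u y \<le> \<Lambda> / 2" for y using ub[of y] by linarith
    then have "Inv 0 (- (\<Lambda> / 2))" by (simp add: Inv_def L0)
    then show ?case ..
  next
    case (Suc j)
    then show ?case using step by blast
  qed
  then obtain m where "Inv j m" by blast
  then have "AE y in lebesgue. dist x0 y < R j \<longrightarrow> m + L j - L j \<le> u y \<and> u y \<le> m + L j" unfolding Inv_def by blast
  then show ?thesis unfolding R_def L_def by auto
qed

text \<open>Two distinct points make the set of quotients nonempty, so that its \<open>Sup\<close>
  is a genuine least upper bound.\<close>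

lemma holder_boundI:
  assumes v: "continuous_on K v" and H: "\<And>x y. x \<in> K \<Longrightarrow> y \<in> K \<Longrightarrow> \<bar>v x - v y\<bar> \<le> H * dist x y powr \<alpha>"
    and ne: "x \<in> K" "y \<in> K" "x \<noteq> y"
  shows "v \<in> holder_space K \<alpha>" "holder_seminorm K \<alpha> v \<le> H"
proof -
  have q: "t \<le> H" if "t \<in> holder_quotients K \<alpha> v" for t
  proof -
    obtain x y where xy: "t = \<bar>v x - v y\<bar> / dist x y powr \<alpha>" "x \<in> K" "y \<in> K" "x \<noteq> y"
      using \<open>t \<in> holder_quotients K \<alpha> v\<close> by (auto simp: holder_quotients_def)
    then show ?thesis using H[of x y] by (simp add: divide_le_eq)
  qed
  then have "bdd_above (holder_quotients K \<alpha> v)" by (rule bdd_aboveI)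
  then show "v \<in> holder_space K \<alpha>" using v by (simp add: holder_space_def)
  have "holder_quotients K \<alpha> v \<noteq> {}" using ne by (auto simp: holder_quotients_def)
  then show "holder_seminorm K \<alpha> v \<le> H" unfolding holder_seminorm_def using q by (rule cSup_least)
qed

lemma open_nonempty_two_points:
  fixes \<Omega> :: "(real^'n) set"
  assumes "open \<Omega>" "\<Omega> \<noteq> {}"
  obtains x y where "x \<in> \<Omega>" "y \<in> \<Omega>" "x \<noteq> y"
proof -
  obtain x where x: "x \<in> \<Omega>" using assms by blast
  obtain r where r: "r > 0" "ball x r \<subseteq> \<Omega>" using assms x by (meson openE)
  obtain e :: "real^'n" where e: "norm e = r / 2" using vector_choose_size[of "r / 2"] r by auto
  then have "x + e \<in> ball x r" "x + e \<noteq> x" using r by (auto simp: dist_norm)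
  then show ?thesis using that[of x "x + e"] x r by auto
qed

theorem theorem1p1:
  fixes s p :: real
  assumes "CARD('n::finite) \<ge> 2" and "0 < s" and "s < 1" and "1 < p"
  shows "\<exists>\<alpha>. 0 < \<alpha> \<and> \<alpha> \<le> s \<and>
    (\<forall>\<Omega>::(real^'n) set. C11_domain \<Omega> \<longrightarrow>
      (\<exists>C>0. \<forall>f u. f \<in> Linf \<Omega> \<longrightarrow> weak_solution s p \<Omega> f u \<longrightarrow>
         (\<exists>v. (AE x in lebesgue. x \<in> closure \<Omega> \<longrightarrow> u x = v x) \<and>
              v \<in> holder_space (closure \<Omega>) \<alpha> \<and>
              Linf_norm \<Omega> u + holder_seminorm (closure \<Omega>) \<alpha> v
                \<le> C * Linf_norm \<Omega> f powr (1 / (p - 1)))))"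
proof -
  note s = assms(2,3) and p = assms(4)
  \<comment> \<open>The flatness exponent of the barrier: i(p - 1) \<ge> 1 implies the condition of
    the symmetric difference estimate, a real restriction for p close to 1.\<close>
  obtain i :: nat where "1 / (p - 1) \<le> real i" using real_arch_simple by blast
  then have "1 \<le> real i * (p - 1)" using p by (simp add: field_simps)
  also have "\<dots> \<le> (2 * real i + 1) * (p - 1)" using p by (intro mult_right_mono) auto
  finally have i: "1 \<le> (2 * real i + 1) * (p - 1)" .
  obtain C1 where C1: "0 \<le> C1" and bar: "\<forall>(x0::real^'n) x \<rho> \<epsilon>. 0 < \<rho> \<longrightarrow> 0 < \<epsilon> \<longrightarrow> x \<in> ball x0 \<rho> \<longrightarrow>
      barrier_operator s p i \<epsilon> x0 \<rho> x \<le> C1 * \<rho> powr (- (p * s))"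
    using barrier_truncated_operator_bound[OF p s i, where 'n='n] by (elim exE conjE) (rule that)
  \<comment> \<open>The favourable contribution of a set with the volume of a ball of relative
    radius 1/16. The barrier and the tail receive a quarter of it each, which leaves m/2 = c0. All
    of these, and hence \<alpha>, are fixed before the domain.\<close>
  define m where "m = (1 / 2) powr (p - 1) * 2 powr (- real CARD('n) - p * s) *
        (unit_ball_vol (real CARD('n)) * (1 / 16) ^ CARD('n))"
  have m: "0 < m" by (simp add: m_def)
  obtain \<sigma> where \<sigma>: "0 < \<sigma>" "\<sigma> \<le> 1 / 2" and \<sigma>s: "\<sigma> / 16 \<le> s" and \<sigma>p: "\<sigma> / 16 * (p - 1) \<le> p * s"
    and \<sigma>C: "\<sigma> powr (p - 1) * (C1 * 8 powr (p * s)) \<le> m / 4"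
    and tail: "(\<integral>\<^sup>+ h. ennreal (tail_kern s p \<sigma> (h :: real^'n)) \<partial>lborel) \<le> ennreal (m / 4)"
    using small_parameter_exists[OF p s(1), of "C1 * 8 powr (p * s)" "m / 4", where 'n='n] C1 m by auto
  define \<alpha> where "\<alpha> = \<sigma> / 16"
  define c0 where "c0 = m / 2"
  have \<alpha>0: "0 < \<alpha>" and c0: "0 < c0" using \<sigma> m by (auto simp: \<alpha>_def c0_def)
  have small: "\<sigma> powr (p - 1) * (C1 * 8 powr (p * s)) + m / 4 - (1 / 2) powr (p - 1) * 2 powr (- real CARD('n) - p * s) *
        (unit_ball_vol (real CARD('n)) * (1 / 16) ^ CARD('n)) \<le> - c0"
    using \<sigma>C unfolding m_def[symmetric] c0_def by linarith
  have main: "\<exists>C>0. \<forall>f u. f \<in> Linf \<Omega> \<longrightarrow> weak_solution s p \<Omega> f u \<longrightarrow>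
         (\<exists>v. (AE x in lebesgue. x \<in> closure \<Omega> \<longrightarrow> u x = v x) \<and>
              v \<in> holder_space (closure \<Omega>) \<alpha> \<and>
              Linf_norm \<Omega> u + holder_seminorm (closure \<Omega>) \<alpha> v
                \<le> C * Linf_norm \<Omega> f powr (1 / (p - 1)))"
    if dom: "C11_domain \<Omega>" for \<Omega> :: "(real^'n) set"
  proof -
    have \<Omega>: "open \<Omega>" "bounded \<Omega>" "\<Omega> \<noteq> {}" using dom by (auto simp: C11_domain_def)
    obtain R0 where R0: "R0 > 0" and ext: "\<forall>z\<in>frontier \<Omega>. \<forall>\<tau>. 0 < \<tau> \<longrightarrow> \<tau> < R0 \<longrightarrow> (\<exists>y. dist z y = \<tau> \<and> ball y (\<tau> / 8) \<inter> \<Omega> = {})"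
      using C11_domain_exterior_ball[OF dom] by blast
    obtain c where c: "c > 0" and bound: "\<forall>f u K. weak_solution s p \<Omega> f u \<longrightarrow> set_borel_measurable lebesgue \<Omega> f \<longrightarrow> 0 \<le> K \<longrightarrow>
     (AE x in lebesgue. x \<in> \<Omega> \<longrightarrow> \<bar>f x\<bar> \<le> K) \<longrightarrow> (AE x in lebesgue. \<bar>u x\<bar> \<le> (K / c) powr (1 / (p - 1)))"
      using weak_solution_bound[OF \<Omega>(1,2) p s(1)] by (elim exE conjE) (rule that)
    obtain x1 x2 where x12: "x1 \<in> closure \<Omega>" "x2 \<in> closure \<Omega>" "x1 \<noteq> x2"
      using open_nonempty_two_points[OF \<Omega>(1,3)] closure_subset[of \<Omega>] by (metis subsetD)
    \<comment> \<open>The first entry makes \<Lambda>/2 a bound for u. The second makes the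
      threshold at scale R0 at least 2K, strictly above K when K > 0. Both conditions are
      homogeneous in K, so D does not depend on f.\<close>
    define D where "D = max ((1 / c) powr (1 / (p - 1))) ((R0 powr (p * s) / c0) powr (1 / (p - 1)))"
    have D0: "0 < D" using c by (simp add: D_def less_max_iff_disj)
    define C where "C = D + 2 * D * (32 / R0) powr \<alpha>"
    have C: "C > 0" using D0 by (simp add: C_def add_pos_nonneg)
    have "\<exists>v. (AE x in lebesgue. x \<in> closure \<Omega> \<longrightarrow> u x = v x) \<and> v \<in> holder_space (closure \<Omega>) \<alpha> \<and>
              Linf_norm \<Omega> u + holder_seminorm (closure \<Omega>) \<alpha> v \<le> C * Linf_norm \<Omega> f powr (1 / (p - 1))"
      if f: "f \<in> Linf \<Omega>" and sol: "weak_solution s p \<Omega> f u" for f u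
    proof -
      define K where "K = Linf_norm \<Omega> f"
      define \<kappa> where "\<kappa> = K powr (1 / (p - 1))"
      define \<Lambda> where "\<Lambda> = 2 * D * \<kappa>"
      have K0: "0 \<le> K" unfolding K_def by (rule Linf_norm_nonneg[OF f])
      have fK: "AE x in lebesgue. x \<in> \<Omega> \<longrightarrow> \<bar>f x\<bar> \<le> K" unfolding K_def by (rule AE_le_Linf_norm[OF f])
      have fm: "set_borel_measurable lebesgue \<Omega> f" using f by (simp add: Linf_def)
      have \<Lambda>0: "0 \<le> \<Lambda>" using D0 by (simp add: \<Lambda>_def \<kappa>_def)
      have uW: "u \<in> W0 s p \<Omega>" using sol by (simp add: weak_solution_iff)
      have u\<Lambda>: "AE x in lebesgue. \<bar>u x\<bar> \<le> \<Lambda> / 2"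
        using bound[rule_format, OF sol fm K0 fK]
      proof eventually_elim
        fix x assume "\<bar>u x\<bar> \<le> (K / c) powr (1 / (p - 1))"
        also have "\<dots> = (1 / c) powr (1 / (p - 1)) * \<kappa>"
          unfolding \<kappa>_def using powr_mult[of "1 / c" K "1 / (p - 1)"] by simp
        also have "\<dots> \<le> D * \<kappa>" by (intro mult_right_mono) (auto simp: D_def \<kappa>_def)
        finally show "\<bar>u x\<bar> \<le> \<Lambda> / 2" by (simp add: \<Lambda>_def)
      qed
      \<comment> \<open>The oscillation estimate asks for a bound at every point; this truncation
        changes u only on a null set.\<close>
      define u' where "u' x = max (- (\<Lambda> / 2)) (min (\<Lambda> / 2) (u x))" for x
      have u'_meas: "u' \<in> borel_measurable lebesgue"
        unfolding u'_def[abs_def] using W0_D(1)[OF uW] by measurable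
      have u'b: "\<bar>u' x\<bar> \<le> \<Lambda> / 2" for x using \<Lambda>0 by (auto simp: u'_def abs_le_iff)
      have u'eq: "AE x in lebesgue. u x = u' x" using u\<Lambda> by eventually_elim (auto simp: u'_def abs_le_iff)
      have sol': "weak_solution s p \<Omega> f u'" by (rule weak_solution_cong_AE[OF sol u'eq u'_meas])
      have osc': "\<exists>m. AE x in lebesgue. dist x0 x < R0 * (1 / 16) ^ j \<longrightarrow> m \<le> u' x \<and> u' x \<le> m + \<Lambda> * ((1 / 16) ^ j) powr \<alpha>"
        if x0: "x0 \<in> closure \<Omega>" for x0 j
      \<comment> \<open>For zero data \<Lambda> = 0 and u' vanishes identically; the iteration needs
        \<Lambda> > 0.\<close>
      proof (cases "K = 0")
        case True
        then have "\<Lambda> = 0" by (simp add: \<Lambda>_def \<kappa>_def)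
        then have "u' x = 0" for x using u'b[of x] by simp
        then show ?thesis using \<open>\<Lambda> = 0\<close> by (intro exI[of _ 0]) simp
      next
        case False
        then have Kpos: "0 < K" using K0 by simp
        have \<kappa>: "0 < \<kappa>" "\<kappa> powr (p - 1) = K" using Kpos p by (auto simp: \<kappa>_def powr_powr)
        have \<Lambda>pos: "0 < \<Lambda>" using D0 \<kappa> by (simp add: \<Lambda>_def)
        have "R0 powr (p * s) / c0 = ((R0 powr (p * s) / c0) powr (1 / (p - 1))) powr (p - 1)"
          using p R0 c0 by (simp add: powr_powr)
        also have "\<dots> \<le> D powr (p - 1)" using p by (intro powr_mono2) (auto simp: D_def)
        finally have Dp: "R0 powr (p * s) / c0 \<le> D powr (p - 1)" .
        have "K < 2 * K" using Kpos by simp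
        also have "\<dots> = 2 * c0 * ((R0 powr (p * s) / c0) * K * R0 powr (- (p * s)))"
          using c0 R0 by (simp add: powr_minus field_simps)
        also have "\<dots> \<le> 2 * c0 * (D powr (p - 1) * K * R0 powr (- (p * s)))"
          using Dp c0 Kpos by (intro mult_left_mono mult_right_mono) auto
        also have "D powr (p - 1) * K = (\<Lambda> / 2) powr (p - 1)"
          by (simp add: \<Lambda>_def powr_mult \<kappa>(2))
        finally have K\<Lambda>: "K < 2 * c0 * ((\<Lambda> / 2) powr (p - 1) * R0 powr (- (p * s)))" .
        have m4: "0 \<le> m / 4" using m by simp
        show ?thesis
          by (rule oscillation_decay[OF p s bar \<sigma> m4 tail small c0 \<alpha>_def \<sigma>p[folded \<alpha>_def] \<Omega>(1,2) ext R0 sol' fm K0 fK \<Lambda>pos u'b K\<Lambda> x0])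
      qed
      have osc: "\<exists>m. AE x in lebesgue. dist x0 x < R0 * (1 / 16) ^ j \<longrightarrow> m \<le> u x \<and> u x \<le> m + \<Lambda> * (1 / 16) powr (\<alpha> * real j)"
        if x0: "x0 \<in> closure \<Omega>" for x0 j
      proof -
        obtain m where "AE x in lebesgue. dist x0 x < R0 * (1 / 16) ^ j \<longrightarrow> m \<le> u' x \<and> u' x \<le> m + \<Lambda> * ((1 / 16) ^ j) powr \<alpha>"
          using osc'[OF x0] by blast
        with u'eq have "AE x in lebesgue. dist x0 x < R0 * (1 / 16) ^ j \<longrightarrow> m \<le> u x \<and> u x \<le> m + \<Lambda> * ((1 / 16) ^ j) powr \<alpha>"
          by eventually_elim auto
        moreover have "((1 / 16 :: real) ^ j) powr \<alpha> = (1 / 16) powr (\<alpha> * real j)"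
          by (simp add: powr_realpow[symmetric] powr_powr mult.commute)
        ultimately show ?thesis by auto
      qed
      obtain v where v: "AE x in lebesgue. x \<in> closure \<Omega> \<longrightarrow> u x = v x" "continuous_on (closure \<Omega>) v"
        "\<forall>x\<in>closure \<Omega>. \<forall>y\<in>closure \<Omega>. \<bar>v x - v y\<bar> \<le> \<Lambda> * (32 / R0) powr \<alpha> * dist x y powr \<alpha>"
        using oscillation_decay_imp_holder[OF \<Omega>(1,2) \<alpha>0 R0 \<Lambda>0 osc u\<Lambda>] by blast
      have hs: "v \<in> holder_space (closure \<Omega>) \<alpha>" "holder_seminorm (closure \<Omega>) \<alpha> v \<le> \<Lambda> * (32 / R0) powr \<alpha>"
        using holder_boundI[OF v(2) _ x12, of "\<Lambda> * (32 / R0) powr \<alpha>" \<alpha>] v(3) by auto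
      have "Linf_norm \<Omega> u \<le> \<Lambda> / 2"
        by (rule Linf_norm_le) (use \<Lambda>0 u\<Lambda> in \<open>auto elim!: eventually_mono\<close>)
      then have "Linf_norm \<Omega> u + holder_seminorm (closure \<Omega>) \<alpha> v \<le> \<Lambda> / 2 + \<Lambda> * (32 / R0) powr \<alpha>"
        using hs(2) by linarith
      also have "\<dots> = C * Linf_norm \<Omega> f powr (1 / (p - 1))"
        by (simp add: \<Lambda>_def C_def \<kappa>_def K_def algebra_simps)
      finally show ?thesis using v(1) hs(1) by blast
    qed
    then show ?thesis using C by blast
  qed
  show ?thesis
    by (rule exI[of _ \<alpha>]) (use \<alpha>0 \<sigma>s main in \<open>auto simp: \<alpha>_def\<close>)
qed

end
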